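(* Let $G$ be a $2$-connected graph on $n$ vertices with $n\ge c(G)+1$ and minimum degree $\delta(G)=k$. Then either $c(G)\ge 2k+2$, or one of the following holds. (i) $c(G)=2k+1$, and at least one of the following is true: - $G\subseteq H(n,2k+1)$; - $G\in\mathcal{H}_{1,n,k}$; - $G\subseteq K_2+\left(K_k\cup \frac{n-k-2}{k-1}K_{k-1}\right)$; - $k=4$ and $G\subseteq K_3+\frac{n-3}{2}K_2$; - $k=3$ and $G\subseteq K_2+\left(S_{n-3-2t}\cup tK_2\right)$ for some $t$. (ii) $c(G)=2k$, and $G\subseteq H(n,2k)$ or $G\in\mathcal{H}_{2,n,k}$.
   Context: Graphs are finite and simple, and are considered up to isomorphism. $c(G)$ denotes the circumference of $G$, i.e. the length of a longest cycle of $G$. $G\subseteq F$ means that $G$ is (isomorphic to) a subgraph of $F$. $K_m$ is the complete graph on $m$ vertices, $I_m$ is the graph with $m$ vertices and no edges, and $\overline{K}_2=I_2$. $aK_m$ is the disjoint union of $a$ copies of $K_m$. $G\cup H$ is the disjoint union of $G$ and $H$. $G+H$ is the join of $G$ and $H$: the graph obtained from vertex-disjoint copies of $G$ and $H$ by adding all edges between them. $S_r$ is the star with $r$ edges (so $r+1$ vertices). A single vertex $\{u\}$ is regarded as a one-vertex graph. An alternative involving $aK_m$ is understood to apply only when $a$ is a non-negative integer, and $t$ denotes a non-negative integer for which the displayed graph makes sense. $H(n,2k)=K_k+I_{n-k}$, and $H(n,2k+1)$ is obtained from $H(n,2k)$ by adding one edge joining two vertices of the independent set $I_{n-k}$. The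 class $\mathcal{H}_{1,n,k}$ is defined for integers $k,n$ such that $n=b(k-1)+3$ for some positive integer $b$. Write $b=b_1+b_2$ with non-negative integers $b_1,b_2$. Let $G_0=\big((b_1K_{k-1}+\{u_1\})\cup(b_2K_{k-1}+\{u_2\})\big)+\{u\}$, and let $G'$ be obtained from $G_0$ by adding the edge $u_1u_2$. Let $G_1$ be obtained from $G'$ by removing the edge $uu_1$, $G_2$ from $G'$ by removing the edge $uu_2$, and $G_3$ from $G'$ by removing both edges $uu_1$ and $uu_2$. The class $\mathcal{H}_{1,n,k}$ consists of all the graphs $G',G_1,G_2,G_3$, over all such choices of $b_1,b_2$. The class $\mathcal{H}_{2,n,k}$ is defined for integers $k,n$ such that $n=b(k-1)+2$ for some positive integer $b$, by $\mathcal{H}_{2,n,k}=\{K_2+bK_{k-1},\ \overline{K}_2+bK_{k-1}\}$. *)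

theory Defs
  imports Main
begin

section \<open>Finite simple graphs\<close>

record 'a ugraph =
  verts :: "'a set"
  edges :: "'a set set"

definition simple_graph :: "'a ugraph \<Rightarrow> bool" where
  "simple_graph G \<longleftrightarrow> finite (verts G) \<and> (\<forall>e \<in> edges G. e \<subseteq> verts G \<and> card e = 2)"

definition adj :: "'a ugraph \<Rightarrow> 'a \<Rightarrow> 'a \<Rightarrow> bool" where
  "adj G u v \<longleftrightarrow> {u, v} \<in> edges G"

definition degree :: "'a ugraph \<Rightarrow> 'a \<Rightarrow> nat" where
  "degree G v = card {u \<in> verts G. adj G v u}"

definition min_degree :: "'a ugraph \<Rightarrow> nat" where
  "min_degree G = Min (degree G ` verts G)"

definition connected_graph :: "'a ugraph \<Rightarrow> bool" where
  "connected_graph G \<longleftrightarrow>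
     verts G \<noteq> {} \<and> (\<forall>u \<in> verts G. \<forall>v \<in> verts G. (adj G)\<^sup>*\<^sup>* u v)"

definition delete_verts :: "'a ugraph \<Rightarrow> 'a set \<Rightarrow> 'a ugraph" where
  "delete_verts G X = \<lparr>verts = verts G - X, edges = {e \<in> edges G. e \<inter> X = {}}\<rparr>"

definition vertex_connected :: "nat \<Rightarrow> 'a ugraph \<Rightarrow> bool" where
  "vertex_connected r G \<longleftrightarrow>
     r < card (verts G) \<and>
     (\<forall>X \<subseteq> verts G. card X < r \<longrightarrow> connected_graph (delete_verts G X))"

definition is_cycle :: "'a ugraph \<Rightarrow> 'a list \<Rightarrow> bool" where
  "is_cycle G p \<longleftrightarrow>
     3 \<le> length p \<and> distinct p \<and> set p \<subseteq> verts G \<and>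
     (\<forall>i < length p. adj G (p ! i) (p ! (Suc i mod length p)))"

text \<open>The circumference of an acyclic graph is taken to be \<open>0\<close>.\<close>

definition circumference :: "'a ugraph \<Rightarrow> nat" where
  "circumference G = Max (insert 0 {length p | p. is_cycle G p})"

definition graph_iso :: "'a ugraph \<Rightarrow> 'b ugraph \<Rightarrow> bool"  (infix "\<simeq>\<^sub>g" 50) where
  "G \<simeq>\<^sub>g F \<longleftrightarrow>
     (\<exists>f. bij_betw f (verts G) (verts F) \<and>
          (\<forall>u \<in> verts G. \<forall>v \<in> verts G. adj G u v \<longleftrightarrow> adj F (f u) (f v)))"

definition subgraph_of :: "'a ugraph \<Rightarrow> 'b ugraph \<Rightarrow> bool"  (infix "\<subseteq>\<^sub>g" 50) where
  "G \<subseteq>\<^sub>g F \<longleftrightarrow>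
     (\<exists>f. inj_on f (verts G) \<and> f ` verts G \<subseteq> verts F \<and>
          (\<forall>u \<in> verts G. \<forall>v \<in> verts G. adj G u v \<longrightarrow> adj F (f u) (f v)))"

definition iso_member :: "'a ugraph \<Rightarrow> 'b ugraph set \<Rightarrow> bool"  (infix "\<in>\<^sub>g" 50) where
  "G \<in>\<^sub>g \<H> \<longleftrightarrow> (\<exists>F \<in> \<H>. G \<simeq>\<^sub>g F)"


section \<open>Constructions\<close>

definition complete_graph :: "nat \<Rightarrow> nat ugraph" where
  "complete_graph m = \<lparr>verts = {..<m}, edges = {{i, j} | i j. i < m \<and> j < m \<and> i \<noteq> j}\<rparr>"

definition empty_graph :: "nat \<Rightarrow> nat ugraph" where
  "empty_graph m = \<lparr>verts = {..<m}, edges = {}\<rparr>"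

definition star :: "nat \<Rightarrow> nat ugraph" where
  "star r = \<lparr>verts = {..r}, edges = {{0, i} | i. 1 \<le> i \<and> i \<le> r}\<rparr>"

definition copies :: "nat \<Rightarrow> 'a ugraph \<Rightarrow> (nat \<times> 'a) ugraph" where
  "copies a G =
     \<lparr>verts = {..<a} \<times> verts G, edges = {Pair i ` e | i e. i < a \<and> e \<in> edges G}\<rparr>"

definition disjoint_union :: "'a ugraph \<Rightarrow> 'b ugraph \<Rightarrow> ('a + 'b) ugraph"  (infix "\<union>\<^sub>g" 65) where
  "G \<union>\<^sub>g H =
     \<lparr>verts = Inl ` verts G \<union> Inr ` verts H,
      edges = (`) Inl ` edges G \<union> (`) Inr ` edges H\<rparr>"

definition join :: "'a ugraph \<Rightarrow> 'b ugraph \<Rightarrow> ('a + 'b) ugraph"  (infix "+\<^sub>g" 65) where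
  "G +\<^sub>g H =
     \<lparr>verts = Inl ` verts G \<union> Inr ` verts H,
      edges = (`) Inl ` edges G \<union> (`) Inr ` edges H
              \<union> {{Inl u, Inr v} | u v. u \<in> verts G \<and> v \<in> verts H}\<rparr>"

definition add_edge :: "'a \<Rightarrow> 'a \<Rightarrow> 'a ugraph \<Rightarrow> 'a ugraph" where
  "add_edge u v G = \<lparr>verts = verts G, edges = insert {u, v} (edges G)\<rparr>"

definition remove_edge :: "'a \<Rightarrow> 'a \<Rightarrow> 'a ugraph \<Rightarrow> 'a ugraph" where
  "remove_edge u v G = \<lparr>verts = verts G, edges = edges G - {{u, v}}\<rparr>"


section \<open>The extremal graphs\<close>

text \<open>For odd \<open>c\<close> the construction only makes sense when the independent part has at
  least two vertices, i.e. \<open>n \<ge> c div 2 + 2\<close>; otherwise the added edge leaves the vertex set.\<close>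

definition H_graph :: "nat \<Rightarrow> nat \<Rightarrow> (nat + nat) ugraph" where
  "H_graph n c =
     (let k = c div 2; B = complete_graph k +\<^sub>g empty_graph (n - k)
      in if even c then B else add_edge (Inr 0) (Inr 1) B)"

text \<open>A single vertex \<open>{u}\<close> is \<open>complete_graph 1\<close>, whose only vertex is \<open>0\<close>. The vertex set of a
  graph in \<open>H1_class\<close> is thus tagged, with the roles of \<open>u\<^sub>1\<close>, \<open>u\<^sub>2\<close>, \<open>u\<close> played by \<open>u1\<close>, \<open>u2\<close>, \<open>u0\<close>
  below.\<close>

type_synonym h1_vertex = "(((nat \<times> nat) + nat) + ((nat \<times> nat) + nat)) + nat"

definition u1 :: h1_vertex where "u1 = Inl (Inl (Inr 0))"
definition u2 :: h1_vertex where "u2 = Inl (Inr (Inr 0))"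
definition u0 :: h1_vertex where "u0 = Inr 0"

definition H1_base :: "nat \<Rightarrow> nat \<Rightarrow> nat \<Rightarrow> h1_vertex ugraph" where
  "H1_base k b1 b2 =
     add_edge u1 u2
       (((copies b1 (complete_graph (k - 1)) +\<^sub>g complete_graph 1) \<union>\<^sub>g
         (copies b2 (complete_graph (k - 1)) +\<^sub>g complete_graph 1)) +\<^sub>g
        complete_graph 1)"

definition H1_class :: "nat \<Rightarrow> nat \<Rightarrow> h1_vertex ugraph set" where
  "H1_class n k =
     (\<Union>(b1, b2) \<in> {(b1, b2). 0 < b1 + b2 \<and> n = (b1 + b2) * (k - 1) + 3}.
        {H1_base k b1 b2,
         remove_edge u0 u1 (H1_base k b1 b2),
         remove_edge u0 u2 (H1_base k b1 b2),
         remove_edge u0 u1 (remove_edge u0 u2 (H1_base k b1 b2))})"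

definition H2_class :: "nat \<Rightarrow> nat \<Rightarrow> (nat + nat \<times> nat) ugraph set" where
  "H2_class n k =
     (\<Union>b \<in> {b. 0 < b \<and> n = b * (k - 1) + 2}.
        {complete_graph 2 +\<^sub>g copies b (complete_graph (k - 1)),
         empty_graph 2 +\<^sub>g copies b (complete_graph (k - 1))})"

end

theory Submission
  imports Defs
begin

text \<open>Let \<open>C\<close> be a longest cycle, of length \<open>c \<le> 2k + 1\<close>. A path with \<open>m\<close> vertices outside \<open>C\<close> whose
  two ends have \<open>u \<ge> 2\<close> neighbours on \<open>C\<close> altogether (and at least one each) splits \<open>C\<close> into \<open>u\<close> gaps, two
  of which have at least \<open>m\<close> inner vertices; hence \<open>2(m + u - 1) \<le> c\<close>, so \<open>m + u \<le> k + 1\<close>. On the other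
  hand, a stable form of the theorem of Erdos and Gallai on long paths between two prescribed
  vertices, applied to a component of \<open>G - C\<close> with (part of) \<open>C\<close> contracted to one vertex, gives paths
  with \<open>m + u \<ge> k + 1\<close>, strictly unless the component is a clique \<open>K\<^sub>m\<close> completely joined to a set of
  \<open>k + 1 - m\<close> vertices of \<open>C\<close>. So every component of \<open>G - C\<close> has this form. Swapping such a clique with
  an equally long gap of \<open>C\<close> yields another longest cycle, so the gap is again a clique with the same
  kind of neighbourhood. Counting gaps leaves \<open>m = 1\<close>, \<open>m = k - 1\<close>, and \<open>m = 2\<close> with \<open>k = 4\<close>, and the
  swaps determine the graph in each case.\<close>

section \<open>Long paths between two vertices\<close>

text \<open>Two gaps are long because two distinct feet, one of each end of the path, split the
  cycle into two arcs, and each arc somewhere passes from feet of one end to feet of the other; only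
  there does the whole path fit as a detour. Everywhere else a gap is merely nonempty. The surplus
  of \<open>2k + 1\<close> over \<open>2k\<close> disappears by parity, so the upper bound
  \<open>k + 1\<close> agrees exactly with the lower bound that the path theorem provides. There is
  no room for a contradiction in general, which is why the path theorem has to describe its extremal
  case: that description, not the existence of long paths, determines the components. Contraction
  trades feet for path length: up to \<open>D\<close> feet of a vertex become a single neighbour, so
  the degree bound drops to \<open>k - D + 1\<close>, while a path starting at a vertex with
  \<open>D\<close> feet recovers exactly this loss. The exceptional graphs for \<open>k = 4\<close>
  and \<open>k = 3\<close> come from solutions of the gap count in which no slack at all is left:
  the former on the whole cycle, the latter on the longer of two arcs.\<close>

definition outer :: "('a \<Rightarrow> 'a \<Rightarrow> bool) \<Rightarrow> 'a set \<Rightarrow> 'a set \<Rightarrow> 'a set" where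
  "outer R U T = {w \<in> U - T. \<exists>t \<in> T. R t w}"

text \<open>Only the endpoint of each step must lie in \<open>S\<close>; the start \<open>w\<close>
  may lie outside, hence the hypothesis \<open>w \<in> S\<close> in
  \<open>reach_subset\<close>.\<close>

definition reach :: "('a \<Rightarrow> 'a \<Rightarrow> bool) \<Rightarrow> 'a set \<Rightarrow> 'a \<Rightarrow> 'a set" where
  "reach R S w = {z. (\<lambda>u v. R u v \<and> v \<in> S)\<^sup>*\<^sup>* w z}"

lemma reach_refl: "w \<in> reach R S w"
  by (simp add: reach_def)

lemma reach_step: "u \<in> reach R S w \<Longrightarrow> R u v \<Longrightarrow> v \<in> S \<Longrightarrow> v \<in> reach R S w"
  unfolding reach_def by (auto intro: rtranclp.rtrancl_into_rtrancl)

lemma reach_subset: "w \<in> S \<Longrightarrow> reach R S w \<subseteq> S"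
proof
  fix z assume "w \<in> S" "z \<in> reach R S w"
  then have "(\<lambda>u v. R u v \<and> v \<in> S)\<^sup>*\<^sup>* w z" by (simp add: reach_def)
  then show "z \<in> S" using \<open>w \<in> S\<close> by (induction rule: rtranclp_induct) auto
qed

lemma reach_path:
  assumes "w \<in> S" "z \<in> reach R S w"
  obtains p where "p \<noteq> []" "distinct p" "set p \<subseteq> S" "hd p = w" "last p = z" "successively R p"
proof -
  have "(\<lambda>u v. R u v \<and> v \<in> S)\<^sup>*\<^sup>* w z" using assms(2) by (simp add: reach_def)
  then have "\<exists>p. p \<noteq> [] \<and> distinct p \<and> set p \<subseteq> S \<and> hd p = w \<and> last p = z \<and> successively R p"
  proof (induction rule: rtranclp_induct)
    case base
    show ?case using \<open>w \<in> S\<close> by (intro exI[of _ "[w]"]) auto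
  next
    case (step y z)
    then obtain p where p: "p \<noteq> []" "distinct p" "set p \<subseteq> S" "hd p = w" "last p = y" "successively R p"
      by blast
    show ?case
    proof (cases "z \<in> set p")
      case True
      then obtain p1 p2 where "p = p1 @ z # p2" by (meson split_list)
      then show ?thesis using p
        by (intro exI[of _ "p1 @ [z]"]) (auto simp: successively_append_iff hd_append)
    next
      case False
      then show ?thesis using p step.hyps
        by (intro exI[of _ "p @ [z]"]) (auto simp: successively_append_iff)
    qed
  qed
  then show thesis using that by blast
qed

section \<open>Disjoint unions of cliques of equal size\<close>

lemma successively_clique:
  "distinct xs \<Longrightarrow> (\<And>u v. u \<in> set xs \<Longrightarrow> v \<in> set xs \<Longrightarrow> u \<noteq> v \<Longrightarrow> R u v) \<Longrightarrow> successively R xs"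
proof (induction xs)
  case (Cons a xs)
  then show ?case by (cases xs) (auto simp: successively_Cons)
qed simp

text \<open>For symmetric irreflexive \<open>R\<close> the graph induced on \<open>S\<close> is a
  disjoint union of complete graphs on \<open>m\<close> vertices. The degree is written with
  \<open>Suc\<close>, so that \<open>m = 0\<close> is impossible for nonempty \<open>S\<close> and
  \<open>cliques R S (d - 1)\<close> implies \<open>2 \<le> d\<close> despite truncated
  subtraction.\<close>

definition cliques :: "('a \<Rightarrow> 'a \<Rightarrow> bool) \<Rightarrow> 'a set \<Rightarrow> nat \<Rightarrow> bool" where
  "cliques R S m \<longleftrightarrow> (\<forall>v\<in>S. Suc (card {w \<in> S. R v w}) = m) \<and>
     (\<forall>u\<in>S. \<forall>v\<in>S. \<forall>w\<in>S. R u v \<longrightarrow> R v w \<longrightarrow> u \<noteq> w \<longrightarrow> R u w)"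

lemma cliques_deg: "cliques R S m \<Longrightarrow> v \<in> S \<Longrightarrow> Suc (card {w \<in> S. R v w}) = m"
  unfolding cliques_def by blast

lemma cliques_trans:
  "cliques R S m \<Longrightarrow> u \<in> S \<Longrightarrow> v \<in> S \<Longrightarrow> w \<in> S \<Longrightarrow> R u v \<Longrightarrow> R v w \<Longrightarrow> u \<noteq> w \<Longrightarrow> R u w"
  unfolding cliques_def by blast

text \<open>In a complete block every ordering is a path, so the last vertex can be
  prescribed.\<close>

lemma cliques_list:
  assumes sym: "\<And>u v. R u v \<Longrightarrow> R v u" and irr: "\<And>u. \<not> R u u"
    and "finite S" "cliques R S m" "v \<in> S"
  obtains xs where "distinct xs" "set xs = insert v {w \<in> S. R v w}" "length xs = m"
    "successively R xs" "xs \<noteq> []" "last xs = v"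
proof -
  have "finite {w \<in> S. R v w}" using assms by simp
  then obtain ys where ys: "set ys = {w \<in> S. R v w}" "distinct ys"
    using finite_distinct_list by blast
  have v: "v \<notin> set ys" using irr ys by auto
  have "length ys = card {w \<in> S. R v w}" using ys distinct_card by metis
  then have len: "length (ys @ [v]) = m" using cliques_deg[OF assms(4,5)] by simp
  have "successively R (ys @ [v])"
  proof (rule successively_clique)
    show "distinct (ys @ [v])" using ys v by simp
    fix a b assume "a \<in> set (ys @ [v])" "b \<in> set (ys @ [v])" "a \<noteq> b"
    then consider "a = v" "R v b" | "b = v" "R v a" | "R v a" "R v b" "a \<in> S" "b \<in> S"
      using ys by auto
    then show "R a b"
    proof cases
      case 3
      then show ?thesis using sym[of v a] assms(4,5) \<open>a \<noteq> b\<close> unfolding cliques_def by blast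
    qed (auto intro: sym)
  qed
  then show thesis using that[of "ys @ [v]"] ys v len by auto
qed

text \<open>Nonadjacent vertices lie in different blocks, which are disjoint by transitivity. The
  two paths are later joined through a vertex adjacent to both blocks.\<close>

lemma cliques_two_lists:
  assumes sym: "\<And>u v. R u v \<Longrightarrow> R v u" and irr: "\<And>u. \<not> R u u"
    and "finite S" "cliques R S m" "u \<in> S" "v \<in> S" "u \<noteq> v" "\<not> R u v"
  obtains xs ys where "distinct (xs @ ys)" "set xs \<subseteq> S" "set ys \<subseteq> S" "length xs = m" "length ys = m"
    "successively R xs" "successively R ys" "xs \<noteq> []" "ys \<noteq> []"
proof -
  obtain xs where xs: "distinct xs" "set xs = insert u {w \<in> S. R u w}" "length xs = m"
    "successively R xs" "xs \<noteq> []" "last xs = u"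
    by (rule cliques_list[OF sym irr assms(3,4,5)])
  obtain ys where ys: "distinct ys" "set ys = insert v {w \<in> S. R v w}" "length ys = m"
    "successively R ys" "ys \<noteq> []" "last ys = v"
    by (rule cliques_list[OF sym irr assms(3,4,6)])
  have "set xs \<inter> set ys = {}"
  proof (rule ccontr)
    assume "set xs \<inter> set ys \<noteq> {}"
    then obtain z where "z = u \<or> z \<in> S \<and> R u z" "z = v \<or> z \<in> S \<and> R v z"
      using xs(2) ys(2) by blast
    then consider "R v u" | "R u v" | "R u z" "R z v" "z \<in> S" using assms(7) sym by blast
    then show False
    proof cases
      case 3
      then show False using assms(4-8) unfolding cliques_def by blast
    qed (use sym assms(8) in auto)
  qed
  then show thesis using that[of xs ys] xs ys assms(5,6) by auto
qed

lemma cliques_card: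
  assumes irr: "\<And>u. \<not> R u u" and "finite S" "cliques R S m" "v \<in> S"
    and "\<And>u v. u \<in> S \<Longrightarrow> v \<in> S \<Longrightarrow> u \<noteq> v \<Longrightarrow> R u v"
  shows "card S = m"
proof -
  have "{w \<in> S. R v w} = S - {v}" using assms by blast
  moreover have "Suc (card (S - {v})) = card S" using card_Suc_Diff1[OF assms(2,4)] .
  ultimately show ?thesis using cliques_deg[OF assms(3,4)] by simp
qed

text \<open>Only the inner vertices are listed, so \<open>length p\<close> counts what the path
  gains between its ends.\<close>

definition link :: "('a \<Rightarrow> 'a \<Rightarrow> bool) \<Rightarrow> 'a set \<Rightarrow> 'a \<Rightarrow> 'a \<Rightarrow> 'a list \<Rightarrow> bool" where
  "link R S x y p \<longleftrightarrow> p \<noteq> [] \<and> distinct p \<and> set p \<subseteq> S \<and> successively R (x # p @ [y])"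

text \<open>Induction: take a minimal nonempty \<open>T \<subseteq> S\<close> with at most one outer neighbour \<open>w\<close> in \<open>S \<union> {y}\<close>.
  Then \<open>x\<close> has a neighbour \<open>x'\<close> in \<open>T\<close>, and the statement applies to \<open>T - {x'}\<close> with the ends \<open>x'\<close>, \<open>w\<close>
  and \<open>d - 1\<close>. If nothing is gained, then \<open>w = y\<close> and \<open>T\<close> is a single clique, and one continues with
  \<open>S - T\<close>.\<close>
lemma long_link_or_cliques:
  fixes R :: "'a \<Rightarrow> 'a \<Rightarrow> bool"
  assumes sym: "\<And>u v. R u v \<Longrightarrow> R v u" and irr: "\<And>u. \<not> R u u"
  shows "finite S \<Longrightarrow> S \<noteq> {} \<Longrightarrow> x \<notin> S \<Longrightarrow> y \<notin> S \<Longrightarrow> x \<noteq> y \<Longrightarrow>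
    (\<And>T. T \<subseteq> S \<Longrightarrow> T \<noteq> {} \<Longrightarrow> 2 \<le> card (outer R (insert x (insert y S)) T)) \<Longrightarrow>
    (\<And>v. v \<in> S \<Longrightarrow> d \<le> card {w \<in> insert x (insert y S). R v w}) \<Longrightarrow>
    (\<exists>p. link R S x y p \<and> d \<le> length p) \<or>
    (\<forall>v\<in>S. R x v \<and> R v y) \<and> cliques R S (d - 1)"
proof (induction "card S" arbitrary: S x y d rule: less_induct)
  case less
  note fin = less.prems(1) and x = less.prems(3) and y = less.prems(4) and xy = less.prems(5)
    and cut = less.prems(6) and deg = less.prems(7)
  define Q where "Q T \<longleftrightarrow> T \<subseteq> S \<and> T \<noteq> {} \<and> card (outer R (insert y S) T) \<le> 1" for T
  \<comment> \<open>\<open>S\<close> itself qualifies, with \<open>y\<close> as its only possible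
    outer neighbour; hence a minimal \<open>T\<close> exists.\<close>
  have "outer R (insert y S) S \<subseteq> {y}" by (auto simp: outer_def)
  then have "card (outer R (insert y S) S) \<le> card {y}" by (intro card_mono) auto
  then have "Q S" using less.prems by (simp add: Q_def)
  then obtain T where QT: "Q T" and Tmin: "\<And>T'. Q T' \<Longrightarrow> card T \<le> card T'"
    using ex_has_least_nat[of Q S card] by auto
  have TS: "T \<subseteq> S" "T \<noteq> {}" and Tout: "card (outer R (insert y S) T) \<le> 1"
    using QT by (auto simp: Q_def)
  have finT: "finite T" using TS fin finite_subset by blast
  \<comment> \<open>By minimality, proper subsets of \<open>T\<close> have two outer neighbours even
    without \<open>x\<close>. This is the cut hypothesis for the induction on
    \<open>T - {x'}\<close>, where \<open>x\<close> is dropped.\<close>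
  have Tsub: "2 \<le> card (outer R (insert y S) T')" if "T' \<subset> T" "T' \<noteq> {}" for T'
  proof -
    have "card T' < card T" using that finT psubset_card_mono by blast
    then have "\<not> Q T'" using Tmin by (metis not_le)
    then show ?thesis using that TS by (auto simp: Q_def)
  qed
  have fo: "finite (outer R (insert y S) T)" using fin by (auto simp: outer_def)
  have osub: "outer R (insert x (insert y S)) T \<subseteq> insert x (outer R (insert y S) T)"
    by (auto simp: outer_def)
  have xin: "x \<in> outer R (insert x (insert y S)) T"
  proof (rule ccontr)
    assume "x \<notin> outer R (insert x (insert y S)) T"
    then have "outer R (insert x (insert y S)) T \<subseteq> outer R (insert y S) T" using osub by blast
    from card_mono[OF fo this] show False using cut[OF TS] Tout by linarith
  qed
  have "2 \<le> card (insert x (outer R (insert y S) T))"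
    using le_trans[OF cut[OF TS] card_mono[OF _ osub]] fo by simp
  moreover have "card (insert x (outer R (insert y S) T)) \<le> Suc (card (outer R (insert y S) T))"
    using fo by (simp add: card_insert_if)
  ultimately have "card (outer R (insert y S) T) = 1" using Tout by linarith
  then obtain w where w: "outer R (insert y S) T = {w}" by (auto simp: card_1_singleton_iff)
  obtain x' where x': "x' \<in> T" "R x' x" using xin by (auto simp: outer_def)
  have wS: "w \<in> insert y S" "w \<notin> T" and wT: "\<exists>t\<in>T. R t w" using w by (auto simp: outer_def)
  have wx: "w \<noteq> x" using wS x xy by auto
  have nbT: "z \<in> T \<or> z = x \<or> z = w" if "t \<in> T" "R t z" "z \<in> insert x (insert y S)" for t z
  proof (rule ccontr)
    assume n: "\<not> ?thesis"
    then have "z \<in> outer R (insert y S) T" using that by (auto simp: outer_def)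
    then show False using w n by auto
  qed
  \<comment> \<open>A path through \<open>T\<close> to \<open>w\<close> continues to
    \<open>y\<close> inside the component of \<open>w\<close> in \<open>S - T\<close>. That
    component is adjacent to \<open>y\<close>, since otherwise its union with \<open>T\<close> would
    have \<open>x\<close> as its only outer neighbour. Unless \<open>w = y\<close>, at least the
    vertex \<open>w\<close> is gained.\<close>
  have ext: "\<exists>p. link R S x y p \<and> length p' \<le> length p \<and> (w \<noteq> y \<longrightarrow> length p' < length p)"
    if p': "link R T x w p'" for p'
  proof (cases "w = y")
    case True
    then show ?thesis using p' TS unfolding link_def by (intro exI[of _ p']) auto
  next
    case False
    then have wST: "w \<in> S - T" using wS by auto
    let ?D = "reach R (S - T) w"
    have D: "?D \<subseteq> S - T" by (rule reach_subset[OF wST])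
    have "\<exists>z\<in>?D. R z y"
    proof (rule ccontr)
      assume no: "\<not> ?thesis"
      have "outer R (insert x (insert y S)) (T \<union> ?D) \<subseteq> {x}"
      proof
        fix z assume "z \<in> outer R (insert x (insert y S)) (T \<union> ?D)"
        then obtain t where t: "z \<in> insert x (insert y S)" "z \<notin> T" "z \<notin> ?D" "t \<in> T \<union> ?D" "R t z"
          by (auto simp: outer_def)
        show "z \<in> {x}"
        proof (cases "t \<in> T")
          case True
          then show ?thesis using nbT[of t z] t reach_refl[of w R "S - T"] by auto
        next
          case False
          then have "t \<in> ?D" using t by auto
          then show ?thesis using t no reach_step[of t R "S - T" w z] by auto
        qed
      qed
      then have "card (outer R (insert x (insert y S)) (T \<union> ?D)) \<le> card {x}"
        by (intro card_mono) auto
      moreover have "2 \<le> card (outer R (insert x (insert y S)) (T \<union> ?D))"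
        using cut[of "T \<union> ?D"] TS D by auto
      ultimately show False by simp
    qed
    then obtain z where z: "z \<in> ?D" "R z y" by blast
    obtain q where q: "q \<noteq> []" "distinct q" "set q \<subseteq> S - T" "hd q = w" "last q = z" "successively R q"
      using reach_path[OF wST z(1)] by blast
    have "link R S x y (p' @ q)"
      using p' q z TS unfolding link_def
      by (auto simp: successively_append_iff successively_Cons)
    then show ?thesis using q by (intro exI[of _ "p' @ q"]) auto
  qed
  have struct: "(\<exists>p. link R S x y p \<and> d \<le> length p) \<or>
    w = y \<and> (\<forall>v\<in>T. R x v \<and> R v y) \<and> cliques R T (d - 1)"
  proof (cases "T = {x'}")
    case True
    have wx': "R x' w" using wT True by auto
    have "link R T x w [x']" using wx' x' sym True by (auto simp: link_def)
    then obtain p where p: "link R S x y p" "1 \<le> length p" "w \<noteq> y \<longrightarrow> 1 < length p"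
      using ext by fastforce
    \<comment> \<open>The sole vertex of \<open>T\<close> has no neighbours besides \<open>x\<close>
      and \<open>w\<close>, so \<open>d\<close> is at most 2.\<close>
    have "{z \<in> insert x (insert y S). R x' z} \<subseteq> {x, w}" using nbT[of x'] True irr by auto
    then have "card {z \<in> insert x (insert y S). R x' z} \<le> card {x, w}" by (intro card_mono) auto
    moreover have "card {x, w} = 2" using wx by auto
    ultimately have d2: "d \<le> 2" using deg[of x'] True TS by auto
    show ?thesis
    proof (cases "w = y \<and> d = 2")
      case False
      then show ?thesis using p d2 by (intro disjI1 exI[of _ p]) auto
    next
      case c: True
      have e: "{w. w = x' \<and> R x' w} = {}" using irr by auto
      have "cliques R {x'} 1" using irr by (auto simp: cliques_def e)
      then show ?thesis using c True x' wx' sym by auto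
    qed
  next
    case False
    let ?S' = "T - {x'}"
    have ne: "?S' \<noteq> {}" using False TS x' by auto
    have finS': "finite ?S'" using finT by simp
    have lt: "card ?S' < card S"
      using TS x' fin by (meson card_Diff1_less card_mono finT order_less_le_trans)
    \<comment> \<open>Vertices of \<open>T - {x'}\<close> lose at most the neighbour
      \<open>x\<close>, hence the bound \<open>d - 1\<close>.\<close>
    have "(\<exists>p. link R ?S' x' w p \<and> d - 1 \<le> length p) \<or>
      (\<forall>v\<in>?S'. R x' v \<and> R v w) \<and> cliques R ?S' (d - 1 - 1)"
    proof (rule less.hyps[OF lt])
      fix T' assume T': "T' \<subseteq> ?S'" "T' \<noteq> {}"
      have "outer R (insert y S) T' \<subseteq> outer R (insert x' (insert w ?S')) T'"
      proof
        fix z assume "z \<in> outer R (insert y S) T'"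
        then obtain t where t: "z \<in> insert y S" "z \<notin> T'" "t \<in> T'" "R t z" by (auto simp: outer_def)
        then have "z \<in> T \<or> z = w" using nbT[of t z] T' x xy by auto
        then show "z \<in> outer R (insert x' (insert w ?S')) T'" using t by (auto simp: outer_def)
      qed
      moreover have "finite (outer R (insert x' (insert w ?S')) T')"
        using finT by (auto simp: outer_def)
      moreover have "2 \<le> card (outer R (insert y S) T')" using Tsub[of T'] T' x' by auto
      ultimately show "2 \<le> card (outer R (insert x' (insert w ?S')) T')"
        by (meson card_mono order_trans)
    next
      fix v assume v: "v \<in> ?S'"
      have "{z \<in> insert x (insert y S). R v z} \<subseteq> insert x {z \<in> insert x' (insert w ?S'). R v z}"
        using nbT[of v] v by auto
      moreover have f: "finite {z \<in> insert x' (insert w ?S'). R v z}" using finT by auto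
      ultimately have "card {z \<in> insert x (insert y S). R v z} \<le>
          card (insert x {z \<in> insert x' (insert w ?S'). R v z})" by (intro card_mono) auto
      also have "\<dots> \<le> Suc (card {z \<in> insert x' (insert w ?S'). R v z})" using f by (simp add: card_insert_if)
      finally show "d - 1 \<le> card {z \<in> insert x' (insert w ?S'). R v z}"
        using deg[of v] v TS by auto
    qed (use finT ne wS x' in auto)
    then show ?thesis
    proof
      assume "\<exists>p. link R ?S' x' w p \<and> d - 1 \<le> length p"
      then obtain p where p: "link R ?S' x' w p" "d - 1 \<le> length p" by blast
      have "link R T x w (x' # p)" using p x' sym unfolding link_def
        by (auto simp: successively_Cons)
      then obtain q where "link R S x y q" "length (x' # p) \<le> length q" using ext by blast
      then show ?thesis using p by (intro disjI1 exI[of _ q]) auto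
    next
      assume st: "(\<forall>v\<in>?S'. R x' v \<and> R v w) \<and> cliques R ?S' (d - 1 - 1)"
      obtain v0 where v0: "v0 \<in> ?S'" using ne by blast
      have cS: "Suc (card {z \<in> ?S'. R v z}) = d - 1 - 1" if "v \<in> ?S'" for v
        using st that unfolding cliques_def by blast
      have d3: "3 \<le> d" using cS[OF v0] by linarith
      \<comment> \<open>Blocks have \<open>d - 2\<close> vertices. Without \<open>x\<close>, a
        vertex would have at most \<open>d - 3\<close> neighbours in its block together with
        \<open>x'\<close> and \<open>w\<close>, fewer than \<open>d\<close>.\<close>
      have toxw: "R v x" if v: "v \<in> ?S'" for v
      proof (rule ccontr)
        assume "\<not> R v x"
        then have "{z \<in> insert x (insert y S). R v z} \<subseteq> insert x' (insert w {z \<in> ?S'. R v z})"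
          using nbT[of v] v by auto
        then have "card {z \<in> insert x (insert y S). R v z} \<le> card (insert x' (insert w {z \<in> ?S'. R v z}))"
          using finT by (intro card_mono) auto
        also have "\<dots> \<le> Suc (Suc (card {z \<in> ?S'. R v z}))" using finT by (simp add: card_insert_if)
        also have "\<dots> < d" using cS[OF v] d3 by linarith
        finally show False using deg[of v] v TS by auto
      qed
      show ?thesis
      proof (cases "\<exists>u\<in>?S'. \<exists>v\<in>?S'. u \<noteq> v \<and> \<not> R u v")
        case True
        then obtain u v where uv: "u \<in> ?S'" "v \<in> ?S'" "u \<noteq> v" "\<not> R u v" by blast
        obtain xs ys where l: "distinct (xs @ ys)" "set xs \<subseteq> ?S'" "set ys \<subseteq> ?S'"
          "length xs = d - 1 - 1" "length ys = d - 1 - 1"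
          "successively R xs" "successively R ys" "xs \<noteq> []" "ys \<noteq> []"
          by (rule cliques_two_lists[OF sym irr finS' conjunct2[OF st] uv])
        have h: "hd xs \<in> ?S'" "last xs \<in> ?S'" "hd ys \<in> ?S'" "last ys \<in> ?S'"
          using l hd_in_set last_in_set by blast+
        \<comment> \<open>Two blocks joined through \<open>x'\<close> give
          \<open>2 * (d - 2) + 1\<close> inner vertices, at least \<open>d\<close> because
          \<open>3 \<le> d\<close>.\<close>
        have "link R T x w (xs @ x' # ys)"
          using l h st toxw sym x' unfolding link_def
          by (auto simp: successively_append_iff successively_Cons)
        then obtain q where q: "link R S x y q" "length (xs @ x' # ys) \<le> length q" using ext by blast
        have "d \<le> length (xs @ x' # ys)" using l d3 by auto
        then show ?thesis using q by (intro disjI1 exI[of _ q]) auto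
      next
        case all: False
        have cS': "card ?S' = d - 1 - 1"
          by (rule cliques_card[OF irr _ conjunct2[OF st] v0]) (use finT all in auto)
        have cT: "card T = d - 1" using cS' d3 x' finT by (simp add: card_Diff_singleton)
        show ?thesis
        proof (cases "w = y")
          \<comment> \<open>The clique with \<open>x'\<close> gives only \<open>d - 1\<close>
            vertices; the missing one is the strict gain in \<open>ext\<close>.\<close>
          case False
          obtain xs where l: "distinct xs" "set xs = insert v0 {w \<in> ?S'. R v0 w}" "length xs = d - 1 - 1"
            "successively R xs" "xs \<noteq> []" "last xs = v0"
            by (rule cliques_list[OF sym irr finS' conjunct2[OF st] v0])
          have "set xs \<subseteq> ?S'" using l v0 by auto
          then have h: "hd xs \<in> ?S'" "last xs \<in> ?S'" using l hd_in_set last_in_set by blast+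
          have "link R T x w (x' # xs)"
            using l h st sym x' v0 unfolding link_def
            by (auto simp: successively_append_iff successively_Cons)
          then obtain q where "link R S x y q" "length (x' # xs) < length q" using ext False by blast
          then show ?thesis using l d3 by (intro disjI1 exI[of _ q]) auto
        next
          case True
          have clique: "R u v" if "u \<in> T" "v \<in> T" "u \<noteq> v" for u v
            using that st sym all by blast
          have x'y: "R x' y"
          proof (rule ccontr)
            assume "\<not> R x' y"
            then have "{z \<in> insert x (insert y S). R x' z} \<subseteq> insert x ?S'"
              using nbT[of x'] x' True irr by auto
            then have "card {z \<in> insert x (insert y S). R x' z} \<le> card (insert x ?S')"
              using finT by (intro card_mono) auto
            also have "\<dots> \<le> Suc (card ?S')" using finT by (simp add: card_insert_if)
            also have "\<dots> < d" using cS' d3 by linarith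
            finally show False using deg[of x'] x' TS by auto
          qed
          have "Suc (card {w \<in> T. R v w}) = d - 1" if "v \<in> T" for v
          proof -
            have "{w \<in> T. R v w} = T - {v}" using clique irr that by blast
            then show ?thesis using cT that finT d3 by (simp add: card_Diff_singleton)
          qed
          then have "cliques R T (d - 1)" using clique by (auto simp: cliques_def)
          moreover have "\<forall>v\<in>T. R x v \<and> R v y" using x'y x' toxw sym st True by blast
          ultimately show ?thesis using True by blast
        qed
      qed
    qed
  qed
  show ?case
  proof (cases "S = T")
    case True
    then show ?thesis using struct by auto
  next
    case False
    show ?thesis
    proof (cases "\<exists>p. link R S x y p \<and> d \<le> length p")
      case nolong: False
      then have stT: "w = y" "\<forall>v\<in>T. R x v \<and> R v y" "cliques R T (d - 1)" using struct by auto
      let ?S' = "S - T"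
      \<comment> \<open>Since \<open>w = y\<close>, the set \<open>T\<close> has no neighbours in
        the rest of \<open>S\<close>, so its removal changes neither degrees nor outer neighbours
        there.\<close>
      have sep: "\<not> R u v" if "u \<in> T" "v \<in> ?S'" for u v
        using nbT[of u v] that stT x y by auto
      have lt: "card ?S' < card S"
        using fin TS by (intro psubset_card_mono) auto
      have "(\<exists>p. link R ?S' x y p \<and> d \<le> length p) \<or>
        (\<forall>v\<in>?S'. R x v \<and> R v y) \<and> cliques R ?S' (d - 1)"
      proof (rule less.hyps[OF lt])
        fix T' assume T': "T' \<subseteq> ?S'" "T' \<noteq> {}"
        have "outer R (insert x (insert y S)) T' \<subseteq> outer R (insert x (insert y ?S')) T'"
          using T' sep sym unfolding outer_def by blast
        moreover have "finite (outer R (insert x (insert y ?S')) T')"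
          using fin by (auto simp: outer_def)
        moreover have "2 \<le> card (outer R (insert x (insert y S)) T')" using cut[of T'] T' by auto
        ultimately show "2 \<le> card (outer R (insert x (insert y ?S')) T')"
          by (meson card_mono order_trans)
      next
        fix v assume v: "v \<in> ?S'"
        have "{w \<in> insert x (insert y S). R v w} = {w \<in> insert x (insert y ?S'). R v w}"
          using v sep sym by blast
        then show "d \<le> card {w \<in> insert x (insert y ?S'). R v w}" using deg[of v] v by auto
      qed (use fin TS False x y xy in auto)
      moreover have "\<not> (\<exists>p. link R ?S' x y p \<and> d \<le> length p)"
        using nolong unfolding link_def by blast
      ultimately have st': "\<forall>v\<in>?S'. R x v \<and> R v y" "cliques R ?S' (d - 1)" by auto
      have "cliques R S (d - 1)"
        unfolding cliques_def
      proof (intro conjI ballI impI)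
        fix v assume v: "v \<in> S"
        show "Suc (card {w \<in> S. R v w}) = d - 1"
        proof (cases "v \<in> T")
          case True
          then have "{w \<in> S. R v w} = {w \<in> T. R v w}" using sep TS by blast
          then show ?thesis using cliques_deg[OF stT(3) True] by simp
        next
          case False
          then have "{w \<in> S. R v w} = {w \<in> ?S'. R v w}" using sep sym v by blast
          then show ?thesis using cliques_deg[OF st'(2), of v] False v by simp
        qed
      next
        fix u v w assume *: "u \<in> S" "v \<in> S" "w \<in> S" "R u v" "R v w" "u \<noteq> w"
        show "R u w"
        proof (cases "v \<in> T")
          case True
          then have "u \<in> T" "w \<in> T" using sep[of v u] sep[of v w] sym[OF *(4)] * by auto
          then show ?thesis using cliques_trans[OF stT(3) _ True _ *(4-6)] by blast
        next
          case False
          then have "u \<in> ?S'" "w \<in> ?S'" "v \<in> ?S'"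
            using sep[of u v] sep[of w v] sym[OF *(5)] * by auto
          then show ?thesis using cliques_trans[OF st'(2) _ _ _ *(4-6)] by blast
        qed
      qed
      moreover have "\<forall>v\<in>S. R x v \<and> R v y"
      proof
        fix v assume "v \<in> S"
        then show "R x v \<and> R v y" using st'(1) stT(2) by (cases "v \<in> T") auto
      qed
      ultimately show ?thesis by simp
    qed simp
  qed
qed

section \<open>Longest cycles\<close>

lemma successively_restrict:
  assumes "successively R xs" "set xs \<subseteq> H" "\<And>u w. u \<in> H \<Longrightarrow> w \<in> H \<Longrightarrow> R u w \<Longrightarrow> Q u w"
  shows "successively Q xs"
  using assms(1,2)
proof (induction xs)
  case (Cons a xs)
  then show ?case using assms(3) by (cases xs) (auto simp: successively_Cons)
qed simp

section \<open>Counting elements that are spread out along a list\<close>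

lemma card_spaced:
  "(\<And>pre u v post. w = pre @ u # v # post \<Longrightarrow> \<not> (u \<in> U \<and> v \<in> U)) \<Longrightarrow>
   2 * card (U \<inter> set w) \<le> Suc (length w)"
proof (induction w rule: length_induct)
  case (1 w)
  show ?case
  proof (cases w)
    case (Cons x w1)
    show ?thesis
    proof (cases w1)
      case Nil
      have "card (U \<inter> {x}) \<le> card {x}" by (intro card_mono) auto
      then show ?thesis using Cons Nil by simp
    next
      case c2: (Cons y w2)
      have ih: "2 * card (U \<inter> set w2) \<le> Suc (length w2)"
      proof (rule 1(1)[rule_format])
        fix pre u v post assume "w2 = pre @ u # v # post"
        then show "\<not> (u \<in> U \<and> v \<in> U)" using 1(2)[of "x # y # pre" u v post] Cons c2 by simp
      qed (simp add: Cons c2)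
      have nxy: "\<not> (x \<in> U \<and> y \<in> U)" using 1(2)[of "[]" x y w2] Cons c2 by simp
      then obtain z where "U \<inter> set w \<subseteq> insert z (U \<inter> set w2)" using Cons c2 by (cases "x \<in> U") auto
      then have "card (U \<inter> set w) \<le> card (insert z (U \<inter> set w2))" by (intro card_mono) auto
      also have "\<dots> \<le> Suc (card (U \<inter> set w2))" by (simp add: card_insert_if)
      finally show ?thesis using ih Cons c2 by simp
    qed
  qed simp
qed

text \<open>Going from \<open>X\<close> to \<open>Y\<close> along \<open>w\<close>, some gap between consecutive elements of \<open>X \<union> Y\<close> must be
  of the long kind; all the others have length at least one.\<close>
lemma card_spaced_crossing:
  assumes "1 \<le> m"
  shows "(\<And>pre u r v post. a # w = pre @ u # r @ v # post \<Longrightarrow>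
      (u \<in> X \<and> v \<in> X \<or> u \<in> Y \<and> v \<in> Y \<longrightarrow> r \<noteq> []) \<and>
      (u \<in> X \<and> v \<in> Y \<or> u \<in> Y \<and> v \<in> X \<longrightarrow> m \<le> length r)) \<Longrightarrow>
    a \<in> X \<Longrightarrow> w \<noteq> [] \<Longrightarrow> last w \<in> Y \<Longrightarrow>
    2 * card ((X \<union> Y) \<inter> set (a # w)) + m \<le> length w + 3"
proof (induction w arbitrary: a rule: length_induct)
  case (1 w)
  note gaps = 1(2)
  have "\<exists>z\<in>set w. z \<in> X \<union> Y" using 1(4,5) last_in_set by blast
  then obtain r u' w' where w: "w = r @ u' # w'" "u' \<in> X \<union> Y" "\<forall>z\<in>set r. z \<notin> X \<union> Y"
    by (rule split_list_first_propE)
  have "(X \<union> Y) \<inter> set (a # w) \<subseteq> insert a ((X \<union> Y) \<inter> set (u' # w'))" using w by auto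
  then have "card ((X \<union> Y) \<inter> set (a # w)) \<le> card (insert a ((X \<union> Y) \<inter> set (u' # w')))"
    by (intro card_mono) auto
  also have "\<dots> \<le> Suc (card ((X \<union> Y) \<inter> set (u' # w')))" by (simp add: card_insert_if del: Int_insert_right)
  finally have le: "card ((X \<union> Y) \<inter> set (a # w)) \<le> Suc (card ((X \<union> Y) \<inter> set (u' # w')))" .
  have g0: "(u' \<in> X \<longrightarrow> r \<noteq> []) \<and> (u' \<in> Y \<longrightarrow> m \<le> length r)"
    using gaps[of "[]" a r u' w'] w(1) 1(3) by auto
  show ?case
  proof (cases "u' \<in> Y")
    case True
    \<comment> \<open>Once the long gap has been spent, the remaining gaps only need to be nonempty,
      which holds for both kinds because \<open>1 \<le> m\<close>.\<close>
    have "2 * card ((X \<union> Y) \<inter> set (u' # w')) \<le> Suc (length (u' # w'))"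
    proof (rule card_spaced)
      fix pre u v post assume "u' # w' = pre @ u # v # post"
      then show "\<not> (u \<in> X \<union> Y \<and> v \<in> X \<union> Y)"
        using gaps[of "a # r @ pre" u "[]" v post] w(1) assms by auto
    qed
    then show ?thesis using le g0 True w(1) by simp
  next
    case False
    then have ne: "w' \<noteq> []" "last w' \<in> Y" using 1(5) w(1) by (auto split: if_splits)
    have "2 * card ((X \<union> Y) \<inter> set (u' # w')) + m \<le> length w' + 3"
    proof (rule 1(1)[rule_format])
      fix pre u s v post assume "u' # w' = pre @ u # s @ v # post"
      then show "(u \<in> X \<and> v \<in> X \<or> u \<in> Y \<and> v \<in> Y \<longrightarrow> s \<noteq> []) \<and>
        (u \<in> X \<and> v \<in> Y \<or> u \<in> Y \<and> v \<in> X \<longrightarrow> m \<le> length s)"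
        using gaps[of "a # r @ pre" u s v post] w(1) by simp
    qed (use w False ne in auto)
    then show ?thesis using le g0 False w by (cases r) auto
  qed
qed

text \<open>Each element of \<open>A\<close> but the last occupies \<open>m + 1\<close> places,
  itself and the gap behind it. The last one occupies a single place, whence the \<open>+ m\<close>
  on the right.\<close>

lemma card_gaps:
  "(\<And>pre u r v post. w = pre @ u # r @ v # post \<Longrightarrow> u \<in> A \<Longrightarrow> v \<in> A \<Longrightarrow> m \<le> length r) \<Longrightarrow>
   Suc m * card (A \<inter> set w) \<le> length w + m"
proof (induction w rule: length_induct)
  case (1 w)
  note gaps = 1(2)
  show ?case
  proof (cases "\<exists>z\<in>set w. z \<in> A")
    case False
    then have "A \<inter> set w = {}" by auto
    then show ?thesis by simp
  next
    case True
    then obtain r0 u w0 where w: "w = r0 @ u # w0" "u \<in> A" "\<forall>z\<in>set r0. z \<notin> A"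
      by (rule split_list_first_propE)
    show ?thesis
    proof (cases "\<exists>z\<in>set w0. z \<in> A")
      case False
      then have "A \<inter> set w = {u}" using w by auto
      then have "card (A \<inter> set w) = 1" by simp
      then show ?thesis using w(1) by simp
    next
      case True
      then obtain r v w1 where w0: "w0 = r @ v # w1" "v \<in> A" "\<forall>z\<in>set r. z \<notin> A"
        by (rule split_list_first_propE)
      have ih: "Suc m * card (A \<inter> set (v # w1)) \<le> length (v # w1) + m"
      proof (rule 1(1)[rule_format])
        fix pre u' s v' post assume "v # w1 = pre @ u' # s @ v' # post" "u' \<in> A" "v' \<in> A"
        then show "m \<le> length s"
          using gaps[of "r0 @ u # r @ pre" u' s v' post] w(1) w0(1) by simp
      qed (use w w0 in auto)
      have mr: "m \<le> length r" using gaps[of r0 u r v w1] w w0 by simp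
      have "A \<inter> set w \<subseteq> insert u (A \<inter> set (v # w1))" using w w0 by auto
      then have "card (A \<inter> set w) \<le> card (insert u (A \<inter> set (v # w1)))" by (intro card_mono) auto
      also have "\<dots> \<le> Suc (card (A \<inter> set (v # w1)))" by (simp add: card_insert_if del: Int_insert_right)
      finally have "Suc m * card (A \<inter> set w) \<le> Suc m * Suc (card (A \<inter> set (v # w1)))"
        by (rule mult_le_mono2)
      also have "\<dots> = Suc m + Suc m * card (A \<inter> set (v # w1))" by simp
      finally show ?thesis using ih mr w w0 by simp
    qed
  qed
qed

text \<open>\<open>cut\<close> is 2-connectedness in the form that the path arguments use: fewer
  than two outer neighbours would separate \<open>T\<close> from a remaining vertex.
  \<open>deg\<close> asks for minimum degree at least \<open>k\<close>.\<close>

locale dirac_graph =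
  fixes V :: "'a set" and E :: "'a \<Rightarrow> 'a \<Rightarrow> bool" and k :: nat
  assumes finV: "finite V" and sym: "E u v \<Longrightarrow> E v u" and irr: "\<not> E u u"
    and EV: "E u v \<Longrightarrow> v \<in> V"
    and cut: "T \<subseteq> V \<Longrightarrow> T \<noteq> {} \<Longrightarrow> 2 \<le> card (V - T) \<Longrightarrow> 2 \<le> card (outer E V T)"
    and deg: "v \<in> V \<Longrightarrow> k \<le> card {w. E v w}"
begin

definition nb :: "'a \<Rightarrow> 'a set" where "nb v = {w. E v w}"

lemma nb_iff: "w \<in> nb v \<longleftrightarrow> E v w" by (simp add: nb_def)
lemma nb_V: "nb v \<subseteq> V" using EV by (auto simp: nb_def)
lemma fin_nb: "finite (nb v)" using nb_V finV finite_subset by blast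
lemma deg_nb: "v \<in> V \<Longrightarrow> k \<le> card (nb v)" using deg by (simp add: nb_def)

section \<open>Cycles as vertex lists\<close>

definition cyc :: "'a list \<Rightarrow> bool" where
  "cyc p \<longleftrightarrow> 3 \<le> length p \<and> distinct p \<and> successively E p \<and> E (last p) (hd p)"

lemma cyc_rot: "cyc (xs @ ys) \<Longrightarrow> cyc (ys @ xs)"
  by (cases "xs = []"; cases "ys = []") (auto simp: cyc_def successively_append_iff)

lemma successively_rev_sym: "successively E xs \<Longrightarrow> successively E (rev xs)"
  unfolding successively_rev by (rule successively_restrict[of E xs UNIV]) (auto intro: sym)

lemma cyc_rev: "cyc xs \<Longrightarrow> cyc (rev xs)"
  using sym by (auto simp: cyc_def successively_rev_sym hd_rev last_rev simp del: successively_rev)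

lemma cyc_V: assumes "cyc p" shows "set p \<subseteq> V"
proof
  fix v assume "v \<in> set p"
  then obtain xs ys where "p = xs @ v # ys" by (meson split_list)
  then have c: "cyc (v # ys @ xs)" using cyc_rot[of xs "v # ys"] assms by simp
  then have "E (last (v # ys @ xs)) v" by (auto simp: cyc_def)
  then show "v \<in> V" using EV by blast
qed

lemma cyc_split:
  assumes "cyc C" "a \<in> set C" "b \<in> set C" "a \<noteq> b"
  obtains P Q where "cyc (a # P @ b # Q)" "set (a # P @ b # Q) = set C"
    "length (a # P @ b # Q) = length C"
proof -
  obtain xs ys where 1: "C = xs @ a # ys" using assms(2) by (meson split_list)
  have c: "cyc (a # ys @ xs)" using cyc_rot[of xs "a # ys"] assms 1 by simp
  have "b \<in> set (ys @ xs)" using assms 1 by auto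
  then obtain P Q where 2: "ys @ xs = P @ b # Q" by (meson split_list)
  have s: "set (P @ b # Q) = set ys \<union> set xs" using arg_cong[OF 2, of set] by simp
  have l: "length (P @ b # Q) = length ys + length xs" using arg_cong[OF 2, of length] by simp
  show thesis using that[of P Q] c s l by (auto simp: 1 2)
qed

lemma cyc_detour:
  assumes "cyc (a # P @ b # Q)" "q \<noteq> []" "distinct q" "set q \<inter> set (a # P @ b # Q) = {}"
    "successively E q" "E a (hd q)" "E (last q) b"
  shows "cyc (a # q @ b # Q)"
  using assms
  by (cases q) (auto simp: cyc_def successively_append_iff successively_Cons hd_append split: if_splits)

end

text \<open>Here \<open>c\<close> is an upper bound for cycle lengths; that it is attained is
  expressed by hypotheses \<open>lcyc C\<close>. The assumption \<open>cn\<close> guarantees a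
  vertex outside every longest cycle.\<close>

locale short_circumference = dirac_graph +
  fixes c :: nat
  assumes bound: "cyc p \<Longrightarrow> length p \<le> c"
    and ck: "c \<le> 2 * k + 1"
    and cn: "c < card V"
begin

definition lcyc :: "'a list \<Rightarrow> bool" where "lcyc C \<longleftrightarrow> cyc C \<and> length C = c"

lemma lcyc_rot: "lcyc (xs @ ys) \<Longrightarrow> lcyc (ys @ xs)"
  by (auto simp: lcyc_def cyc_rot)

lemma lcyc_rev: "lcyc xs \<Longrightarrow> lcyc (rev xs)"
  by (auto simp: lcyc_def cyc_rev)

lemma lcyc_distinct: "lcyc xs \<Longrightarrow> distinct xs"
  by (auto simp: lcyc_def cyc_def)

lemma lcyc_V: "lcyc xs \<Longrightarrow> set xs \<subseteq> V"
  by (auto simp: lcyc_def dest: cyc_V)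

lemma lcyc_split:
  assumes "lcyc C" "a \<in> set C" "b \<in> set C" "a \<noteq> b"
  obtains P Q where "lcyc (a # P @ b # Q)" "set (a # P @ b # Q) = set C"
proof -
  obtain P Q where "cyc (a # P @ b # Q)" "set (a # P @ b # Q) = set C"
    "length (a # P @ b # Q) = length C"
    using assms by (auto simp: lcyc_def elim: cyc_split)
  then show thesis using that assms(1) unfolding lcyc_def by metis
qed

text \<open>Otherwise replacing \<open>r\<close> by \<open>q\<close> would lengthen a longest
  cycle.\<close>

lemma detour_le:
  assumes "lcyc (pre @ u # r @ v # post)" "q \<noteq> []" "distinct q"
    "set q \<inter> set (pre @ u # r @ v # post) = {}" "successively E q" "E u (hd q)" "E (last q) v"
  shows "length q \<le> length r"
proof -
  have "lcyc (u # r @ v # (post @ pre))"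
    using lcyc_rot[of pre "u # r @ v # post"] assms(1) by simp
  then have c: "cyc (u # r @ v # (post @ pre))" and l: "length (u # r @ v # (post @ pre)) = c"
    by (auto simp: lcyc_def)
  have "cyc (u # q @ v # (post @ pre))"
    by (rule cyc_detour[OF c]) (use assms in auto)
  then show ?thesis using bound l by fastforce
qed

lemma detour_eq:
  assumes "lcyc (u # r @ v # post)" "distinct q" "length q = length r" "q \<noteq> []"
    "set q \<inter> set (u # r @ v # post) = {}" "successively E q" "E u (hd q)" "E (last q) v"
  shows "lcyc (u # q @ v # post)"
  using cyc_detour[of u r v post q] assms by (auto simp: lcyc_def)

definition feet :: "'a list \<Rightarrow> 'a \<Rightarrow> 'a set" where "feet C v = nb v \<inter> set C"

lemma feet_iff: "w \<in> feet C v \<longleftrightarrow> E v w \<and> w \<in> set C" by (simp add: feet_def nb_iff)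

text \<open>The cycle is cut at distinct feet \<open>a\<close> of \<open>hd p\<close> and
  \<open>b\<close> of \<open>last p\<close>, and \<open>card_spaced_crossing\<close> charges each
  arc one gap of length \<open>length p\<close>. With \<open>u\<close> feet in all, adding both arcs
  gives \<open>2 * (length p + u) \<le> c + 2 \<le> 2 * k + 3\<close>, and parity removes the odd
  unit.\<close>

lemma crossing:
  assumes C: "lcyc C" and p: "p \<noteq> []" "distinct p" "set p \<inter> set C = {}" "successively E p"
    and ne: "feet C (hd p) \<noteq> {}" "feet C (last p) \<noteq> {}"
    and two: "2 \<le> card (feet C (hd p) \<union> feet C (last p))"
  shows "length p + card (feet C (hd p) \<union> feet C (last p)) \<le> k + 1"
proof -
  let ?X = "feet C (hd p)" let ?Y = "feet C (last p)"
  have UC: "?X \<union> ?Y \<subseteq> set C" by (auto simp: feet_def)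
  have "\<exists>a\<in>?X. \<exists>b\<in>?Y. a \<noteq> b"
  proof (rule ccontr)
    assume no: "\<not> ?thesis"
    obtain a b where ab: "a \<in> ?X" "b \<in> ?Y" using ne by blast
    then have "b = a" using no by auto
    then have "?X \<union> ?Y \<subseteq> {a}" using no ab by auto
    then have "card (?X \<union> ?Y) \<le> card {a}" by (intro card_mono) auto
    then show False using two by simp
  qed
  then obtain a b where ab: "a \<in> ?X" "b \<in> ?Y" "a \<noteq> b" by blast
  then obtain P Q where PQ: "lcyc (a # P @ b # Q)" "set (a # P @ b # Q) = set C"
    using lcyc_split[OF C, of a b] UC by blast
  have QP: "lcyc (b # Q @ a # P)" using lcyc_rot[of "a # P" "b # Q"] PQ by simp
  have srev: "successively E (rev p)" using p successively_rev_sym by blast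
  \<comment> \<open>Feet of one end are bypassed through that end alone, feet of different ends
    through \<open>p\<close> or its reverse.\<close>
  have gap: "(u \<in> ?X \<and> v \<in> ?X \<or> u \<in> ?Y \<and> v \<in> ?Y \<longrightarrow> r \<noteq> []) \<and>
      (u \<in> ?X \<and> v \<in> ?Y \<or> u \<in> ?Y \<and> v \<in> ?X \<longrightarrow> length p \<le> length r)"
    if l: "lcyc (pre @ u # r @ v # post)" and s: "set (pre @ u # r @ v # post) = set C" for pre u r v post
  proof -
    have d: "length q \<le> length r" if "q \<noteq> []" "distinct q" "set q \<subseteq> set p" "successively E q"
      "E (hd q) u" "E (last q) v" for q
      by (rule detour_le[OF l that(1,2) _ that(4) sym[OF that(5)] that(6)])
        (use s p(3) that(3) in auto)
    have h: "hd p \<in> set p" "last p \<in> set p" using p(1) by auto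
    show ?thesis
      using d[of "[hd p]"] d[of "[last p]"] d[of p] d[of "rev p"] h p srev
      by (auto simp: feet_iff hd_rev last_rev simp del: successively_rev)
  qed
  have m: "1 \<le> length p" using p(1) by (cases p) auto
  have 1: "2 * card ((?X \<union> ?Y) \<inter> set (a # P @ [b])) + length p \<le> length (P @ [b]) + 3"
  proof (rule card_spaced_crossing[OF m])
    fix pre u r v post assume w: "a # P @ [b] = pre @ u # r @ v # post"
    have e: "a # P @ b # Q = pre @ u # r @ v # (post @ Q)" using arg_cong[OF w, of "\<lambda>l. l @ Q"] by simp
    show "(u \<in> ?X \<and> v \<in> ?X \<or> u \<in> ?Y \<and> v \<in> ?Y \<longrightarrow> r \<noteq> []) \<and>
      (u \<in> ?X \<and> v \<in> ?Y \<or> u \<in> ?Y \<and> v \<in> ?X \<longrightarrow> length p \<le> length r)"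
      by (rule gap[of pre u r v "post @ Q"]) (use PQ e in simp_all)
  qed (use ab in auto)
  have 2: "2 * card ((?Y \<union> ?X) \<inter> set (b # Q @ [a])) + length p \<le> length (Q @ [a]) + 3"
  proof (rule card_spaced_crossing[OF m])
    fix pre u r v post assume w: "b # Q @ [a] = pre @ u # r @ v # post"
    have e: "b # Q @ a # P = pre @ u # r @ v # (post @ P)" using arg_cong[OF w, of "\<lambda>l. l @ P"] by simp
    have s: "set (b # Q @ a # P) = set C" using PQ(2) by auto
    show "(u \<in> ?Y \<and> v \<in> ?Y \<or> u \<in> ?X \<and> v \<in> ?X \<longrightarrow> r \<noteq> []) \<and>
      (u \<in> ?Y \<and> v \<in> ?X \<or> u \<in> ?X \<and> v \<in> ?Y \<longrightarrow> length p \<le> length r)"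
      using gap[OF QP[unfolded e] s[unfolded e]] by blast
  qed (use ab in auto)
  let ?U = "?X \<union> ?Y"
  have d: "distinct (a # P @ b # Q)" using lcyc_distinct PQ by blast
  have un: "(?U \<inter> set (a # P @ [b])) \<union> (?U \<inter> set (b # Q @ [a])) = ?U" using UC PQ(2) by auto
  have int: "(?U \<inter> set (a # P @ [b])) \<inter> (?U \<inter> set (b # Q @ [a])) = {a, b}" using d ab by auto
  \<comment> \<open>\<open>a\<close> and \<open>b\<close> lie on both arcs and are counted
    twice.\<close>
  have "card (?U \<inter> set (a # P @ [b])) + card (?U \<inter> set (b # Q @ [a])) = card ?U + card {a, b}"
    using card_Un_Int[of "?U \<inter> set (a # P @ [b])" "?U \<inter> set (b # Q @ [a])"] un int by simp
  moreover have "?Y \<union> ?X = ?U" by blast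
  moreover have "length P + length Q + 2 = c" using PQ by (auto simp: lcyc_def)
  ultimately show ?thesis using 1 2 ab ck by simp
qed

end

section \<open>Components outside a longest cycle\<close>

lemma reach_minimal:
  assumes "w \<in> U" "\<And>u v. u \<in> U \<Longrightarrow> R u v \<Longrightarrow> v \<in> S \<Longrightarrow> v \<in> U"
  shows "reach R S w \<subseteq> U"
proof
  fix z assume "z \<in> reach R S w"
  then have "(\<lambda>u v. R u v \<and> v \<in> S)\<^sup>*\<^sup>* w z" by (simp add: reach_def)
  then show "z \<in> U" using assms by (induction rule: rtranclp_induct) auto
qed

lemma two_elements:
  assumes "2 \<le> card S"
  shows "\<exists>x\<in>S. \<exists>y\<in>S. x \<noteq> y"
proof (rule ccontr)
  assume no: "\<not> ?thesis"
  obtain x where "x \<in> S" using assms by (metis card.empty ex_in_conv not_numeral_le_zero)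
  then have "S \<subseteq> {x}" using no by blast
  from card_mono[OF _ this] show False using assms by simp
qed

context short_circumference
begin

text \<open>If no edge left \<open>T\<close>, then \<open>T\<close> or its complement in the
  component, whichever contains \<open>h\<close>, would contain everything reachable from
  \<open>h\<close>.\<close>

lemma cross_edge:
  assumes "T \<subseteq> reach E S h" "T \<noteq> {}" "T \<noteq> reach E S h" "h \<in> S"
  obtains t w where "t \<in> T" "w \<in> reach E S h - T" "E t w"
proof -
  let ?H = "reach E S h"
  have HS: "?H \<subseteq> S" by (rule reach_subset[OF assms(4)])
  have "\<exists>t\<in>T. \<exists>w\<in>?H - T. E t w"
  proof (rule ccontr)
    assume no: "\<not> ?thesis"
    show False
    proof (cases "h \<in> T")
      case True
      have "?H \<subseteq> T"
      proof (rule reach_minimal[OF True])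
        fix u v assume "u \<in> T" "E u v" "v \<in> S"
        then show "v \<in> T" using no assms(1) reach_step[of u E S h v] by blast
      qed
      then show False using assms by blast
    next
      case False
      have "?H \<subseteq> ?H - T"
      proof (rule reach_minimal)
        show "h \<in> ?H - T" using False reach_refl[of h E S] by blast
        fix u v assume "u \<in> ?H - T" "E u v" "v \<in> S"
        then show "v \<in> ?H - T" using no sym[of u v] reach_step[of u E S h v] by blast
      qed
      then show False using assms by blast
    qed
  qed
  then show thesis using that by blast
qed

text \<open>Let \<open>D\<close> be the largest number of feet of a vertex of \<open>H\<close>. If \<open>D \<ge> 2\<close>, use paths from a vertex with
  \<open>D\<close> feet to \<open>C\<close> contracted to \<open>y\<close>; if \<open>D = 1\<close>, use paths from \<open>x\<close> to \<open>C - x\<close> contracted to \<open>y\<close>.\<close>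
lemma component_structure:
  assumes C: "lcyc C" and h: "h \<in> V - set C" and H: "H = reach E (V - set C) h"
  shows "\<exists>A. A \<subseteq> set C \<and> 2 \<le> card A \<and> card A + card H = k + 1 \<and> (\<forall>z\<in>H. nb z = A \<union> (H - {z}))"
proof -
  have HV: "H \<subseteq> V - set C" unfolding H by (rule reach_subset[OF h])
  then have finH: "finite H" using finV finite_subset by blast
  have hH: "h \<in> H" unfolding H by (rule reach_refl)
  have clos: "w \<in> H \<or> w \<in> set C" if "z \<in> H" "E z w" for z w
    using that reach_step[of z E "V - set C" h w] EV[of z w] unfolding H by blast
  have len3: "3 \<le> length C" using C by (auto simp: lcyc_def cyc_def)
  have CV: "set C \<subseteq> V" by (rule lcyc_V[OF C])
  have dC: "distinct C" by (rule lcyc_distinct[OF C])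
  have feetC: "feet C z \<subseteq> set C" for z by (simp add: feet_def)
  have finf: "finite (feet C z)" for z by (simp add: feet_def)
  have nbz: "card (nb z) = card (nb z \<inter> H) + card (feet C z)" if "z \<in> H" for z
  proof -
    have "nb z = (nb z \<inter> H) \<union> feet C z" using clos[OF that] unfolding feet_def nb_def by blast
    moreover have "card ((nb z \<inter> H) \<union> feet C z) = card (nb z \<inter> H) + card (feet C z)"
      by (rule card_Un_disjoint) (use finH HV in \<open>auto simp: feet_def\<close>)
    ultimately show ?thesis by simp
  qed
  have degz: "k \<le> card (nb z \<inter> H) + card (feet C z)" if "z \<in> H" for z
    using deg_nb[of z] nbz[OF that] that HV by auto
  have cutH: "2 \<le> card (outer E V T)" if "T \<subseteq> H" "T \<noteq> {}" for T
  proof (rule cut)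
    show "T \<subseteq> V" "T \<noteq> {}" using that HV by auto
    have "card (set C) \<le> card (V - T)" using that HV CV finV by (intro card_mono) auto
    then show "2 \<le> card (V - T)" using distinct_card[OF dC] len3 by simp
  qed
  have cross: "\<exists>t\<in>T. \<exists>w\<in>H - T. E t w" if "T \<subseteq> H" "T \<noteq> {}" "T \<noteq> H" for T
    using cross_edge[of T "V - set C" h] that h unfolding H by metis
  define D where "D = Max ((\<lambda>z. card (feet C z)) ` H)"
  have leD: "card (feet C z) \<le> D" if "z \<in> H" for z
    unfolding D_def using finH that by (intro Max_ge) auto
  have "D \<in> (\<lambda>z. card (feet C z)) ` H" unfolding D_def using finH hH by (intro Max_in) auto
  then obtain v where v: "v \<in> H" "card (feet C v) = D" by auto
  show ?thesis
  proof (cases "2 \<le> D")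
    case D2: True
    have fv: "feet C v \<noteq> {}" using v D2 by auto
    have Dk: "D \<le> k" using crossing[OF C, of "[v]"] v D2 fv HV by auto
    have k2: "2 \<le> k" using D2 Dk by simp
    show ?thesis
    proof (cases "H = {v}")
      case True
      have "nb v \<inter> H = {}" using True irr by (auto simp: nb_iff)
      then have "card (feet C v) = k" using degz[OF v(1)] Dk v(2) by simp
      moreover have "w \<in> set C" if "E v w" for w
        using clos[OF v(1) that] True irr[of v] that by auto
      then have "nb v = feet C v" by (auto simp: feet_def nb_iff)
      ultimately show ?thesis using True k2 feetC[of v] by (intro exI[of _ "feet C v"]) simp
    next
      case False
      \<comment> \<open>\<open>y\<close> stands for the contracted cycle; it only matters that it
        lies outside \<open>H\<close>. In \<open>R\<close> it is adjacent to exactly those vertices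
        of \<open>H\<close> that have a foot.\<close>
      define y where "y = hd C"
      have yC: "y \<in> set C" unfolding y_def using len3 by (cases C) auto
      have yH: "y \<notin> H" using yC HV by blast
      define R where "R u w \<longleftrightarrow> (u \<in> H \<and> w \<in> H \<and> E u w) \<or> (u \<in> H \<and> w = y \<and> feet C u \<noteq> {}) \<or>
        (w \<in> H \<and> u = y \<and> feet C w \<noteq> {})" for u w
      have Rsym: "R w u" if "R u w" for u w using that sym by (auto simp: R_def)
      have Rirr: "\<not> R u u" for u using irr yH by (auto simp: R_def)
      have RE: "E u w" if "u \<in> H" "w \<in> H" "R u w" for u w using that yH by (auto simp: R_def)
      have Ry: "feet C u \<noteq> {}" if "R u y" for u using that yH by (auto simp: R_def)
      let ?S = "H - {v}"
      have iv: "insert v (insert y ?S) = insert y H" using v by auto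
      have HS: "u \<in> H" if "u \<in> ?S" for u using that by blast
      \<comment> \<open>Contraction replaces at most \<open>D\<close> feet by the one neighbour
        \<open>y\<close>, hence the degree bound \<open>k - D + 1\<close>.\<close>
      have "(\<exists>p. link R ?S v y p \<and> k - D + 1 \<le> length p) \<or>
        (\<forall>u\<in>?S. R v u \<and> R u y) \<and> cliques R ?S (k - D + 1 - 1)"
      proof (rule long_link_or_cliques[OF Rsym Rirr])
        fix T assume T: "T \<subseteq> ?S" "T \<noteq> {}"
        have TH: "T \<subseteq> H" "T \<noteq> H" using T v by auto
        obtain t w where tw: "t \<in> T" "w \<in> H - T" "E t w" using cross[of T] T(2) TH by blast
        have fino: "finite (outer R (insert y H) T)" using finH by (auto simp: outer_def)
        have wo: "w \<in> outer R (insert y H) T" using tw TH by (auto simp: outer_def R_def)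
        have "2 \<le> card (outer R (insert y H) T)"
        proof (cases "\<exists>u\<in>T. feet C u \<noteq> {}")
          case True
          then have "y \<in> outer R (insert y H) T" using TH yH by (auto simp: outer_def R_def)
          then have "{y, w} \<subseteq> outer R (insert y H) T" using wo by auto
          from card_mono[OF fino this] show ?thesis using tw yH by (auto simp: card_insert_if split: if_splits)
        next
          \<comment> \<open>Without feet in \<open>T\<close>, all its outer neighbours lie in
            \<open>H\<close>, so the cut condition of the original graph carries over.\<close>
          case False
          have "outer E V T \<subseteq> outer R (insert y H) T"
          proof
            fix z assume "z \<in> outer E V T"
            then obtain u where u: "u \<in> T" "z \<notin> T" "E u z" by (auto simp: outer_def)
            have "z \<notin> set C" using u(1,3) False feet_iff[of z C u] by blast
            then have "z \<in> H" using clos[of u z] TH u by blast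
            then show "z \<in> outer R (insert y H) T" using u TH by (auto simp: outer_def R_def)
          qed
          from card_mono[OF fino this] show ?thesis using cutH[OF TH(1) T(2)] by simp
        qed
        then show "2 \<le> card (outer R (insert v (insert y ?S)) T)" by (simp only: iv)
      next
        fix z assume "z \<in> ?S"
        then have z: "z \<in> H" by blast
        show "k - D + 1 \<le> card {w \<in> insert v (insert y ?S). R z w}"
        proof (cases "feet C z = {}")
          case True
          have "nb z \<inter> H \<subseteq> {w \<in> insert y H. R z w}" using z by (auto simp: R_def nb_iff)
          then have "card (nb z \<inter> H) \<le> card {w \<in> insert y H. R z w}" using finH by (intro card_mono) auto
          then show ?thesis using degz[OF z] True D2 Dk iv by simp
        next
          case False
          have "insert y (nb z \<inter> H) \<subseteq> {w \<in> insert y H. R z w}" using z False by (auto simp: R_def nb_iff)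
          then have "card (insert y (nb z \<inter> H)) \<le> card {w \<in> insert y H. R z w}"
            using finH by (intro card_mono) auto
          moreover have "card (insert y (nb z \<inter> H)) = Suc (card (nb z \<inter> H))" using finH yH by simp
          ultimately show ?thesis using degz[OF z] leD[OF z] iv by simp
        qed
      qed (use finH False v yH in auto)
      then show ?thesis
      proof
        \<comment> \<open>With \<open>v\<close> in front the path has at least
          \<open>k - D + 2\<close> vertices, and the feet of \<open>v\<close> alone number
          \<open>D\<close>: too many for \<open>crossing\<close>.\<close>
        assume "\<exists>p. link R ?S v y p \<and> k - D + 1 \<le> length p"
        then obtain p where p: "link R ?S v y p" "k - D + 1 \<le> length p" by blast
        have p1: "p \<noteq> []" "distinct p" "set p \<subseteq> ?S" using p by (auto simp: link_def)
        have "successively R ((v # p) @ [y])" using p by (simp add: link_def)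
        then have sR: "successively R (v # p)" and ly: "R (last p) y"
          using p1(1) by (simp_all only: successively_append_iff) auto
        have "successively E (v # p)"
          by (rule successively_restrict[OF sR, of H]) (use p1 v RE in auto)
        then have "length (v # p) + card (feet C (hd (v # p)) \<union> feet C (last (v # p))) \<le> k + 1"
        proof (rule crossing[OF C _ _ _, rotated 3])
          have "card (feet C v) \<le> card (feet C v \<union> feet C (last p))" using finf by (intro card_mono) auto
          then show "2 \<le> card (feet C (hd (v # p)) \<union> feet C (last (v # p)))" using v D2 p1(1) by simp
        qed (use p1 v fv HV Ry[OF ly] in auto)
        moreover have "card (feet C v) \<le> card (feet C v \<union> feet C (last p))" using finf by (intro card_mono) auto
        ultimately show ?thesis using p(2) p1(1) v Dk by simp
      next
        assume st: "(\<forall>u\<in>?S. R v u \<and> R u y) \<and> cliques R ?S (k - D + 1 - 1)"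
        then have cl: "cliques R ?S (k - D)" by simp
        have vE: "E v u" if "u \<in> ?S" for u using st that RE v(1) by blast
        have fS: "feet C u \<noteq> {}" if "u \<in> ?S" for u using st that Ry by blast
        have finS: "finite ?S" using finH by simp
        have toE: "successively E xs" if "successively R xs" "set xs \<subseteq> ?S" for xs
          by (rule successively_restrict[OF that]) (use RE in auto)
        \<comment> \<open>Two blocks joined through \<open>v\<close> form a path with
          \<open>2 * (k - D) + 1\<close> vertices. A vertex of a block has \<open>k - D\<close>
          neighbours in \<open>H\<close>, hence at least \<open>D\<close> feet, and
          \<open>crossing\<close> would give \<open>k \<le> D\<close>, although the blocks are
          nonempty.\<close>
        have all: "R a b" if ab: "a \<in> ?S" "b \<in> ?S" "a \<noteq> b" for a b
        proof (rule ccontr)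
          assume nR: "\<not> R a b"
          obtain xs ys where l: "distinct (xs @ ys)" "set xs \<subseteq> ?S" "set ys \<subseteq> ?S"
            "length xs = k - D" "length ys = k - D"
            "successively R xs" "successively R ys" "xs \<noteq> []" "ys \<noteq> []"
            by (rule cliques_two_lists[OF Rsym Rirr finS cl ab nR])
          have m: "hd xs \<in> ?S" "last xs \<in> ?S" "hd ys \<in> ?S" "last ys \<in> ?S"
            using l(2,3) hd_in_set[OF l(8)] last_in_set[OF l(8)] hd_in_set[OF l(9)] last_in_set[OF l(9)]
            by blast+
          have big: "D \<le> card (feet C u)" if u: "u \<in> ?S" for u
          proof -
            have "nb u \<inter> H = insert v {w \<in> ?S. R u w}"
              using u sym[OF vE[OF u]] v(1) RE[of u] unfolding nb_def R_def by blast
            moreover have "card (insert v {w \<in> ?S. R u w}) = k - D"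
              using cliques_deg[OF cl u] finS by simp
            ultimately show ?thesis using degz[of u] u Dk by simp
          qed
          have "successively E (xs @ v # ys)"
            using toE[OF l(6,2)] toE[OF l(7,3)] sym[OF vE[OF m(2)]] vE[OF m(3)]
            by (simp add: successively_append_iff successively_Cons)
          then have "length (xs @ v # ys) + card (feet C (hd (xs @ v # ys)) \<union> feet C (last (xs @ v # ys))) \<le> k + 1"
          proof (rule crossing[OF C _ _ _, rotated 3])
            have "card (feet C (hd xs)) \<le> card (feet C (hd xs) \<union> feet C (last ys))"
              using finf by (intro card_mono) auto
            then show "2 \<le> card (feet C (hd (xs @ v # ys)) \<union> feet C (last (xs @ v # ys)))"
              using big[OF m(1)] D2 l by simp
            show "set (xs @ v # ys) \<inter> set C = {}" using l(2,3) v(1) HV by auto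
            show "distinct (xs @ v # ys)" using l(1-3) by auto
            show "feet C (hd (xs @ v # ys)) \<noteq> {}" "feet C (last (xs @ v # ys)) \<noteq> {}"
              using l(8,9) fS[OF m(1)] fS[OF m(4)] by simp_all
          qed simp
          moreover have "card (feet C (hd xs)) \<le> card (feet C (hd xs) \<union> feet C (last ys))"
            using finf by (intro card_mono) auto
          moreover have "0 < length xs" using l(8) by blast
          ultimately show False using big[OF m(1)] l Dk by simp
        qed
        obtain s0 where s0: "s0 \<in> ?S" using False v by blast
        have cS: "card ?S = k - D" by (rule cliques_card[OF Rirr finS cl s0 all])
        have cH: "card H = k - D + 1" using cS v finH by (simp add: card_Diff_singleton)
          (metis Suc_pred card_gt_0_iff emptyE)
        have comp: "E a b" if "a \<in> H" "b \<in> H" "a \<noteq> b" for a b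
          using all[of a b] RE[of a b] vE[of a] vE[of b] sym that by blast
        have nbH: "nb u \<inter> H = H - {u}" if "u \<in> H" for u
          using comp irr that by (auto simp: nb_iff)
        \<comment> \<open>Traversing the clique from \<open>v\<close> to \<open>u\<close> uses
          \<open>k - D + 1\<close> vertices, so \<open>crossing\<close> leaves room for
          \<open>D\<close> feet altogether. Both ends have \<open>D\<close>, so the two sets
          coincide.\<close>
        have feq: "feet C u = feet C v" if u: "u \<in> ?S" for u
        proof -
          have "card (nb u \<inter> H) = k - D" using nbH[of u] u cH finH by (simp add: card_Diff_singleton)
          then have cu: "card (feet C u) = D" using degz[of u] leD[of u] u Dk by simp
          obtain xs where l: "distinct xs" "set xs = insert u {w \<in> ?S. R u w}" "length xs = k - D"
            "successively R xs" "xs \<noteq> []" "last xs = u"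
            by (rule cliques_list[OF Rsym Rirr finS cl u])
          have xS: "set xs \<subseteq> ?S" using l u by auto
          have "successively E (v # xs)"
            using toE[OF l(4) xS] vE[OF subsetD[OF xS hd_in_set[OF l(5)]]] by (simp add: successively_Cons)
          then have "length (v # xs) + card (feet C (hd (v # xs)) \<union> feet C (last (v # xs))) \<le> k + 1"
          proof (rule crossing[OF C _ _ _, rotated 3])
            have "card (feet C v) \<le> card (feet C v \<union> feet C u)" using finf by (intro card_mono) auto
            then show "2 \<le> card (feet C (hd (v # xs)) \<union> feet C (last (v # xs)))" using l v D2 by simp
          qed (use l xS fv fS[OF u] v HV in auto)
          then have le: "card (feet C v \<union> feet C u) \<le> D" using l Dk by simp
          have "feet C v = feet C v \<union> feet C u"
            by (rule card_seteq) (use finf le v in auto)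
          moreover have "feet C u = feet C v \<union> feet C u"
            by (rule card_seteq) (use finf le cu in auto)
          ultimately show ?thesis by simp
        qed
        have "nb u = feet C v \<union> (H - {u})" if u: "u \<in> H" for u
        proof -
          have "nb u = (nb u \<inter> H) \<union> feet C u" using clos[OF u] unfolding feet_def nb_def by blast
          moreover have "feet C u = feet C v" using feq[of u] u by (cases "u = v") auto
          ultimately show ?thesis using nbH[OF u] by auto
        qed
        then show ?thesis using v D2 cH Dk
          by (intro exI[of _ "feet C v"]) (simp add: feetC)
      qed
    qed
  next
    case False
    have le1: "card (feet C z) \<le> 1" if "z \<in> H" for z using leD[OF that] False by simp
    have "outer E V H \<subseteq> (\<Union>z\<in>H. feet C z)"
    proof
      fix z assume "z \<in> outer E V H"
      then obtain u where "u \<in> H" "E u z" "z \<notin> H" by (auto simp: outer_def)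
      then show "z \<in> (\<Union>z\<in>H. feet C z)" using clos[of u z] by (auto simp: feet_iff)
    qed
    moreover have "finite (\<Union>z\<in>H. feet C z)" using finH finf by auto
    moreover have "2 \<le> card (outer E V H)" using cutH[of H] hH by blast
    ultimately have "2 \<le> card (\<Union>z\<in>H. feet C z)" using card_mono le_trans by blast
    then obtain x y where xy: "x \<in> (\<Union>z\<in>H. feet C z)" "y \<in> (\<Union>z\<in>H. feet C z)" "x \<noteq> y"
      using two_elements by blast
    have xC: "x \<in> set C" "y \<in> set C" using xy by (auto simp: feet_def)
    have xH: "x \<notin> H" "y \<notin> H" using xC HV by auto
    \<comment> \<open>Here \<open>x\<close> remains a vertex of its own and \<open>y\<close> stands
      for the rest of the cycle, so a link from \<open>x\<close> to \<open>y\<close> is a path whose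
      ends have two distinct feet together.\<close>
    define R where "R u w \<longleftrightarrow> (u \<in> H \<and> w \<in> H \<and> E u w) \<or> (u \<in> H \<and> w = x \<and> x \<in> feet C u) \<or>
        (w \<in> H \<and> u = x \<and> x \<in> feet C w) \<or> (u \<in> H \<and> w = y \<and> feet C u - {x} \<noteq> {}) \<or>
        (w \<in> H \<and> u = y \<and> feet C w - {x} \<noteq> {})" for u w
    have Rsym: "R w u" if "R u w" for u w using that sym unfolding R_def by blast
    have Rirr: "\<not> R u u" for u using irr xH by (auto simp: R_def)
    have RE: "E u w" if "u \<in> H" "w \<in> H" "R u w" for u w using that xH by (auto simp: R_def)
    have Rx: "x \<in> feet C u" if "R u x" for u using that xH xy(3) by (auto simp: R_def)
    have Ry: "feet C u - {x} \<noteq> {}" if "R u y" for u using that xH xy(3) by (auto simp: R_def)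
    have Rxy: "R u x \<or> R u y" if "u \<in> H" "feet C u \<noteq> {}" for u
      using that by (cases "x \<in> feet C u") (auto simp: R_def)
    \<comment> \<open>A vertex has at most one foot, which becomes the neighbour \<open>x\<close> or
      \<open>y\<close>. No degree is lost, so the bound is \<open>k\<close>.\<close>
    have "(\<exists>p. link R H x y p \<and> k \<le> length p) \<or>
        (\<forall>u\<in>H. R x u \<and> R u y) \<and> cliques R H (k - 1)"
    proof (rule long_link_or_cliques[OF Rsym Rirr])
      fix T assume T: "T \<subseteq> H" "T \<noteq> {}"
      let ?O = "outer R (insert x (insert y H)) T"
      have fino: "finite ?O" using finH by (auto simp: outer_def)
      show "2 \<le> card ?O"
      proof (cases "T = H")
        case True
        have "{x, y} \<subseteq> ?O" using xy True xH unfolding outer_def R_def by blast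
        from card_mono[OF fino this] show ?thesis using xy(3) by simp
      next
        case False
        obtain t w where tw: "t \<in> T" "w \<in> H - T" "E t w" using cross[of T] T False by blast
        have wo: "w \<in> ?O" using tw T by (auto simp: outer_def R_def)
        show ?thesis
        proof (cases "\<exists>u\<in>T. feet C u \<noteq> {}")
          case True
          then obtain u where u: "u \<in> T" "feet C u \<noteq> {}" by blast
          have "R u x \<or> R u y" using Rxy u T by blast
          then obtain z where "z = x \<or> z = y" "R u z" by blast
          then have "{z, w} \<subseteq> ?O" "z \<noteq> w" using wo u xH T tw by (auto simp: outer_def)
          with card_mono[OF fino this(1)] show ?thesis by simp
        next
          case False
          have "outer E V T \<subseteq> ?O"
          proof
            fix z assume "z \<in> outer E V T"
            then obtain u where u: "u \<in> T" "z \<notin> T" "E u z" by (auto simp: outer_def)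
            have "z \<notin> set C" using u(1,3) False feet_iff[of z C u] by blast
            then have "z \<in> H" using clos[of u z] T u by blast
            then show "z \<in> ?O" using u T by (auto simp: outer_def R_def)
          qed
          from card_mono[OF fino this] show ?thesis using cutH[OF T] by simp
        qed
      qed
    next
      fix z assume z: "z \<in> H"
      show "k \<le> card {w \<in> insert x (insert y H). R z w}"
      proof (cases "feet C z = {}")
        case True
        have "nb z \<inter> H \<subseteq> {w \<in> insert x (insert y H). R z w}" using z by (auto simp: R_def nb_iff)
        then have "card (nb z \<inter> H) \<le> card {w \<in> insert x (insert y H). R z w}"
          using finH by (intro card_mono) auto
        then show ?thesis using degz[OF z] True by simp
      next
        case False
        then have "R z x \<or> R z y" using z Rxy by blast
        then obtain y' where y': "y' = x \<or> y' = y" "R z y'" by blast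
        have "insert y' (nb z \<inter> H) \<subseteq> {w \<in> insert x (insert y H). R z w}"
          using z y' by (auto simp: R_def nb_iff)
        then have "card (insert y' (nb z \<inter> H)) \<le> card {w \<in> insert x (insert y H). R z w}"
          using finH by (intro card_mono) auto
        moreover have "card (insert y' (nb z \<inter> H)) = Suc (card (nb z \<inter> H))" using finH xH y' by auto
        ultimately show ?thesis using degz[OF z] le1[OF z] by simp
      qed
    qed (use finH hH xH xy in auto)
    then show ?thesis
    proof
      \<comment> \<open>A path with \<open>k\<close> vertices whose ends have two feet contradicts
        \<open>crossing\<close>.\<close>
      assume "\<exists>p. link R H x y p \<and> k \<le> length p"
      then obtain p where p: "link R H x y p" "k \<le> length p" by blast
      have p1: "p \<noteq> []" "distinct p" "set p \<subseteq> H" using p by (auto simp: link_def)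
      have sR: "successively R p" and R1: "R x (hd p)" and R2: "R (last p) y"
        using p p1(1) by (auto simp: link_def successively_append_iff successively_Cons)
      have sE: "successively E p" by (rule successively_restrict[OF sR p1(3) RE])
      obtain y' where y': "y' \<in> feet C (last p)" "y' \<noteq> x" using Ry[OF R2] by blast
      have "{x, y'} \<subseteq> feet C (hd p) \<union> feet C (last p)" using Rx[OF Rsym[OF R1]] y' by blast
      then have c2: "card {x, y'} \<le> card (feet C (hd p) \<union> feet C (last p))" using finf by (intro card_mono) auto
      then have "length p + card (feet C (hd p) \<union> feet C (last p)) \<le> k + 1"
        by (intro crossing[OF C p1(1,2) _ sE]) (use p1 HV y' Rx[OF Rsym[OF R1]] in auto)
      then show ?thesis using c2 y' p by simp
    next
      \<comment> \<open>In the extremal case every vertex of \<open>H\<close> would have the foot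
        \<open>x\<close> and another one.\<close>
      assume st: "(\<forall>u\<in>H. R x u \<and> R u y) \<and> cliques R H (k - 1)"
      then have "x \<in> feet C h" "feet C h - {x} \<noteq> {}" using hH Rx[OF Rsym] Ry by blast+
      then obtain y' where "{x, y'} \<subseteq> feet C h" "y' \<noteq> x" by blast
      then have "2 \<le> card (feet C h)" using card_mono[OF finf, of "{x, y'}" h] by simp
      then show ?thesis using le1[OF hH] by simp
    qed
  qed
qed

text \<open>By \<open>outside_cycle\<close> below, this is the whole component of \<open>v\<close> outside the longest cycle \<open>C\<close>.\<close>
definition blob :: "'a list \<Rightarrow> 'a \<Rightarrow> 'a set" where "blob C v = insert v (nb v - set C)"

text \<open>Component and attachment set can both be read off from the single vertex
  \<open>h\<close>, so the structure theorem applies to any longest cycle without naming a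
  component.\<close>

theorem outside_cycle:
  assumes C: "lcyc C" and h: "h \<in> V - set C"
  shows "2 \<le> card (feet C h)" "card (feet C h) + card (blob C h) = k + 1"
    "\<And>z. z \<in> blob C h \<Longrightarrow> nb z = feet C h \<union> (blob C h - {z})"
proof -
  let ?H = "reach E (V - set C) h"
  obtain A where A: "A \<subseteq> set C" "2 \<le> card A" "card A + card ?H = k + 1"
    "\<forall>z\<in>?H. nb z = A \<union> (?H - {z})"
    using component_structure[OF C h refl] by blast
  have H: "?H \<subseteq> V - set C" "h \<in> ?H" using reach_subset[OF h] reach_refl by auto
  have nbh: "nb h = A \<union> (?H - {h})" using A(4) H(2) by blast
  have f: "feet C h = A" using nbh A(1) H by (auto simp: feet_def)
  have b: "blob C h = ?H" using nbh A(1) H by (auto simp: blob_def)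
  show "2 \<le> card (feet C h)" "card (feet C h) + card (blob C h) = k + 1" using A f b by simp_all
  show "nb z = feet C h \<union> (blob C h - {z})" if "z \<in> blob C h" for z using A(4) that f b by simp
qed

end

section \<open>Swapping cliques into the cycle\<close>

text \<open>Unlike in \<open>card_spaced\<close>, occurrences are counted instead of elements,
  because a cycle is later written out as a list that repeats its first vertex.\<close>

lemma spaced_filter:
  "(\<And>pre u v post. w = pre @ u # v # post \<Longrightarrow> \<not> (u \<in> A \<and> v \<in> A)) \<Longrightarrow>
   2 * length (filter (\<lambda>z. z \<in> A) w) \<le> Suc (length w)"
proof (induction w rule: induct_list012)
  case (3 x y zs)
  have "2 * length (filter (\<lambda>z. z \<in> A) zs) \<le> Suc (length zs)"
  proof (rule 3(1))
    fix pre u v post assume "zs = pre @ u # v # post"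
    then show "\<not> (u \<in> A \<and> v \<in> A)" using 3(3)[of "x # y # pre" u v post] by simp
  qed
  then show ?case using 3(3)[of "[]" x y zs] by auto
qed auto

text \<open>A tight count forces \<open>w\<close> to alternate, starting and ending in \<open>A\<close>.\<close>
lemma spaced_filter_tight:
  assumes "\<And>pre u v post. w = pre @ u # v # post \<Longrightarrow> \<not> (u \<in> A \<and> v \<in> A)"
    and "Suc (length w) \<le> 2 * length (filter (\<lambda>z. z \<in> A) w)" "w = p @ z # q" "z \<notin> A"
  shows "p \<noteq> []" "last p \<in> A" "q \<noteq> []" "hd q \<in> A"
proof -
  let ?f = "\<lambda>l. 2 * length (filter (\<lambda>z. z \<in> A) l)"
  have p: "?f p \<le> Suc (length p)"
    by (rule spaced_filter) (use assms(1)[of _ _ _ "_ @ z # q"] assms(3) in simp)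
  have q: "?f q \<le> Suc (length q)"
    by (rule spaced_filter) (use assms(1)[of "p @ z # _"] assms(3) in simp)
  have tot: "Suc (length p + length q) \<le> ?f p + ?f q - 1" "2 \<le> ?f p + ?f q" using assms(2-4) by auto
  \<comment> \<open>Tightness leaves no slack in the bounds for \<open>p\<close> and
    \<open>q\<close>, whereas a half without an element of \<open>A\<close> next to \<open>z\<close>
    falls short of its bound.\<close>
  have p': "?f p \<le> length p" if "p = [] \<or> last p \<notin> A"
  proof (cases p rule: rev_cases)
    case (snoc p1 b)
    have "?f p1 \<le> Suc (length p1)"
      by (rule spaced_filter) (use assms(1)[of _ _ _ "_ @ b # z # q"] assms(3) snoc in simp)
    then show ?thesis using snoc that by simp
  qed simp
  have q': "?f q \<le> length q" if "q = [] \<or> hd q \<notin> A"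
  proof (cases q)
    case (Cons b q1)
    have "?f q1 \<le> Suc (length q1)"
      by (rule spaced_filter) (use assms(1)[of "p @ z # b # _"] assms(3) Cons in simp)
    then show ?thesis using Cons that by simp
  qed simp
  show "p \<noteq> []" using p' q tot by fastforce
  show "last p \<in> A" using p' q tot by fastforce
  show "q \<noteq> []" using q' p tot by fastforce
  show "hd q \<in> A" using q' p tot by fastforce
qed

context short_circumference
begin

text \<open>The common shape of components outside a longest cycle and of swapped gaps: a clique on
  \<open>m\<close> vertices with exactly \<open>A\<close> attached. No cycle is mentioned, so facts
  obtained from different longest cycles can be combined.\<close>

definition clq :: "'a set \<Rightarrow> nat \<Rightarrow> 'a \<Rightarrow> bool" where
  "clq A m v \<longleftrightarrow> (\<exists>K. v \<in> K \<and> card K = m \<and> K \<subseteq> V - A \<and> (\<forall>w\<in>K. nb w = A \<union> (K - {w})))"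

lemma lcyc_length: "lcyc C \<Longrightarrow> length C = c" by (simp add: lcyc_def)

lemma feet_cong: "set C = set C' \<Longrightarrow> feet C v = feet C' v" by (simp add: feet_def)
lemma blob_cong: "set C = set C' \<Longrightarrow> blob C v = blob C' v" by (simp add: blob_def)

lemma feet_sub: "feet C v \<subseteq> set C" by (simp add: feet_def)
lemma fin_blob: "finite (blob C v)" by (simp add: blob_def fin_nb)
lemma blob_self: "v \<in> blob C v" by (simp add: blob_def)

lemma blob_out: "v \<in> V - set C \<Longrightarrow> blob C v \<subseteq> V - set C"
  using nb_V by (auto simp: blob_def)

lemma blob_pos: "1 \<le> card (blob C v)"
  using fin_blob[of C v] blob_self[of v C] card_gt_0_iff by (metis One_nat_def Suc_leI empty_iff)

lemma clq_out:
  assumes "lcyc C" "v \<in> V - set C"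
  shows "clq (feet C v) (card (blob C v)) v"
  unfolding clq_def using outside_cycle(3)[OF assms] blob_out[OF assms(2)] blob_self[of v C] feet_sub[of C v]
  by (intro exI[of _ "blob C v"]) auto

lemma clq_two:
  assumes "lcyc C" "v \<in> V - set C" "feet C v = {a, b}" "a \<noteq> b"
  shows "clq {a, b} (k - 1) v"
proof -
  have "card (blob C v) = k - 1" using outside_cycle(2)[OF assms(1,2)] assms(3,4) by simp
  then show ?thesis using clq_out[OF assms(1,2)] assms(3) by simp
qed

text \<open>A blob is complete and completely joined to its feet, so any ordering of it is a detour
  between any two feet.\<close>

lemma blob_list:
  assumes "lcyc C" "v \<in> V - set C"
  obtains q where "q \<noteq> []" "distinct q" "set q = blob C v" "length q = card (blob C v)" "successively E q"
    "\<And>w. w \<in> feet C v \<Longrightarrow> E w (hd q)" "\<And>w. w \<in> feet C v \<Longrightarrow> E (last q) w"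
proof -
  obtain q where q: "set q = blob C v" "distinct q" using finite_distinct_list[OF fin_blob] by blast
  have ne: "q \<noteq> []" using q blob_self[of v C] by auto
  have l: "length q = card (blob C v)" using q distinct_card by metis
  have nbz: "nb z = feet C v \<union> (blob C v - {z})" if "z \<in> set q" for z
    using outside_cycle(3)[OF assms] that q by blast
  have "successively E q"
    by (rule successively_clique[OF q(2)]) (use nbz q nb_iff in blast)
  moreover have "E z w" if "z \<in> set q" "w \<in> feet C v" for z w using nbz[OF that(1)] that(2) nb_iff by blast
  ultimately show thesis using that[OF ne q(2,1) l] hd_in_set[OF ne] last_in_set[OF ne] sym by blast
qed

lemma gap_le:
  assumes "lcyc (pre @ u # r @ w # post)" "v \<in> V - set (pre @ u # r @ w # post)" "E v u" "E v w"
  shows "card (blob (pre @ u # r @ w # post) v) \<le> length r"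
proof -
  let ?C = "pre @ u # r @ w # post"
  obtain q where q: "q \<noteq> []" "distinct q" "set q = blob ?C v" "length q = card (blob ?C v)" "successively E q"
    "\<And>w. w \<in> feet ?C v \<Longrightarrow> E w (hd q)" "\<And>w. w \<in> feet ?C v \<Longrightarrow> E (last q) w"
    by (rule blob_list[OF assms(1,2)]) blast
  have "length q \<le> length r"
    by (rule detour_le[OF assms(1) q(1,2) _ q(5)])
      (use q(3,6,7) blob_out[OF assms(2)] assms(3,4) in \<open>auto simp: feet_iff\<close>)
  then show ?thesis using q(4) by simp
qed

lemma no_consecutive_feet:
  assumes "lcyc (pre @ u # w # post)" "v \<in> V - set (pre @ u # w # post)"
  shows "\<not> (E v u \<and> E v w)"
  using detour_le[of pre u "[]" w post "[v]"] assms sym by auto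

text \<open>Replacing \<open>P\<close> by an equally long path through the blob gives a longest
  cycle with \<open>P\<close> outside, to which \<open>outside_cycle\<close> applies. The new blob
  is exactly \<open>P\<close>, and its feet avoid the vertices that moved onto the cycle.\<close>

lemma swap:
  assumes C: "lcyc (a # P @ b # Q)" and v0: "v0 \<in> V - set (a # P @ b # Q)" "E v0 a" "E v0 b"
    and len: "card (blob (a # P @ b # Q) v0) = length P"
  obtains F where "{a, b} \<subseteq> F" "F \<subseteq> {a, b} \<union> set Q" "card F + length P = k + 1"
    "\<And>v. v \<in> set P \<Longrightarrow> nb v = F \<union> (set P - {v})"
proof -
  let ?C = "a # P @ b # Q"
  have dist: "distinct ?C" by (rule lcyc_distinct[OF C])
  obtain q where q: "q \<noteq> []" "distinct q" "set q = blob ?C v0" "length q = card (blob ?C v0)" "successively E q"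
    "\<And>w. w \<in> feet ?C v0 \<Longrightarrow> E w (hd q)" "\<And>w. w \<in> feet ?C v0 \<Longrightarrow> E (last q) w"
    by (rule blob_list[OF C v0(1)]) blast
  have ab: "a \<in> feet ?C v0" "b \<in> feet ?C v0" using v0 by (auto simp: feet_iff)
  have qC: "set q \<inter> set ?C = {}" using q(3) blob_out[OF v0(1)] by blast
  let ?C' = "a # q @ b # Q"
  have C': "lcyc ?C'"
    by (rule detour_eq[OF C q(2) _ q(1) qC q(5)]) (use q ab len in auto)
  have Pne: "P \<noteq> []" using len q(1,4) by auto
  obtain h P' where P: "P = h # P'" using Pne by (cases P) auto
  have cC: "cyc ?C" using C by (simp add: lcyc_def)
  have Eah: "E a h" using cC P by (simp add: cyc_def successively_Cons)
  have Elb: "E (last P) b" using cC Pne by (auto simp: cyc_def successively_append_iff successively_Cons)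
  have sP: "successively E P" using cC by (auto simp: cyc_def successively_append_iff successively_Cons)
  have h: "h \<in> V - set ?C'" using P dist qC lcyc_V[OF C] by auto
  let ?F = "feet ?C' h" let ?B = "blob ?C' h"
  note B = outside_cycle[OF C' h]
  have clos: "w \<in> ?B" if "z \<in> ?B" "E z w" "w \<notin> set ?C'" for z w
    using B(3)[OF that(1)] that(2,3) feet_sub[of ?C' h] nb_iff by blast
  have "set L \<subseteq> ?B" if "successively E (h' # L)" "h' \<in> ?B" "set L \<inter> set ?C' = {}" for h' L
    using that
  proof (induction L arbitrary: h')
    case (Cons l L)
    then have "l \<in> ?B" using clos[of h' l] by (auto simp: successively_Cons)
    then show ?case using Cons by (auto simp: successively_Cons)
  qed simp
  from this[of h P'] have PB: "set P \<subseteq> ?B"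
    using sP P blob_self[of h ?C'] dist qC by auto
  have aF: "a \<in> ?F" using Eah sym by (auto simp: feet_iff)
  \<comment> \<open>A further vertex of the new blob would be adjacent to \<open>a\<close> and
    \<open>h\<close>, which are consecutive on the original cycle.\<close>
  have "z \<in> set P" if z: "z \<in> ?B" for z
  proof (rule ccontr)
    assume n: "z \<notin> set P"
    have zV: "z \<in> V - set ?C'" using z blob_out[OF h] by blast
    then have zC: "z \<in> V - set ([] @ a # h # P' @ b # Q)" using n P by auto
    have "z \<noteq> h" using n P by auto
    then have "E z h" using B(3)[OF z] blob_self[of h ?C'] nb_iff by blast
    moreover have "E z a" using B(3)[OF z] aF nb_iff by blast
    ultimately show False using no_consecutive_feet[OF _ zC] C P by auto
  qed
  then have BP: "?B = set P" using PB by blast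
  have cP: "card (set P) = length P" using dist distinct_card[of P] by simp
  have bF: "b \<in> ?F"
  proof -
    have "b \<in> nb (last P)" using Elb nb_iff by blast
    then show ?thesis using B(3)[of "last P"] last_in_set[OF Pne] BP dist by auto
  qed
  \<comment> \<open>Vertices of \<open>q\<close> share the feet of \<open>v0\<close>. If one of them
    were adjacent to \<open>h\<close>, then \<open>v0\<close> would be adjacent to the consecutive
    vertices \<open>a\<close> and \<open>h\<close>.\<close>
  have Fq: "f \<notin> set q" if f: "f \<in> ?F" for f
  proof
    assume fq: "f \<in> set q"
    have "h \<in> nb f" using f sym by (auto simp: feet_iff nb_iff)
    moreover have "nb f = feet ?C v0 \<union> (blob ?C v0 - {f})" using outside_cycle(3)[OF C v0(1)] fq q(3) by blast
    moreover have "h \<notin> blob ?C v0" using qC q(3) P by auto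
    ultimately have "E v0 h" by (auto simp: feet_iff)
    moreover have "lcyc ([] @ a # h # (P' @ b # Q))" "v0 \<in> V - set ([] @ a # h # (P' @ b # Q))"
      using C P v0 by auto
    ultimately show False using no_consecutive_feet v0(2) by blast
  qed
  show thesis
  proof (rule that[of ?F])
    show "{a, b} \<subseteq> ?F" using aF bF by blast
    show "?F \<subseteq> {a, b} \<union> set Q" using Fq feet_sub[of ?C' h] by auto
    show "card ?F + length P = k + 1" using B(2) BP cP by simp
    show "nb v = ?F \<union> (set P - {v})" if "v \<in> set P" for v using B(3)[of v] that BP by simp
  qed
qed

lemma swap2:
  assumes C: "lcyc (a # P @ b # Q)" and v0: "v0 \<in> V - set (a # P @ b # Q)" "E v0 a" "E v0 b"
    and len: "card (blob (a # P @ b # Q) v0) = length P" "length P = k - 1" "v \<in> set P"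
  shows "nb v = {a, b} \<union> (set P - {v})"
proof -
  obtain F where F: "{a, b} \<subseteq> F" "F \<subseteq> {a, b} \<union> set Q" "card F + length P = k + 1"
    "\<And>v. v \<in> set P \<Longrightarrow> nb v = F \<union> (set P - {v})"
    by (rule swap[OF C v0 len(1)]) blast
  have "length P \<ge> 1" using len(3) by (cases P) auto
  then have c2: "card F = 2" using F(3) len(2) by simp
  have "a \<noteq> b" using lcyc_distinct[OF C] by auto
  have "{a, b} = F"
    by (rule card_subset_eq) (use F(1) c2 \<open>a \<noteq> b\<close> card.infinite in \<open>auto intro!: card_ge_0_finite\<close>)
  then show ?thesis using F(4) len(3) by blast
qed

lemma clq_segment:
  assumes "distinct P" "set P \<subseteq> V - A" "\<And>v. v \<in> set P \<Longrightarrow> nb v = A \<union> (set P - {v})" "v \<in> set P"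
  shows "clq A (length P) v"
  unfolding clq_def using assms distinct_card[of P] by (intro exI[of _ "set P"]) auto

text \<open>Around the cycle each foot and the gap behind it use \<open>card (blob C v) + 1\<close>
  vertices. \<open>card_gaps\<close> covers the stretch from the first to the last foot; the closing
  gap \<open>Q\<close> supplies the rest.\<close>

lemma gaps_sum:
  assumes C: "lcyc C" and v: "v \<in> V - set C"
  shows "Suc (card (blob C v)) * card (feet C v) \<le> c"
proof -
  let ?m = "card (blob C v)"
  obtain a b0 where ab: "a \<in> feet C v" "b0 \<in> feet C v" "a \<noteq> b0"
    using two_elements[OF outside_cycle(1)[OF C v]] by blast
  then obtain P0 Q0 where C0: "lcyc (a # P0 @ b0 # Q0)" "set (a # P0 @ b0 # Q0) = set C"
    using lcyc_split[OF C, of a b0] feet_sub by blast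
  have "\<exists>z\<in>set (P0 @ b0 # Q0). z \<in> feet C v" using ab by auto
  then obtain P b Q where PQ: "P0 @ b0 # Q0 = P @ b # Q" "b \<in> feet C v" "\<forall>z\<in>set Q. z \<notin> feet C v"
    by (rule split_list_last_propE)
  have C1: "lcyc (a # P @ b # Q)" "set (a # P @ b # Q) = set C" using C0 unfolding PQ(1) by blast+
  have C2: "lcyc ([] @ b # Q @ a # P)" "set ([] @ b # Q @ a # P) = set C"
    using lcyc_rot[of "a # P" "b # Q"] C1 by auto
  have "card (blob ([] @ b # Q @ a # P) v) \<le> length Q"
    by (rule gap_le[OF C2(1)]) (use C2(2) v ab PQ(2) in \<open>auto simp: feet_iff\<close>)
  then have Qm: "?m \<le> length Q" using blob_cong[OF C2(2)] by simp
  have "Suc ?m * card (feet C v \<inter> set (a # P @ [b])) \<le> length (a # P @ [b]) + ?m"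
  proof (rule card_gaps)
    fix pre u r w post assume w: "a # P @ [b] = pre @ u # r @ w # post" "u \<in> feet C v" "w \<in> feet C v"
    have e: "a # P @ b # Q = pre @ u # r @ w # (post @ Q)" using arg_cong[OF w(1), of "\<lambda>l. l @ Q"] by simp
    have "card (blob (pre @ u # r @ w # (post @ Q)) v) \<le> length r"
      by (rule gap_le) (use C1 e v w(2,3) in \<open>auto simp: feet_iff\<close>)
    then show "?m \<le> length r" using blob_cong[OF C1(2)] e by simp
  qed
  moreover have "feet C v \<inter> set (a # P @ [b]) = feet C v"
    using PQ(3) feet_sub[of C v] C1(2) by auto
  moreover have "length P + length Q + 2 = c" using C1 by (auto simp: lcyc_def)
  ultimately show ?thesis using Qm by simp
qed

text \<open>The numbers \<open>t\<close> of feet and \<open>m\<close> of blob vertices satisfy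
  \<open>t + m = k + 1\<close> and \<open>(m + 1) * t \<le> 2 * k + 1\<close>. With
  \<open>m = i + 1\<close> and \<open>t = j + 2\<close> this becomes \<open>i * j \<le> 1\<close>.
  The value 1 exhausts the bound and forces \<open>k = 4\<close> and \<open>c = 9\<close>.\<close>

lemma feet_classification:
  assumes C: "lcyc C" and v: "v \<in> V - set C"
  shows "2 \<le> k" "2 * k \<le> c"
    "card (feet C v) = 2 \<and> card (blob C v) = k - 1 \<or>
     card (feet C v) = k \<and> card (blob C v) = 1 \<or>
     k = 4 \<and> c = 9 \<and> card (feet C v) = 3 \<and> card (blob C v) = 2"
proof -
  let ?m = "card (blob C v)" and ?t = "card (feet C v)"
  have t2: "2 \<le> ?t" and tm: "?t + ?m = k + 1" using outside_cycle[OF C v] by auto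
  have m1: "1 \<le> ?m" by (rule blob_pos)
  have sum: "Suc ?m * ?t \<le> c" by (rule gaps_sum[OF C v])
  define j where "j = ?t - 2"
  define i where "i = ?m - 1"
  have t: "?t = j + 2" and m: "?m = i + 1" using t2 m1 by (auto simp: j_def i_def)
  have k: "k = i + j + 2" using tm t m by simp
  have s: "2 * i + 2 * j + 4 + i * j \<le> c" using sum t m by (simp add: algebra_simps)
  show "2 \<le> k" "2 * k \<le> c" using k s by simp_all
  have "i * j \<le> 1" using s ck k by simp
  then consider "i = 0" | "j = 0" | "i = 1" "j = 1"
    by (cases i; cases j) auto
  then show "?t = 2 \<and> ?m = k - 1 \<or> ?t = k \<and> ?m = 1 \<or> k = 4 \<and> c = 9 \<and> ?t = 3 \<and> ?m = 2"
    using t m k s ck by cases auto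
qed

lemma feet_within:
  assumes "v \<in> V - set C" "\<And>w. w \<in> set C - A \<Longrightarrow> nb w \<subseteq> set C"
  shows "feet C v \<subseteq> A"
  using assms sym[of v] unfolding feet_def nb_def by blast

lemma doubleton_feet:
  assumes "lcyc C" "v \<in> V - set C" "feet C v \<subseteq> {a, b}"
  shows "feet C v = {a, b}"
proof (rule card_seteq[OF _ assms(3)])
  have "card {a, b} \<le> 2" by (simp add: card_insert_if)
  then show "card {a, b} \<le> card (feet C v)" using outside_cycle(1)[OF assms(1,2)] by simp
qed simp

section \<open>Outside vertices with exactly two feet\<close>

lemma lcyc_turn: "lcyc (a # P @ b # Q) \<Longrightarrow> lcyc (b # Q @ a # P)"
  using lcyc_rot[of "a # P" "b # Q"] by simp

text \<open>Both arcs have at least \<open>k - 1\<close> inner vertices and together at most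
  \<open>2 * k - 1\<close>, so one of them has exactly \<open>k - 1\<close>. It is called
  \<open>P\<close>; the other has \<open>k - 1\<close> or \<open>k\<close>.\<close>

lemma two_feet_arcs:
  assumes C: "lcyc C" and v0: "v0 \<in> V - set C" and f: "card (feet C v0) = 2"
  obtains a P b Q where "lcyc (a # P @ b # Q)" "v0 \<in> V - set (a # P @ b # Q)"
    "feet (a # P @ b # Q) v0 = {a, b}" "length P = k - 1" "length Q = c - k - 1"
proof -
  obtain a b where ab: "feet C v0 = {a, b}" "a \<noteq> b" using f card_2_iff by metis
  then have abC: "a \<in> set C" "b \<in> set C" "E v0 a" "E v0 b" using feet_iff[of _ C v0] by auto
  obtain P Q where C1: "lcyc (a # P @ b # Q)" "set (a # P @ b # Q) = set C"
    using lcyc_split[OF C abC(1,2) ab(2)] by blast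
  have C2: "lcyc (b # Q @ a # P)" "set (b # Q @ a # P) = set C"
    using lcyc_turn C1 by auto
  have m: "card (blob C v0) = k - 1" using outside_cycle(2)[OF C v0] f by simp
  have k2: "2 \<le> k" by (rule feet_classification(1)[OF C v0])
  have l: "length P + length Q + 2 = c" using lcyc_length[OF C1(1)] by simp
  have v1: "v0 \<in> V - set (a # P @ b # Q)" "v0 \<in> V - set (b # Q @ a # P)" using v0 C1 C2 by auto
  have m1: "card (blob (a # P @ b # Q) v0) = k - 1" "card (blob (b # Q @ a # P) v0) = k - 1"
    using m blob_cong[OF C1(2)] blob_cong[OF C2(2)] by simp_all
  have f1: "feet (a # P @ b # Q) v0 = {a, b}" "feet (b # Q @ a # P) v0 = {b, a}"
    using ab feet_cong[OF C1(2)] feet_cong[OF C2(2)] by auto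
  have g: "k - 1 \<le> length P" "k - 1 \<le> length Q"
    using gap_le[of "[]" a P b Q v0] gap_le[of "[]" b Q a P v0] C1 C2 v1 m1 abC by auto
  show thesis
  proof (cases "length P = k - 1")
    case True
    then have "length Q = c - k - 1" using l k2 by linarith
    then show thesis using that[OF C1(1) v1(1) f1(1) True] by blast
  next
    case False
    then have "length Q = k - 1" "length P = c - k - 1" using g l k2 ck by linarith+
    then show thesis using that[OF C2(1) v1(2) f1(2)] by blast
  qed
qed

lemma short_arc:
  assumes C: "lcyc (a # P @ b # Q)" and v0: "v0 \<in> V - set (a # P @ b # Q)"
    and f0: "feet (a # P @ b # Q) v0 = {a, b}" and len: "length P = k - 1" and v: "v \<in> set P"
  shows "nb v = {a, b} \<union> (set P - {v})" "clq {a, b} (k - 1) v"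
proof -
  have dist: "distinct (a # P @ b # Q)" by (rule lcyc_distinct[OF C])
  have E0: "E v0 a" "E v0 b" using f0 feet_iff[of _ "a # P @ b # Q" v0] by auto
  have m: "card (blob (a # P @ b # Q) v0) = length P"
    using outside_cycle(2)[OF C v0] f0 dist len by auto
  have nP: "nb w = {a, b} \<union> (set P - {w})" if "w \<in> set P" for w
    by (rule swap2[OF C v0 E0 m len that])
  then show "nb v = {a, b} \<union> (set P - {v})" using v by blast
  have "clq {a, b} (length P) v"
    by (rule clq_segment) (use dist lcyc_V[OF C] nP v in auto)
  then show "clq {a, b} (k - 1) v" using len by simp
qed

text \<open>Both arcs are short and can be swapped, so their inner vertices have no neighbours
  outside the cycle. Only \<open>a\<close> and \<open>b\<close> remain as feet for all other
  components.\<close>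

lemma two_feet_even:
  assumes C0: "lcyc C0" "v0 \<in> V - set C0" "card (feet C0 v0) = 2" and c: "c = 2 * k"
  shows "\<exists>a b. a \<in> V \<and> b \<in> V \<and> a \<noteq> b \<and> (\<forall>v\<in>V - {a, b}. clq {a, b} (k - 1) v)"
proof -
  obtain a P b Q where C: "lcyc (a # P @ b # Q)" and v0: "v0 \<in> V - set (a # P @ b # Q)"
    and f0: "feet (a # P @ b # Q) v0 = {a, b}" and len: "length P = k - 1" "length Q = c - k - 1"
    by (rule two_feet_arcs[OF C0])
  let ?C = "a # P @ b # Q"
  have s: "set (b # Q @ a # P) = set ?C" by auto
  have dist: "distinct ?C" by (rule lcyc_distinct[OF C])
  have P: "nb w = {a, b} \<union> (set P - {w})" "clq {a, b} (k - 1) w" if "w \<in> set P" for w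
    using short_arc[OF C v0 f0 len(1) that] by blast+
  have lQ: "length Q = k - 1" using len(2) c by simp
  have v0': "v0 \<in> V - set (b # Q @ a # P)" "feet (b # Q @ a # P) v0 = {b, a}"
    using v0 f0 feet_cong[OF s] by auto
  have Q: "nb w = {a, b} \<union> (set Q - {w})" "clq {a, b} (k - 1) w" if "w \<in> set Q" for w
    using short_arc[OF lcyc_turn[OF C] v0' lQ that] by (simp_all add: insert_commute)
  have "clq {a, b} (k - 1) v" if v: "v \<in> V - {a, b}" for v
  proof -
    consider "v \<in> set P" | "v \<in> set Q" | "v \<in> V - set ?C" using v by auto
    then show ?thesis
    proof cases
      case 3
      have "feet ?C v \<subseteq> {a, b}"
      proof (rule feet_within[OF 3])
        fix w assume "w \<in> set ?C - {a, b}"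
        then show "nb w \<subseteq> set ?C" using P(1)[of w] Q(1)[of w] by auto
      qed
      then show ?thesis using clq_two[OF C 3 doubleton_feet[OF C 3]] dist by auto
    qed (use P(2) Q(2) in blast)+
  qed
  moreover have "a \<in> V" "b \<in> V" "a \<noteq> b" using dist lcyc_V[OF C] by auto
  ultimately show ?thesis by blast
qed

end

section \<open>The cases of the theorem\<close>

context short_circumference
begin

lemma lcyc_reflect: "lcyc (a # P @ b # Q) \<Longrightarrow> lcyc (b # rev P @ a # rev Q)"
  using lcyc_rot[of "rev Q" "b # rev P @ [a]"] lcyc_rev[of "a # P @ b # Q"] by simp

text \<open>The feet \<open>b\<close> and \<open>q = last Q\<close> cut off the other
  \<open>k - 1\<close> vertices of \<open>Q\<close>, a second gap that can be swapped. As
  \<open>a\<close> and \<open>q\<close> are consecutive on the cycle, no outside vertex is adjacent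
  to both, so every clique hangs on \<open>{a, b}\<close> or on \<open>{b, q}\<close>.\<close>

lemma H1_shape:
  assumes C: "lcyc (a # P @ b # Q)" and k2: "2 \<le> k" and len: "length P = k - 1" "length Q = k"
    and nP: "\<And>v. v \<in> set P \<Longrightarrow> nb v = {a, b} \<union> (set P - {v})"
    and v1: "v1 \<in> V - set (a # P @ b # Q)" "feet (a # P @ b # Q) v1 = {b, last Q}"
  shows "\<exists>a b q. distinct [a, b, q] \<and> {a, b, q} \<subseteq> V \<and> E a q \<and>
    (\<forall>v\<in>V - {a, b, q}. clq {a, b} (k - 1) v \<and> q \<notin> nb v \<or> clq {b, q} (k - 1) v \<and> a \<notin> nb v)"
proof -
  obtain Q' q where Q: "Q = Q' @ [q]" using len k2 by (cases Q rule: rev_cases) auto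
  let ?C = "b # Q' @ q # (a # P)"
  have C2: "lcyc ?C" using lcyc_turn[OF C] Q by simp
  have s: "set (a # P @ b # Q) = set ?C" using Q by auto
  have v1': "v1 \<in> V - set ?C" "feet ?C v1 = {b, q}" using v1 s feet_cong[OF s] Q by auto
  have dist: "distinct ?C" by (rule lcyc_distinct[OF C2])
  have CV: "set ?C \<subseteq> V" by (rule lcyc_V[OF C2])
  have E1: "E v1 b" "E v1 q" using v1'(2) feet_iff[of _ ?C v1] by auto
  have lQ: "length Q' = k - 1" using len Q by simp
  have m: "card (blob ?C v1) = length Q'"
    using outside_cycle(2)[OF C2 v1'(1)] v1'(2) dist lQ by auto
  have nQ: "nb v = {b, q} \<union> (set Q' - {v})" if "v \<in> set Q'" for v
    by (rule swap2[OF C2 v1'(1) E1 m lQ that])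
  have "E q a" using C Q by (auto simp: lcyc_def cyc_def)
  then have Eaq: "E a q" by (rule sym)
  have "clq {a, b} (k - 1) v \<and> q \<notin> nb v \<or> clq {b, q} (k - 1) v \<and> a \<notin> nb v" if v: "v \<in> V - {a, b, q}" for v
  proof -
    consider "v \<in> set P" | "v \<in> set Q'" | "v \<in> V - set ?C" using v by auto
    then show ?thesis
    proof cases
      case 1
      have "clq {a, b} (length P) v"
        by (rule clq_segment) (use dist CV nP 1 in auto)
      moreover have "q \<notin> nb v" using nP[OF 1] dist by auto
      ultimately show ?thesis using len by simp
    next
      case 2
      have "clq {b, q} (length Q') v"
        by (rule clq_segment) (use dist CV nQ 2 in auto)
      moreover have "a \<notin> nb v" using nQ[OF 2] dist by auto
      ultimately show ?thesis using lQ by simp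
    next
      case 3
      have f: "feet ?C v \<subseteq> {a, b, q}"
      proof (rule feet_within[OF 3])
        fix w assume "w \<in> set ?C - {a, b, q}"
        then show "nb w \<subseteq> set ?C" using nP[of w] nQ[of w] by auto
      qed
      have "\<not> (E v q \<and> E v a)" using no_consecutive_feet[of "b # Q'" q a P v] C2 3 by simp
      then have "feet ?C v \<subseteq> {a, b} \<or> feet ?C v \<subseteq> {b, q}" using f by (auto simp: feet_iff)
      then have "feet ?C v = {a, b} \<or> feet ?C v = {b, q}" using doubleton_feet[OF C2 3] by blast
      then show ?thesis
      proof
        assume e: "feet ?C v = {a, b}"
        then have "q \<notin> feet ?C v" using dist by auto
        then have "q \<notin> nb v" by (simp add: feet_def)
        then show ?thesis using clq_two[OF C2 3 e] dist by auto
      next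
        assume e: "feet ?C v = {b, q}"
        then have "a \<notin> feet ?C v" using dist by auto
        then have "a \<notin> nb v" by (simp add: feet_def)
        then show ?thesis using clq_two[OF C2 3 e] dist by auto
      qed
    qed
  qed
  moreover have "distinct [a, b, q]" "{a, b, q} \<subseteq> V" using dist CV by auto
  ultimately show ?thesis using Eaq by blast
qed

text \<open>The count of \<open>gaps_sum\<close> restricted to one arc, which together with its two
  ends has to hold all the feet.\<close>

lemma feet_in_long_arc:
  assumes C: "lcyc (a # P @ b # Q)" and v: "v \<in> V - set (a # P @ b # Q)"
    and P: "feet (a # P @ b # Q) v \<inter> set P = {}"
  shows "Suc (card (blob (a # P @ b # Q) v)) * card (feet (a # P @ b # Q) v)
    \<le> length Q + 2 + card (blob (a # P @ b # Q) v)"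
proof -
  let ?C = "a # P @ b # Q"
  let ?m = "card (blob ?C v)"
  have "Suc ?m * card (feet ?C v \<inter> set (b # Q @ [a])) \<le> length (b # Q @ [a]) + ?m"
  proof (rule card_gaps)
    fix pre u r w post assume w: "b # Q @ [a] = pre @ u # r @ w # post" "u \<in> feet ?C v" "w \<in> feet ?C v"
    have e: "b # Q @ a # P = pre @ u # r @ w # (post @ P)" using arg_cong[OF w(1), of "\<lambda>l. l @ P"] by simp
    have s: "set ?C = set (pre @ u # r @ w # (post @ P))" unfolding e[symmetric] by auto
    have "card (blob (pre @ u # r @ w # (post @ P)) v) \<le> length r"
      by (rule gap_le) (use lcyc_turn[OF C] e v s w(2,3) in \<open>auto simp: feet_iff\<close>)
    then show "?m \<le> length r" using blob_cong[OF s] by simp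
  qed
  moreover have "feet ?C v \<inter> set (b # Q @ [a]) = feet ?C v" using P feet_sub[of ?C v] by auto
  ultimately show ?thesis by simp
qed

lemma middle_feet:
  assumes F: "F \<subseteq> {b, q1, q2, q3, a}" "card F = 3"
    and n: "\<not> (b \<in> F \<and> q1 \<in> F)" "\<not> (q1 \<in> F \<and> q2 \<in> F)" "\<not> (q2 \<in> F \<and> q3 \<in> F)" "\<not> (q3 \<in> F \<and> a \<in> F)"
  shows "F = {b, q2, a}"
proof -
  have no: "\<not> F \<subseteq> {x, y}" for x y
  proof
    assume "F \<subseteq> {x, y}"
    from card_mono[OF _ this] show False using F(2) card_insert_le_m1[of 2 "{y}" x] by auto
  qed
  have q1: "q1 \<notin> F"
  proof
    assume "q1 \<in> F"
    then have "F \<subseteq> {q1, q3} \<or> F \<subseteq> {q1, a}" using F n by auto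
    then show False using no by blast
  qed
  have q3: "q3 \<notin> F"
  proof
    assume "q3 \<in> F"
    then have "F \<subseteq> {q3, b} \<or> F \<subseteq> {q3, q1}" using F n by auto
    then show False using no by blast
  qed
  have "F \<subseteq> {b, q2, a}" using F q1 q3 by auto
  moreover have "card {b, q2, a} \<le> card F" using F(2) by (simp add: card_insert_if)
  ultimately show ?thesis by (intro card_seteq) auto
qed

text \<open>The cycle \<open>u\<close>, \<open>x\<close>, \<open>v\<close>, then \<open>P\<close>
  backwards, then \<open>r\<close>, then \<open>Q\<close> contains all old vertices and
  \<open>x\<close>. An edge between \<open>hd P\<close> and \<open>hd Q\<close> permits
  \<open>r = []\<close>, a common neighbour \<open>y\<close> permits \<open>r = [y]\<close>.\<close>

lemma crossed_feet:
  assumes C: "lcyc (u # P @ v # Q)" and x: "x \<notin> set (u # P @ v # Q)" "E x u" "E x v"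
    and ne: "P \<noteq> []" "Q \<noteq> []"
  shows "\<not> E (hd P) (hd Q)"
    and "y \<notin> set (u # P @ v # Q) \<Longrightarrow> y \<noteq> x \<Longrightarrow> \<not> (E y (hd P) \<and> E y (hd Q))"
proof -
  have cC: "cyc (u # P @ v # Q)" and lC: "length (u # P @ v # Q) = c" using C by (auto simp: lcyc_def)
  have p: "successively E P" "E (last P) v" "successively E Q" "E (last Q) u"
    and d: "distinct (u # P @ v # Q)"
    using cC ne by (auto simp: cyc_def successively_append_iff successively_Cons)
  have rP: "successively E (rev P)" using p(1) by (rule successively_rev_sym)
  have base: "False" if "distinct r" "set r \<inter> set (u # P @ v # Q) = {}" "x \<notin> set r"
    "successively E (hd P # r @ [hd Q])" for r
  proof -
    have "cyc ([u, x, v] @ rev P @ r @ Q)"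
      unfolding cyc_def
    proof (intro conjI)
      show "3 \<le> length ([u, x, v] @ rev P @ r @ Q)" by simp
      show "distinct ([u, x, v] @ rev P @ r @ Q)" using d x(1) that by auto
      show "E (last ([u, x, v] @ rev P @ r @ Q)) (hd ([u, x, v] @ rev P @ r @ Q))" using p ne by simp
      have 1: "successively E [u, x, v]" using x sym[OF x(2)] by (simp add: successively_Cons)
      have 2: "successively E (rev P @ r @ Q)"
        using rP p(3) that(4) ne
        by (cases "r = []") (auto simp: successively_append_iff successively_Cons last_rev hd_append simp del: successively_rev)
      show "successively E ([u, x, v] @ rev P @ r @ Q)"
        using 1 2 ne sym[OF p(2)] successively_append_iff[of E "[u, x, v]" "rev P @ r @ Q"]
        by (auto simp: hd_rev simp del: successively_rev)
    qed
    from bound[OF this] show False using lC by simp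
  qed
  show "\<not> E (hd P) (hd Q)" using base[of "[]"] by auto
  show "\<not> (E y (hd P) \<and> E y (hd Q))" if "y \<notin> set (u # P @ v # Q)" "y \<noteq> x"
    using base[of "[y]"] that sym[of y "hd P"] by auto
qed

text \<open>Decided by the outside vertices with a foot in the long arc \<open>Q\<close>. If there
  are none, the second alternative holds with \<open>S = set Q\<close>; one with exactly two feet
  yields the first; otherwise all of them have three feet, which forces \<open>k = 3\<close> and the
  star.\<close>

lemma two_feet_odd_arcs:
  assumes C: "lcyc (a # P @ b # Q)" and v0: "v0 \<in> V - set (a # P @ b # Q)"
    and f0: "feet (a # P @ b # Q) v0 = {a, b}"
    and len: "length P = k - 1" "length Q = k"
  shows "(\<exists>a b q. distinct [a, b, q] \<and> {a, b, q} \<subseteq> V \<and> E a q \<and>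
      (\<forall>v\<in>V - {a, b, q}. clq {a, b} (k - 1) v \<and> q \<notin> nb v \<or> clq {b, q} (k - 1) v \<and> a \<notin> nb v)) \<or>
    (\<exists>a b S. a \<in> V \<and> b \<in> V \<and> a \<noteq> b \<and> S \<subseteq> V - {a, b} \<and> card S = k \<and>
      (\<forall>v\<in>V - {a, b} - S. clq {a, b} (k - 1) v \<and> nb v \<inter> S = {})) \<or>
    k = 3 \<and> (\<exists>a b q S. a \<in> V \<and> b \<in> V \<and> a \<noteq> b \<and> q \<in> S \<and> S \<subseteq> V - {a, b} \<and>
      (\<forall>u\<in>S. \<forall>v\<in>S. E u v \<longrightarrow> u = q \<or> v = q) \<and>
      (\<forall>v\<in>V - {a, b} - S. clq {a, b} 2 v \<and> nb v \<inter> S = {}))"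
    (is "?H1 \<or> ?K \<or> ?star")
proof -
  let ?C = "a # P @ b # Q"
  have k2: "2 \<le> k" by (rule feet_classification(1)[OF C v0])
  have dist: "distinct ?C" by (rule lcyc_distinct[OF C])
  have CV: "set ?C \<subseteq> V" by (rule lcyc_V[OF C])
  have nP: "nb v = {a, b} \<union> (set P - {v})" and clP: "clq {a, b} (k - 1) v" if "v \<in> set P" for v
    using short_arc[OF C v0 f0 len(1) that] by blast+
  have fP: "feet ?C v \<inter> set P = {}" if v: "v \<in> V - set ?C" for v
    using feet_within[OF v, of "- set P"] nP by auto
  have short: "feet ?C v = {a, b} \<or> feet ?C v \<inter> set Q \<noteq> {}" if v: "v \<in> V - set ?C" for v
  proof (cases "feet ?C v \<inter> set Q = {}")
    case True
    then have "feet ?C v \<subseteq> {a, b}" using fP[OF v] feet_sub[of ?C v] by auto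
    then show ?thesis using doubleton_feet[OF C v] by blast
  qed blast
  have clS: "clq {a, b} (k - 1) v" if "v \<in> V - set ?C" "feet ?C v = {a, b}" for v
    by (rule clq_two[OF C that]) (use dist in auto)
  show ?thesis
  proof (cases "\<exists>v\<in>V - set ?C. feet ?C v \<inter> set Q \<noteq> {}")
    case False
    have "clq {a, b} (k - 1) v \<and> nb v \<inter> set Q = {}" if v: "v \<in> V - {a, b} - set Q" for v
    proof (cases "v \<in> set P")
      case True
      then show ?thesis using clP nP[OF True] dist by auto
    next
      case False
      then have v': "v \<in> V - set ?C" using v by auto
      then have "feet ?C v \<inter> set Q = {}" using \<open>\<not> (\<exists>v\<in>V - set ?C. feet ?C v \<inter> set Q \<noteq> {})\<close> by blast
      moreover have "nb v \<inter> set Q = feet ?C v \<inter> set Q" by (auto simp: feet_def)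
      ultimately show ?thesis using short[OF v'] clS[OF v'] by auto
    qed
    moreover have "card (set Q) = k" using dist distinct_card[of Q] len by simp
    moreover have "a \<in> V" "b \<in> V" "a \<noteq> b" "set Q \<subseteq> V - {a, b}" using dist CV by auto
    ultimately have ?K by (intro exI[of _ a] exI[of _ b] exI[of _ "set Q"]) blast
    then show ?thesis by blast
  next
    case True
    have dich: "card (feet ?C v) = 2 \<or> k = 3 \<and> card (feet ?C v) = 3" if v: "v \<in> V - set ?C" for v
    proof -
      have le: "Suc (card (blob ?C v)) * card (feet ?C v) \<le> k + 2 + card (blob ?C v)"
        using feet_in_long_arc[OF C v fP[OF v]] len by simp
      define j where "j = card (feet ?C v) - 2"
      define i where "i = card (blob ?C v) - 1"
      have ji: "card (feet ?C v) = j + 2" "card (blob ?C v) = i + 1"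
        using outside_cycle(1)[OF C v] blob_pos[of ?C v] by (auto simp: j_def i_def)
      have kk: "k = i + j + 2" using outside_cycle(2)[OF C v] ji by simp
      \<comment> \<open>Three feet thus occur only for \<open>i = 0\<close> and
        \<open>j = 1\<close>, that is for \<open>k = 3\<close>.\<close>
      have "i * j + j \<le> 1" using le ji kk by (simp add: algebra_simps)
      then show ?thesis using ji kk by (cases j; cases i) auto
    qed
    show ?thesis
    proof (cases "\<exists>v\<in>V - set ?C. feet ?C v \<inter> set Q \<noteq> {} \<and> card (feet ?C v) = 2")
      case True
      then obtain v f where v: "v \<in> V - set ?C" and f: "f \<in> feet ?C v" "f \<in> set Q" and c2: "card (feet ?C v) = 2"
        by blast
      obtain f' where f': "feet ?C v = {f, f'}" "f \<noteq> f'"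
      proof -
        obtain x y where xy: "feet ?C v = {x, y}" "x \<noteq> y" using c2 by (auto simp: card_2_iff)
        then have "f = x \<or> f = y" using f(1) by auto
        then show ?thesis using that[of x] that[of y] xy insert_commute[of x y "{}"] by auto
      qed
      have Ef: "E v f" "E v f'" "f' \<in> set ?C" using f' feet_iff[of _ ?C v] by auto
      have mb: "card (blob ?C v) = k - 1" using outside_cycle(2)[OF C v] c2 by simp
      have gap: "k - 1 \<le> length r" if l: "lcyc (pre @ u # r @ w # post)" "set ?C = set (pre @ u # r @ w # post)"
        "E v u" "E v w" for pre u r w post
      proof -
        have "v \<in> V - set (pre @ u # r @ w # post)" using v l(2) by blast
        from gap_le[OF l(1) this l(3,4)] show ?thesis using blob_cong[OF l(2), of v] mb by simp
      qed
      obtain Q1 Q2 where Q: "Q = Q1 @ f # Q2" using f(2) by (meson split_list)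
      have lQ: "length Q1 + length Q2 + 1 = k" using len(2) Q by simp
      have "f' \<notin> set P" using fP[OF v] f'(1) by auto
      \<comment> \<open>A gap of \<open>k - 1\<close> vertices leaves room for only one foot in
        \<open>Q\<close>. The other foot is \<open>a\<close> or \<open>b\<close>, and
        \<open>f\<close> sits at the opposite end of \<open>Q\<close>.\<close>
      then consider "f' = b" | "f' = a" | "f' \<in> set Q1" | "f' \<in> set Q2" using Ef(3) f'(2) Q by auto
      then have ends: "f' = b \<and> f = last Q \<or> f' = a \<and> f = hd Q"
      proof cases
        case 1
        have "k - 1 \<le> length Q1"
          by (rule gap[of "[]" b Q1 f "Q2 @ a # P"]) (use lcyc_turn[OF C] Q Ef 1 in auto)
        then have "Q2 = []" using lQ k2 by auto
        then show ?thesis using 1 Q by simp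
      next
        case 2
        have "k - 1 \<le> length Q2"
          by (rule gap[of "b # Q1" f Q2 a P]) (use lcyc_turn[OF C] Q Ef 2 in auto)
        then have "Q1 = []" using lQ k2 by auto
        then show ?thesis using 2 Q by simp
      next
        case 3
        then obtain R S where R: "Q1 = R @ f' # S" by (meson split_list)
        have "k - 1 \<le> length S"
          by (rule gap[of "a # P @ b # R" f' S f Q2]) (use C Q R Ef in auto)
        then show ?thesis using lQ R by simp
      next
        case 4
        then obtain R S where R: "Q2 = R @ f' # S" by (meson split_list)
        have "k - 1 \<le> length R"
          by (rule gap[of "a # P @ b # Q1" f R f' S]) (use C Q R Ef in auto)
        then show ?thesis using lQ R by simp
      qed
      then have ?H1
      proof
        assume e: "f' = b \<and> f = last Q"
        show ?thesis
          by (rule H1_shape[OF C k2 len nP v]) (use f' e in auto)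
      next
        \<comment> \<open>Reversing the cycle exchanges \<open>a\<close> with \<open>b\<close> and
          the two ends of \<open>Q\<close>, which reduces this to the other case.\<close>
        assume e: "f' = a \<and> f = hd Q"
        have s: "set ?C = set (b # rev P @ a # rev Q)" by auto
        show ?thesis
        proof (rule H1_shape[OF lcyc_reflect[OF C] k2])
          show "length (rev P) = k - 1" "length (rev Q) = k" using len by auto
          show "nb w = {b, a} \<union> (set (rev P) - {w})" if "w \<in> set (rev P)" for w
            using nP[of w] that by auto
          show "v \<in> V - set (b # rev P @ a # rev Q)" using v by auto
          show "feet (b # rev P @ a # rev Q) v = {a, last (rev Q)}"
          proof -
            have "Q \<noteq> []" using f(2) by auto
            then have "last (rev Q) = f" using e by (simp add: last_rev)
            then show ?thesis using feet_cong[OF s, of v] f'(1) e by (metis insert_commute)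
          qed
        qed
      qed
      then show ?thesis by blast
    next
      case no2: False
      obtain x where x: "x \<in> V - set ?C" "feet ?C x \<inter> set Q \<noteq> {}" using True by blast
      have k3: "k = 3" using dich[OF x(1)] no2 x by blast
      then obtain q1 q2 q3 where Q: "Q = [q1, q2, q3]"
        using len(2) by (auto simp: numeral_3_eq_3 length_Suc_conv)
      have mid: "feet ?C v = {b, q2, a}" if v: "v \<in> V - set ?C" "feet ?C v \<inter> set Q \<noteq> {}" for v
      proof (rule middle_feet)
        show "card (feet ?C v) = 3" using dich[OF v(1)] no2 v by blast
        show "feet ?C v \<subseteq> {b, q1, q2, q3, a}" using feet_sub[of ?C v] fP[OF v(1)] Q by auto
        have t: "lcyc ([b, q1, q2, q3] @ a # P)" using lcyc_turn[OF C] Q by simp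
        show "\<not> (b \<in> feet ?C v \<and> q1 \<in> feet ?C v)"
          using no_consecutive_feet[of "[]" b q1 "q2 # q3 # a # P" v] t v Q by (auto simp: feet_iff)
        show "\<not> (q1 \<in> feet ?C v \<and> q2 \<in> feet ?C v)"
          using no_consecutive_feet[of "[b]" q1 q2 "q3 # a # P" v] t v Q by (auto simp: feet_iff)
        show "\<not> (q2 \<in> feet ?C v \<and> q3 \<in> feet ?C v)"
          using no_consecutive_feet[of "[b, q1]" q2 q3 "a # P" v] t v Q by (auto simp: feet_iff)
        show "\<not> (q3 \<in> feet ?C v \<and> a \<in> feet ?C v)"
          using no_consecutive_feet[of "[b, q1, q2]" q3 a P v] t v Q by (auto simp: feet_iff)
      qed
      \<comment> \<open>\<open>q1\<close> and \<open>q3\<close> follow the feet \<open>b\<close> and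
        \<open>q2\<close> of \<open>x\<close> on the cycle, so \<open>crossed_feet\<close> forbids
        this edge.\<close>
      have ne13: "\<not> E q1 q3"
      proof -
        have Ex: "E x b" "E x q2" using mid[OF x] feet_iff[of _ ?C x] by auto
        show ?thesis
          using crossed_feet(1)[of b "[q1]" q2 "q3 # a # P" x] lcyc_turn[OF C] Q x(1) Ex by simp
      qed
      \<comment> \<open>These vertices join \<open>Q\<close> in the star: each has neighbourhood
        exactly \<open>{b, q2, a}\<close>, so within \<open>?S\<close> only edges at the centre
        \<open>q2\<close> remain.\<close>
      define Z where "Z = {v \<in> V - set ?C. feet ?C v \<inter> set Q \<noteq> {}}"
      have nbZ: "nb z = {b, q2, a}" if z: "z \<in> Z" for z
      proof -
        have z1: "z \<in> V - set ?C" "feet ?C z \<inter> set Q \<noteq> {}" using z unfolding Z_def by blast+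
        have z2: "feet ?C z = {b, q2, a}" by (rule mid[OF z1])
        have "card {b, q2, a} = 3" using dist Q by auto
        then have "card (feet ?C z) = 3" using z2 by (simp only:)
        then have "card (blob ?C z) = 1" using outside_cycle(2)[OF C z1(1)] k3 by linarith
        then obtain y where "blob ?C z = {y}" by (rule card_1_singletonE)
        then have y: "blob ?C z = {z}" using blob_self[of z ?C] by simp
        have "nb z = feet ?C z \<union> (blob ?C z - {z})" by (rule outside_cycle(3)[OF C z1(1) blob_self])
        then show ?thesis unfolding y z2 by simp
      qed
      let ?S = "set Q \<union> Z"
      have ZC: "Z \<subseteq> V - set ?C" by (auto simp: Z_def)
      have SV: "?S \<subseteq> V - {a, b}" using ZC dist CV by auto
      have edges: "u = q2 \<or> v = q2" if uv: "u \<in> ?S" "v \<in> ?S" "E u v" for u v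
      proof (rule ccontr)
        assume n: "\<not> ?thesis"
        have "u \<notin> Z"
        proof
          assume "u \<in> Z"
          from nbZ[OF this] have "v \<in> {b, q2, a}" using uv(3) nb_iff by blast
          then show False using n uv(2) SV by auto
        qed
        moreover have "v \<notin> Z"
        proof
          assume "v \<in> Z"
          from nbZ[OF this] have "u \<in> {b, q2, a}" using sym[OF uv(3)] nb_iff by blast
          then show False using n uv(1) SV by auto
        qed
        ultimately have "u \<in> {q1, q3}" "v \<in> {q1, q3}" using uv n Q by auto
        then show False using uv(3) ne13 sym[of q3 q1] irr by auto
      qed
      have rest: "clq {a, b} 2 v \<and> nb v \<inter> ?S = {}" if v: "v \<in> V - {a, b} - ?S" for v
      proof (cases "v \<in> set P")
        case True
        have "z \<notin> nb v" if "z \<in> Z" for z using nP[OF True] ZC that dist by auto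
        then show ?thesis using clP[OF True] nP[OF True] dist k3 by auto
      next
        case False
        then have v': "v \<in> V - set ?C" using v by auto
        then have fv: "feet ?C v = {a, b}" using short[OF v'] v by (auto simp: Z_def)
        have "z \<notin> nb v" if "z \<in> Z" for z
        proof
          assume "z \<in> nb v"
          then have "v \<in> nb z" using sym[of v z] by (simp add: nb_iff)
          then show False using nbZ[OF that] v Q by auto
        qed
        moreover have "nb v \<inter> set Q = {}"
        proof -
          have "nb v \<inter> set Q \<subseteq> feet ?C v" by (auto simp: feet_def)
          then show ?thesis using fv dist by auto
        qed
        ultimately show ?thesis using clS[OF v' fv] k3 by auto
      qed
      have 1: "a \<in> V" "b \<in> V" "a \<noteq> b" "q2 \<in> ?S" using dist CV Q by auto
      have 2: "\<forall>u\<in>?S. \<forall>v\<in>?S. E u v \<longrightarrow> u = q2 \<or> v = q2" using edges by blast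
      have 3: "\<forall>v\<in>V - {a, b} - ?S. clq {a, b} 2 v \<and> nb v \<inter> ?S = {}" using rest by blast
      have ?star
        by (intro conjI k3 exI[of _ a] exI[of _ b] exI[of _ q2] exI[of _ ?S] 1 2 3 SV)
      then show ?thesis by blast
    qed
  qed
qed

lemma outside_vertex:
  assumes "lcyc C"
  obtains x where "x \<in> V - set C"
proof -
  have "\<not> V \<subseteq> set C"
  proof
    assume "V \<subseteq> set C"
    then have "card V \<le> length C" using card_mono[of "set C" V] card_length[of C] by simp
    then show False using cn lcyc_length[OF assms] by simp
  qed
  then show thesis using that by blast
qed

section \<open>Components with two vertices and three feet\<close>

lemma three_arcs:
  assumes C: "lcyc (a1 # P1 @ a2 # P2 @ a3 # P3)"
    and len: "length P1 = 2" "length P2 = 2" "length P3 = 2" and k: "k = 4"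
    and v0: "v0 \<in> V - set (a1 # P1 @ a2 # P2 @ a3 # P3)" "E v0 a1" "E v0 a2" "E v0 a3"
    and m: "card (blob (a1 # P1 @ a2 # P2 @ a3 # P3) v0) = 2" and v: "v \<in> set P1"
  shows "nb v = {a1, a2, a3} \<union> (set P1 - {v})"
proof -
  let ?C = "a1 # P1 @ a2 # P2 @ a3 # P3"
  let ?C2 = "a2 # P2 @ a3 # (P3 @ a1 # P1)"
  let ?C3 = "a3 # P3 @ a1 # (P1 @ a2 # P2)"
  have C2: "lcyc ?C2" using lcyc_rot[of "a1 # P1" "a2 # P2 @ a3 # P3"] C by simp
  have C3: "lcyc ?C3" using lcyc_rot[of "a1 # P1 @ a2 # P2" "a3 # P3"] C by simp
  have s: "set ?C2 = set ?C" "set ?C3 = set ?C" by auto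
  have dist: "distinct ?C" by (rule lcyc_distinct[OF C])
  obtain F1 where F1: "{a1, a2} \<subseteq> F1" "F1 \<subseteq> {a1, a2} \<union> set (P2 @ a3 # P3)" "card F1 + length P1 = k + 1"
    "\<And>v. v \<in> set P1 \<Longrightarrow> nb v = F1 \<union> (set P1 - {v})"
    by (rule swap[OF C v0(1,2,3)]) (use m len in auto)
  obtain F2 where F2: "{a2, a3} \<subseteq> F2" "F2 \<subseteq> {a2, a3} \<union> set (P3 @ a1 # P1)" "card F2 + length P2 = k + 1"
    "\<And>v. v \<in> set P2 \<Longrightarrow> nb v = F2 \<union> (set P2 - {v})"
    by (rule swap[OF C2 _ v0(3,4)]) (use m len v0(1) blob_cong[OF s(1)] in auto)
  obtain F3 where F3: "{a3, a1} \<subseteq> F3" "F3 \<subseteq> {a3, a1} \<union> set (P1 @ a2 # P2)" "card F3 + length P3 = k + 1"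
    "\<And>v. v \<in> set P3 \<Longrightarrow> nb v = F3 \<union> (set P3 - {v})"
    by (rule swap[OF C3 _ v0(4,2)]) (use m len v0(1) blob_cong[OF s(2)] in auto)
  have c3: "card F1 = 3" "card F2 = 3" "card F3 = 3" using F1(3) F2(3) F3(3) len k by auto
  have cP: "card (set P1) = 2" using dist len distinct_card[of P1] by simp
  \<comment> \<open>If the third foot of \<open>P1\<close> lay in another gap \<open>P\<close>, both
    vertices of \<open>P1\<close> would belong to the attachment set \<open>F\<close> of
    \<open>P\<close>, in addition to the two ends \<open>x\<close>, \<open>y\<close> of that gap:
    four elements instead of three.\<close>
  have absurd: False if f: "f \<in> F1" "f \<in> set P" and nbP: "\<And>v. v \<in> set P \<Longrightarrow> nb v = F \<union> (set P - {v})"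
    and F: "card F = 3" "{x, y} \<subseteq> F" "x \<noteq> y" "{x, y} \<inter> set P1 = {}" "set P \<inter> set P1 = {}" for f P F x y
  proof -
    have "set P1 \<subseteq> F"
    proof
      fix p assume p: "p \<in> set P1"
      then have "f \<in> nb p" using F1(4)[OF p] f(1) by blast
      then have "p \<in> nb f" using sym[of p f] by (simp add: nb_iff)
      then show "p \<in> F" using nbP[OF f(2)] p F(5) by auto
    qed
    then have "set P1 \<union> {x, y} \<subseteq> F" using F(2) by blast
    then have "card (set P1 \<union> {x, y}) \<le> card F" by (rule card_mono[rotated]) (use F(1) card_ge_0_finite in force)
    moreover have "card (set P1 \<union> {x, y}) = card (set P1) + card {x, y}"
      by (rule card_Un_disjoint) (use F(4) in auto)
    ultimately show False using cP F(1,3) by simp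
  qed
  have "F1 \<inter> set P2 = {}"
  proof -
    have "{a2, a3} \<inter> set P1 = {}" "set P2 \<inter> set P1 = {}" "a2 \<noteq> a3" using dist by auto
    then show ?thesis using absurd[of _ P2 F2 a2 a3] F2(1,4) c3 by blast
  qed
  moreover have "F1 \<inter> set P3 = {}"
  proof -
    have "{a3, a1} \<inter> set P1 = {}" "set P3 \<inter> set P1 = {}" "a3 \<noteq> a1" using dist by auto
    then show ?thesis using absurd[of _ P3 F3 a3 a1] F3(1,4) c3 by blast
  qed
  ultimately have "F1 \<subseteq> {a1, a2, a3}" using F1(2) by auto
  then have "F1 = {a1, a2, a3}"
    by (rule card_seteq[rotated]) (use c3 in \<open>auto simp: card_insert_if\<close>)
  then show ?thesis using F1(4)[OF v] by simp
qed

lemma three_feet: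
  assumes C: "lcyc C" and v0: "v0 \<in> V - set C"
    and k4: "k = 4" "c = 9" "card (feet C v0) = 3" "card (blob C v0) = 2"
    and no2: "\<And>v. v \<in> V - set C \<Longrightarrow> card (feet C v) \<noteq> 2"
  shows "\<exists>A. A \<subseteq> V \<and> card A = 3 \<and> (\<forall>v\<in>V - A. clq A 2 v)"
proof -
  obtain x y z where xyz: "feet C v0 = {x, y, z}" "x \<noteq> y" "x \<noteq> z" "y \<noteq> z"
    using k4(3) card_3_iff by metis
  have xC: "x \<in> set C" "y \<in> set C" "z \<in> set C" using xyz(1) feet_sub[of C v0] by auto
  obtain P Q where PQ: "lcyc (x # P @ y # Q)" "set (x # P @ y # Q) = set C"
    using lcyc_split[OF C xC(1,2) xyz(2)] by blast
  have "z \<in> set P \<or> z \<in> set Q" using xC(3) PQ(2) xyz by auto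
  then obtain a1 P1 a2 P2 a3 P3 where D: "lcyc (a1 # P1 @ a2 # P2 @ a3 # P3)"
    "set (a1 # P1 @ a2 # P2 @ a3 # P3) = set C" "feet C v0 = {a1, a2, a3}"
  proof
    assume "z \<in> set P"
    then obtain R S where R: "P = R @ z # S" by (meson split_list)
    show thesis by (rule that[of x R z S y Q]) (use PQ R xyz in auto)
  next
    assume "z \<in> set Q"
    then obtain R S where R: "Q = R @ z # S" by (meson split_list)
    show thesis by (rule that[of x P y R z S]) (use PQ R xyz in auto)
  qed
  let ?C = "a1 # P1 @ a2 # P2 @ a3 # P3"
  let ?C2 = "a2 # P2 @ a3 # P3 @ a1 # P1"
  let ?C3 = "a3 # P3 @ a1 # P1 @ a2 # P2"
  have C2: "lcyc ?C2" using lcyc_rot[of "a1 # P1" "a2 # P2 @ a3 # P3"] D(1) by simp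
  have C3: "lcyc ?C3" using lcyc_rot[of "a1 # P1 @ a2 # P2" "a3 # P3"] D(1) by simp
  have s: "set ?C2 = set C" "set ?C3 = set C" using D(2) by auto
  have v: "v0 \<in> V - set ?C" "v0 \<in> V - set ?C2" "v0 \<in> V - set ?C3" using v0 D(2) s by blast+
  have Ea: "E v0 a1" "E v0 a2" "E v0 a3" using D(3) feet_iff[of _ C v0] by auto
  have m: "card (blob ?C v0) = 2" "card (blob ?C2 v0) = 2" "card (blob ?C3 v0) = 2"
    using k4(4) blob_cong[OF D(2)] blob_cong[OF s(1)] blob_cong[OF s(2)] by simp_all
  have "2 \<le> length P1" "2 \<le> length P2" "2 \<le> length P3"
    using gap_le[of "[]" a1 P1 a2 "P2 @ a3 # P3" v0] gap_le[of "[]" a2 P2 a3 "P3 @ a1 # P1" v0]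
      gap_le[of "[]" a3 P3 a1 "P1 @ a2 # P2" v0] D(1) C2 C3 v m Ea by auto
  \<comment> \<open>The cycle has nine vertices, three of them feet, so all three gaps have exactly
    two.\<close>
  moreover have "length P1 + length P2 + length P3 = 6" using lcyc_length[OF D(1)] k4(2) by simp
  ultimately have len: "length P1 = 2" "length P2 = 2" "length P3 = 2" by simp_all
  let ?A = "{a1, a2, a3}"
  have dist: "distinct ?C" by (rule lcyc_distinct[OF D(1)])
  have CV: "set ?C \<subseteq> V" by (rule lcyc_V[OF D(1)])
  have n1: "nb w = ?A \<union> (set P1 - {w})" if "w \<in> set P1" for w
    by (rule three_arcs[OF D(1) len k4(1) v(1) Ea m(1) that])
  have n2: "nb w = ?A \<union> (set P2 - {w})" if "w \<in> set P2" for w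
    using three_arcs[OF C2 len(2,3,1) k4(1) v(2) Ea(2,3,1) m(2) that] by auto
  have n3: "nb w = ?A \<union> (set P3 - {w})" if "w \<in> set P3" for w
    using three_arcs[OF C3 len(3,1,2) k4(1) v(3) Ea(3,1,2) m(3) that] by auto
  have cA: "card ?A = 3" using D(3) k4(3) by simp
  have "clq ?A 2 w" if w: "w \<in> V - ?A" for w
  proof -
    consider "w \<in> set P1" | "w \<in> set P2" | "w \<in> set P3" | "w \<in> V - set C" using w D(2) by auto
    then show ?thesis
    proof cases
      case 1
      have "clq ?A (length P1) w" by (rule clq_segment) (use dist CV n1 1 in auto)
      then show ?thesis using len by simp
    next
      case 2
      have "clq ?A (length P2) w" by (rule clq_segment) (use dist CV n2 2 in auto)
      then show ?thesis using len by simp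
    next
      case 3
      have "clq ?A (length P3) w" by (rule clq_segment) (use dist CV n3 3 in auto)
      then show ?thesis using len by simp
    next
      case 4
      have f: "feet C w \<subseteq> ?A"
      proof (rule feet_within[OF 4], unfold D(2)[symmetric])
        fix u assume "u \<in> set ?C - ?A"
        then show "nb u \<subseteq> set ?C" using n1[of u] n2[of u] n3[of u] by auto
      qed
      \<comment> \<open>This excludes one-vertex components, which would have \<open>k = 4\<close>
        feet.\<close>
      have "card (feet C w) \<le> 3" using card_mono[OF _ f] cA by simp
      then have c3: "card (feet C w) = 3" using outside_cycle(1)[OF C 4] no2[OF 4] by simp
      then have "feet C w = ?A" by (intro card_seteq) (use f cA in auto)
      moreover have "card (blob C w) = 2" using outside_cycle(2)[OF C 4] c3 k4(1) by simp
      ultimately show ?thesis using clq_out[OF C 4] by simp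
    qed
  qed
  moreover have "?A \<subseteq> V" using CV by auto
  ultimately show ?thesis using cA by blast
qed

section \<open>Components consisting of single vertices\<close>

lemma successors_of_feet:
  assumes C: "lcyc C" and x: "x \<in> V - set C"
    and u: "C = p1 @ a # u # q1" "E x a" and v: "C = p2 @ b # v # q2" "E x b" and uv: "u \<noteq> v"
  shows "\<not> E u v" "y \<in> V - set C \<Longrightarrow> y \<noteq> x \<Longrightarrow> \<not> (E y u \<and> E y v)"
proof -
  \<comment> \<open>The case in which \<open>a\<close> precedes \<open>b\<close> in the list;
    rotating the list to start at \<open>a\<close> puts \<open>u\<close> and \<open>v\<close> at the
    heads of the two arcs, as \<open>crossed_feet\<close> requires.\<close>
  have *: "\<not> E u v \<and> (\<forall>y. y \<in> V - set C \<and> y \<noteq> x \<longrightarrow> \<not> (E y u \<and> E y v))"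
    if u: "C = p1 @ a # u # q1" "E x a" and v: "C = p2 @ b # v # q2" "E x b" and uv: "u \<noteq> v"
      and r: "p2 = p1 @ r" for p1 a u q1 p2 b v q2 r
  proof -
    have e: "a # u # q1 = r @ b # v # q2" using u(1) v(1) r by simp
    then have "r \<noteq> []" using uv by auto
    then obtain r1 where r1: "r = a # r1" "u # q1 = r1 @ b # v # q2" using e by (cases r) auto
    have "r1 \<noteq> []"
    proof
      assume "r1 = []"
      then have "C = p1 @ a # b # v # q2" using r1 u by simp
      then show False using no_consecutive_feet[of p1 a b "v # q2" x] C x u(2) v(2) by auto
    qed
    then obtain r2 where r2: "r1 = u # r2" using r1 by (cases r1) auto
    have eC: "C = p1 @ a # (u # r2) @ b # (v # q2)" using u(1) r1 r2 by simp
    have C': "lcyc (a # (u # r2) @ b # ((v # q2) @ p1))"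
      using lcyc_rot[of p1 "a # (u # r2) @ b # (v # q2)"] C eC by simp
    have s: "set (a # (u # r2) @ b # ((v # q2) @ p1)) = set C" using eC by auto
    have xs: "x \<notin> set (a # (u # r2) @ b # ((v # q2) @ p1))" using x s by blast
    show ?thesis
      using crossed_feet[OF C' xs u(2) v(2)] s by auto
  qed
  have "(\<exists>r. p2 = p1 @ r) \<or> (\<exists>r. p1 = p2 @ r)"
  proof -
    have "p1 @ a # u # q1 = p2 @ b # v # q2" using u(1) v(1) by simp
    then show ?thesis by (auto simp: append_eq_append_conv2)
  qed
  then have "\<not> E u v \<and> (\<forall>y. y \<in> V - set C \<and> y \<noteq> x \<longrightarrow> \<not> (E y u \<and> E y v))"
  proof
    assume "\<exists>r. p2 = p1 @ r"
    then show ?thesis using *[OF u v uv] by blast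
  next
    assume "\<exists>r. p1 = p2 @ r"
    then show ?thesis using *[OF v u uv[symmetric]] sym by blast
  qed
  then show "\<not> E u v" "y \<in> V - set C \<Longrightarrow> y \<noteq> x \<Longrightarrow> \<not> (E y u \<and> E y v)" by blast+
qed

lemma predecessors_of_feet:
  assumes C: "lcyc C" and x: "x \<in> V - set C"
    and u: "C = p1 @ u # a # q1" "E x a" and v: "C = p2 @ v # b # q2" "E x b" and uv: "u \<noteq> v"
  shows "\<not> E u v" "y \<in> V - set C \<Longrightarrow> y \<noteq> x \<Longrightarrow> \<not> (E y u \<and> E y v)"
proof -
  have 1: "rev C = rev q1 @ a # u # rev p1" using u(1) by simp
  have 2: "rev C = rev q2 @ b # v # rev p2" using v(1) by simp
  have x': "x \<in> V - set (rev C)" using x by simp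
  show "\<not> E u v" by (rule successors_of_feet(1)[OF lcyc_rev[OF C] x' 1 u(2) 2 v(2) uv])
  show "\<not> (E y u \<and> E y v)" if "y \<in> V - set C" "y \<noteq> x"
    by (rule successors_of_feet(2)[OF lcyc_rev[OF C] x' 1 u(2) 2 v(2) uv]) (use that in auto)
qed

lemma filter_feet:
  assumes "distinct w" "A \<subseteq> set w"
  shows "length (filter (\<lambda>z. z \<in> A) w) = card A"
proof -
  have "set (filter (\<lambda>z. z \<in> A) w) = A" using assms(2) by auto
  then show ?thesis using distinct_card[of "filter (\<lambda>z. z \<in> A) w"] assms(1) by simp
qed

text \<open>The \<open>k\<close> feet of \<open>x\<close> are pairwise nonconsecutive among
  \<open>2 * k\<close> vertices, so the cycle alternates between \<open>nb x\<close> and other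
  vertices. The latter are successors of feet, hence independent, and an outside vertex with a
  neighbour among them would have too few neighbours.\<close>

lemma single_feet_even:
  assumes C: "lcyc C" and k3: "3 \<le> k" and c: "c = 2 * k"
    and single: "\<And>v. v \<in> V - set C \<Longrightarrow> feet C v = nb v \<and> card (nb v) = k"
  shows "\<exists>A. A \<subseteq> V \<and> card A = k \<and> (\<forall>u\<in>V - A. \<forall>v\<in>V - A. \<not> E u v)"
proof -
  obtain x where x: "x \<in> V - set C" by (rule outside_vertex[OF C])
  let ?A = "nb x"
  have cA: "card ?A = k" and AC: "?A \<subseteq> set C" using single[OF x] feet_sub[of C x] by auto
  obtain a where a: "a \<in> ?A" using cA k3 by fastforce
  obtain p q where pq: "C = p @ a # q" using a AC by (meson split_list subsetD)
  define w where "w = q @ p"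
  have C1: "lcyc (a # w)" "set (a # w) = set C"
    using lcyc_rot[of p "a # q"] C pq by (auto simp: w_def)
  have x1: "x \<in> V - set (a # w)" using x C1(2) by simp
  have dist: "distinct (a # w)" by (rule lcyc_distinct[OF C1(1)])
  have lw: "length w + 1 = 2 * k" using lcyc_length[OF C1(1)] c by simp
  \<comment> \<open>Repeating \<open>a\<close> makes the closing pair of the cycle a consecutive
    pair of the list. There are \<open>k + 1\<close> occurrences of feet in \<open>2 * k + 1\<close>
    places, which is tight.\<close>
  let ?L = "a # w @ [a]"
  have AL: "length (filter (\<lambda>z. z \<in> ?A) ?L) = k + 1"
    using filter_feet[OF dist, of ?A] AC C1(2) cA a by simp
  have wne: "w \<noteq> []" using lw k3 by auto
  have foll: "\<not> (E y u \<and> E y v)" if L: "?L = pre @ u # v # post" and y: "y \<in> V - set C" for pre u v post y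
  proof (cases post rule: rev_cases)
    case Nil
    then have e: "a # w = pre @ [u]" "v = a" using L by (auto simp flip: append_Cons)
    obtain r where r: "pre = a # r" using e wne by (cases pre) auto
    have "lcyc (u # a # r)" using lcyc_rot[of "a # r" "[u]"] C1(1) e r by simp
    moreover have "set (u # a # r) = set C" using C1(2) e r by auto
    ultimately show ?thesis using no_consecutive_feet[of "[]" u a r y] y e by auto
  next
    case (snoc ps z)
    then have e: "a # w = pre @ u # v # ps" using L by (auto simp flip: append_Cons append_assoc)
    then show ?thesis using no_consecutive_feet[of pre u v ps y] C1 y by auto
  qed
  have nocon: "\<not> (u \<in> ?A \<and> v \<in> ?A)" if "?L = pre @ u # v # post" for pre u v post
    using foll[OF that x] by (simp add: nb_iff)
  have tight: "Suc (length ?L) \<le> 2 * length (filter (\<lambda>z. z \<in> ?A) ?L)" using AL lw by simp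
  have nbrs: "\<exists>p a1 a2 q. ?L = p @ a1 # z # a2 # q \<and> a1 \<in> ?A \<and> a2 \<in> ?A \<and> a1 \<noteq> a2"
    if z: "z \<in> set C - ?A" for z
  proof -
    have "z \<in> set ?L" using z C1(2) by auto
    then obtain p q where pq: "?L = p @ z # q" by (meson split_list)
    have zA: "z \<notin> ?A" using z by blast
    have t: "p \<noteq> []" "last p \<in> ?A" "q \<noteq> []" "hd q \<in> ?A"
      by (rule spaced_filter_tight[OF _ tight pq zA], erule nocon)+
    obtain p' a1 where p: "p = p' @ [a1]" using t(1) by (cases p rule: rev_cases) auto
    obtain a2 q' where q: "q = a2 # q'" using t(3) by (cases q) auto
    have L: "?L = p' @ a1 # z # a2 # q'" using pq p q by simp
    have "a1 \<noteq> a2"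
    proof
      assume e: "a1 = a2"
      show False
      proof (cases q' rule: rev_cases)
        case Nil
        then have "a2 = a" "a # w = p' @ [a1, z]" using L by (auto simp flip: append_Cons)
        then have "p' = []" using e dist by (cases p') auto
        then have "length w = 1" using L Nil by simp
        then show False using lw k3 by simp
      next
        case (snoc qs b)
        then have "a # w = p' @ a1 # z # a2 # qs" using L by (auto simp flip: append_Cons append_assoc)
        then show False using e dist by auto
      qed
    qed
    then show ?thesis using L t(2,4) p q by auto
  qed
  have succ: "\<exists>p a1 q. a # w = p @ a1 # z # q \<and> a1 \<in> ?A" if z: "z \<in> set C - ?A" for z
  proof -
    obtain p a1 a2 q where L: "?L = p @ a1 # z # a2 # q" "a1 \<in> ?A" using nbrs[OF z] by blast
    show ?thesis
    proof (cases q rule: rev_cases)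
      case Nil
      then have "a # w = p @ [a1, z]" using L by (auto simp flip: append_Cons)
      then show ?thesis using L by blast
    next
      case (snoc qs b)
      then have "a # w = p @ a1 # z # a2 # qs" using L by (auto simp flip: append_Cons append_assoc)
      then show ?thesis using L by blast
    qed
  qed
  have indep: "\<not> E u v" "y \<in> V - set C \<Longrightarrow> y \<noteq> x \<Longrightarrow> \<not> (E y u \<and> E y v)"
    if u: "u \<in> set C - ?A" and v: "v \<in> set C - ?A" and uv: "u \<noteq> v" for u v y
  proof -
    obtain p1 a1 q1 where 1: "a # w = p1 @ a1 # u # q1" "a1 \<in> ?A" using succ[OF u] by blast
    obtain p2 a2 q2 where 2: "a # w = p2 @ a2 # v # q2" "a2 \<in> ?A" using succ[OF v] by blast
    show "\<not> E u v" "y \<in> V - set C \<Longrightarrow> y \<noteq> x \<Longrightarrow> \<not> (E y u \<and> E y v)"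
      using successors_of_feet[OF C1(1) x1 1(1) _ 2(1) _ uv] 1(2) 2(2) C1(2) by (auto simp: nb_iff)
  qed
  have nbA: "nb y \<subseteq> ?A" if y: "y \<in> V - set C" for y
  proof (rule ccontr)
    assume n: "\<not> ?thesis"
    then have yx: "y \<noteq> x" by blast
    have yC: "nb y \<subseteq> set C" "card (nb y) = k" using single[OF y] feet_sub[of C y] by auto
    obtain z where z: "z \<in> nb y" "z \<in> set C - ?A" using n yC by blast
    obtain p a1 a2 q where L: "?L = (p @ [a1]) @ z # a2 # q" "?L = p @ a1 # z # (a2 # q)" "a1 \<in> ?A" "a2 \<in> ?A" "a1 \<noteq> a2"
      using nbrs[OF z(2)] by auto
    \<comment> \<open>Besides \<open>z\<close> only feet of \<open>x\<close> are possible, and the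
      cycle neighbours \<open>a1\<close>, \<open>a2\<close> of \<open>z\<close> drop out, so at most
      \<open>k - 1\<close> neighbours remain.\<close>
    have "nb y \<subseteq> insert z (?A - {a1, a2})"
    proof
      fix v assume v: "v \<in> nb y"
      show "v \<in> insert z (?A - {a1, a2})"
      proof (cases "v \<in> ?A")
        case True
        then show ?thesis using foll[OF L(1) y] foll[OF L(2) y] z(1) v by (auto simp: nb_iff)
      next
        case False
        then have "v \<in> set C - ?A" using v yC by blast
        then show ?thesis using indep(2)[OF _ z(2), of v y] y yx v z(1) by (auto simp: nb_iff)
      qed
    qed
    then have "card (nb y) \<le> card (insert z (?A - {a1, a2}))"
      using fin_nb[of x] by (intro card_mono) auto
    also have "\<dots> \<le> Suc (card (?A - {a1, a2}))" using fin_nb[of x] by (simp add: card_insert_if)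
    also have "card (?A - {a1, a2}) = k - 2" using L fin_nb[of x] cA by (subst card_Diff_subset) auto
    finally show False using yC k3 by simp
  qed
  have "\<not> E u v" if "u \<in> V - ?A" "v \<in> V - ?A" for u v
  proof
    assume Euv: "E u v"
    have uv: "u \<noteq> v" using Euv irr by auto
    have "u \<in> set C" using nbA[of u] that Euv nb_iff by blast
    moreover have "v \<in> set C" using nbA[of v] that sym[OF Euv] nb_iff by blast
    ultimately show False using indep(1)[of u v] uv that Euv by blast
  qed
  moreover have "?A \<subseteq> V" by (rule nb_V)
  ultimately show ?thesis using cA by blast
qed

text \<open>The vertices \<open>g\<close>, \<open>g'\<close> form the only gap of length two; if \<open>y\<close> were adjacent to \<open>g\<close>, the cycle
  could be rerouted through \<open>x\<close> and \<open>y\<close>, missing only one vertex of \<open>C\<close>.\<close>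
lemma gap_end:
  assumes C: "lcyc (g' # w @ [g])" and k3: "3 \<le> k" and c: "c = 2 * k + 1"
    and x: "x \<in> V - set (g' # w @ [g])" and A: "nb x \<subseteq> set w" "card (nb x) = k"
    and y: "y \<in> V - set (g' # w @ [g])" "y \<noteq> x" "nb y \<subseteq> set (g' # w @ [g])" "card (nb y) = k"
    and only: "\<And>v. v \<in> set w \<Longrightarrow> E y v \<Longrightarrow> E x v"
  shows "\<not> E y g"
proof
  assume yg: "E y g"
  let ?A = "nb x"
  have dist: "distinct (g' # w @ [g])" by (rule lcyc_distinct[OF C])
  have lw: "length w = 2 * k - 1" using lcyc_length[OF C] c by simp
  have nocon: "\<not> (u \<in> ?A \<and> v \<in> ?A)" if "w = pre @ u # v # post" for pre u v post
    using no_consecutive_feet[of "g' # pre" u v "post @ [g]" x] C x that by (auto simp: nb_iff)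
  have tight: "Suc (length w) \<le> 2 * length (filter (\<lambda>z. z \<in> ?A) w)"
    using filter_feet[of w ?A] A dist lw k3 by simp
  have "w \<noteq> []" using lw k3 by auto
  then obtain w1 s where w1: "w = w1 @ [s]" by (cases w rule: rev_cases) auto
  have sA: "s \<in> ?A"
  proof (rule ccontr)
    assume n: "s \<notin> ?A"
    have "([]::'a list) \<noteq> []" by (rule spaced_filter_tight(3)[OF _ tight w1 n], erule nocon)
    then show False by simp
  qed
  have nys: "\<not> E y s"
    using no_consecutive_feet[of "g' # w1" s g "[]" y] C y(1) w1 yg by simp
  have nyg': "\<not> E y g'"
    using no_consecutive_feet[of "[]" g g' w y] lcyc_rot[of "g' # w" "[g]"] C y(1) yg by auto
  \<comment> \<open>The cycle neighbours \<open>s\<close> and \<open>g'\<close> of \<open>g\<close>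
    are excluded, so counting forces \<open>y\<close> to be adjacent to \<open>g\<close> and to
    every foot of \<open>x\<close> except \<open>s\<close>.\<close>
  have sub: "nb y \<subseteq> insert g (?A - {s})"
    using y(3) nys nyg' only by (auto simp: nb_iff)
  have "card (insert g (?A - {s})) \<le> Suc (card (?A - {s}))" using fin_nb[of x] by (simp add: card_insert_if)
  also have "\<dots> = k" using sA A(2) fin_nb[of x] card_Suc_Diff1[of ?A s] by simp
  finally have eq: "nb y = insert g (?A - {s})"
    using sub y(4) fin_nb[of x] by (intro card_seteq) auto
  \<comment> \<open>For \<open>3 \<le> k\<close> the list \<open>w\<close> has at least five
    vertices, so its third vertex \<open>v\<close> differs from the last one
    \<open>s\<close>.\<close>
  obtain s' m v rest where w: "w = s' # m # v # rest" "rest \<noteq> []"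
    using lw k3 by (cases w; cases "tl w"; cases "tl (tl w)"; cases "tl (tl (tl w))") auto
  have s'A: "s' \<in> ?A"
  proof (rule ccontr)
    assume n: "s' \<notin> ?A"
    have w': "w = [] @ s' # m # v # rest" using w by simp
    have "([]::'a list) \<noteq> []" by (rule spaced_filter_tight(1)[OF _ tight w' n], erule nocon)
    then show False by simp
  qed
  have mA: "m \<notin> ?A" using nocon[of "[]" s' m "v # rest"] s'A w by auto
  have w': "w = [s'] @ m # v # rest" using w by simp
  have "hd (v # rest) \<in> ?A" by (rule spaced_filter_tight(4)[OF _ tight w' mA], erule nocon)
  then have vA: "v \<in> ?A" by simp
  have ls: "last rest = s" using w w1 by (metis last_ConsR last_snoc list.distinct(1))
  have "v \<noteq> s" using dist w ls last_in_set[OF w(2)] by auto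
  then have yv: "E y v" using vA eq nb_iff by blast
  have cC: "cyc (g' # w @ [g])" using C by (simp add: lcyc_def)
  have sr: "successively E (v # rest)" "E s' g'" "E g' g"
    using cC w sym[of g' s'] sym[of g g']
    by (auto simp: cyc_def successively_append_iff successively_Cons)
  have "cyc ((y # v # rest) @ [x, s', g', g])"
    unfolding cyc_def
  proof (intro conjI)
    show "distinct ((y # v # rest) @ [x, s', g', g])" using dist w x y(1,2) by auto
    have "successively E (y # v # rest)" using sr yv by (simp add: successively_Cons)
    moreover have "successively E [x, s', g', g]" using sr s'A by (simp add: nb_iff successively_Cons)
    moreover have "E (last (y # v # rest)) x" using ls w(2) sA sym[of x s] by (simp add: nb_iff)
    ultimately show "successively E ((y # v # rest) @ [x, s', g', g])"
      by (simp only: successively_append_iff list.sel) simp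
    show "E (last ((y # v # rest) @ [x, s', g', g])) (hd ((y # v # rest) @ [x, s', g', g]))"
      using sym[OF yg] by simp
  qed simp
  from bound[OF this] show False using lcyc_length[OF C] w by simp
qed

text \<open>A cycle of length \<open>2 * k + 1\<close> with \<open>k\<close> nonconsecutive feet has
  exactly one pair of consecutive vertices that are not feet; elsewhere it alternates. This pair is
  the only possible edge outside \<open>nb x\<close> and becomes the added edge of
  \<open>H_graph\<close>.\<close>

lemma single_feet_odd:
  assumes C: "lcyc C" and k3: "3 \<le> k" and c: "c = 2 * k + 1"
    and single: "\<And>v. v \<in> V - set C \<Longrightarrow> feet C v = nb v \<and> card (nb v) = k"
  shows "\<exists>A g g'. A \<subseteq> V \<and> card A = k \<and> g \<in> V - A \<and> g' \<in> V - A \<and> g \<noteq> g' \<and>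
    (\<forall>u\<in>V - A. \<forall>v\<in>V - A. E u v \<longrightarrow> {u, v} = {g, g'})"
proof -
  obtain x where x: "x \<in> V - set C" by (rule outside_vertex[OF C])
  let ?A = "nb x"
  have cA: "card ?A = k" and AC: "?A \<subseteq> set C" using single[OF x] feet_sub[of C x] by auto
  obtain a where a: "a \<in> ?A" using cA k3 by fastforce
  obtain p q where pq: "C = p @ a # q" using a AC by (meson split_list subsetD)
  define w0 where "w0 = q @ p"
  have C1: "lcyc (a # w0)" "set (a # w0) = set C"
    using lcyc_rot[of p "a # q"] C pq by (auto simp: w0_def)
  have d0: "distinct (a # w0)" by (rule lcyc_distinct[OF C1(1)])
  let ?B = "set C - ?A"
  have "card (set C) = 2 * k + 1" using C lcyc_distinct[OF C] lcyc_length[OF C] c by (simp add: distinct_card)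
  then have cB: "card ?B = k + 1" using cA AC fin_nb[of x] by (simp add: card_Diff_subset)
  \<comment> \<open>The list \<open>w0\<close> has \<open>2 * k\<close> vertices,
    \<open>k + 1\<close> of them not feet, so two of these are consecutive. As the cycle was cut at
    a foot, no such pair is lost at the seam.\<close>
  have "\<exists>pre u v post. w0 = pre @ u # v # post \<and> u \<in> ?B \<and> v \<in> ?B"
  proof (rule ccontr)
    assume "\<not> ?thesis"
    then have "2 * length (filter (\<lambda>z. z \<in> ?B) w0) \<le> Suc (length w0)"
      by (intro spaced_filter) blast
    moreover have "length (filter (\<lambda>z. z \<in> ?B) w0) = k + 1"
    proof -
      have "distinct w0" "?B \<subseteq> set w0" using d0 a C1(2) by auto
      from filter_feet[OF this] show ?thesis using cB by simp
    qed
    ultimately show False using lcyc_length[OF C1(1)] c by simp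
  qed
  then obtain pre g g' post where gg: "w0 = pre @ g # g' # post" "g \<in> ?B" "g' \<in> ?B" by blast
  define w where "w = post @ a # pre"
  let ?C = "g' # w @ [g]"
  have C2: "lcyc ?C" using lcyc_rot[of "a # pre @ [g]" "g' # post"] C1(1) gg(1) by (simp add: w_def)
  have s: "set ?C = set C" using C1(2) gg(1) by (auto simp: w_def)
  have dist: "distinct ?C" by (rule lcyc_distinct[OF C2])
  have gne: "g \<noteq> g'" using dist by auto
  have x2: "x \<in> V - set ?C" using x s by blast
  have Aw: "?A \<subseteq> set w"
  proof
    fix z assume z: "z \<in> ?A"
    then have "z \<in> set ?C" using AC s by blast
    moreover have "z \<noteq> g" "z \<noteq> g'" using z gg by auto
    ultimately show "z \<in> set w" by auto
  qed
  have lw: "length w = 2 * k - 1" using lcyc_length[OF C2] c by simp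
  have nocon: "\<not> (u \<in> ?A \<and> v \<in> ?A)" if "w = pre @ u # v # post" for pre u v post
    using no_consecutive_feet[of "g' # pre" u v "post @ [g]" x] C2 x2 that by (auto simp: nb_iff)
  have tight: "Suc (length w) \<le> 2 * length (filter (\<lambda>z. z \<in> ?A) w)"
    using filter_feet[of w ?A] Aw cA dist lw k3 by simp
  have mid: "\<exists>p a1 a2 q. w = p @ a1 # z # a2 # q \<and> a1 \<in> ?A \<and> a2 \<in> ?A" if z: "z \<in> set w - ?A" for z
  proof -
    obtain p q where pq: "w = p @ z # q" using z by (meson DiffD1 split_list)
    have zA: "z \<notin> ?A" using z by blast
    have t: "p \<noteq> []" "last p \<in> ?A" "q \<noteq> []" "hd q \<in> ?A"
      by (rule spaced_filter_tight[OF _ tight pq zA], erule nocon)+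
    obtain p' a1 where p: "p = p' @ [a1]" using t(1) by (cases p rule: rev_cases) auto
    obtain a2 q' where q: "q = a2 # q'" using t(3) by (cases q) auto
    show ?thesis using t(2,4) pq p q by auto
  qed
  have wne: "w \<noteq> []" by (simp add: w_def)
  have hw: "hd w \<in> ?A"
  proof (rule ccontr)
    assume n: "hd w \<notin> ?A"
    have w': "w = [] @ hd w # tl w" using wne by simp
    have "([]::'a list) \<noteq> []" by (rule spaced_filter_tight(1)[OF _ tight w' n], erule nocon)
    then show False by simp
  qed
  have lastw: "last w \<in> ?A"
  proof (rule ccontr)
    assume n: "last w \<notin> ?A"
    have w': "w = butlast w @ last w # []" using wne by simp
    have "([]::'a list) \<noteq> []" by (rule spaced_filter_tight(3)[OF _ tight w' n], erule nocon)
    then show False by simp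
  qed
  have pred: "\<exists>p a1 q. ?C = p @ a1 # z # q \<and> E x a1" if z: "z \<in> ?B" "z \<noteq> g'" for z
  proof (cases "z = g")
    case True
    have "?C = (g' # butlast w) @ last w # z # []" using wne True by simp
    then show ?thesis using lastw nb_iff by blast
  next
    case False
    then have "z \<in> set w - ?A" using z s by auto
    then obtain p a1 a2 q where "w = p @ a1 # z # a2 # q" "a1 \<in> ?A" using mid by blast
    then have "?C = (g' # p) @ a1 # z # (a2 # q @ [g])" "E x a1" by (auto simp: nb_iff)
    then show ?thesis by blast
  qed
  have succ: "\<exists>p a1 q. ?C = p @ z # a1 # q \<and> E x a1" if z: "z \<in> ?B" "z \<noteq> g" for z
  proof (cases "z = g'")
    case True
    have "?C = [] @ z # hd w # (tl w @ [g])" using wne True by simp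
    then show ?thesis using hw nb_iff by blast
  next
    case False
    then have "z \<in> set w - ?A" using z s by auto
    then obtain p a1 a2 q where "w = p @ a1 # z # a2 # q" "a2 \<in> ?A" using mid by blast
    then have "?C = (g' # p @ [a1]) @ z # a2 # (q @ [g])" "E x a2" by (auto simp: nb_iff)
    then show ?thesis by blast
  qed
  \<comment> \<open>Every such vertex but \<open>g'\<close> follows a foot, and every one but
    \<open>g\<close> precedes a foot. A pair other than \<open>{g, g'}\<close> is therefore covered
    by successors or by predecessors.\<close>
  have indep: "\<not> E u v \<and> (\<forall>y. y \<in> V - set C \<longrightarrow> y \<noteq> x \<longrightarrow> \<not> (E y u \<and> E y v))"
    if u: "u \<in> ?B" and v: "v \<in> ?B" and uv: "u \<noteq> v" "{u, v} \<noteq> {g, g'}" for u v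
  proof (cases "u = g' \<or> v = g'")
    case False
    then obtain p1 a1 q1 p2 a2 q2 where *: "?C = p1 @ a1 # u # q1" "E x a1" "?C = p2 @ a2 # v # q2" "E x a2"
      using pred[OF u] pred[OF v] by blast
    show ?thesis
      using successors_of_feet[OF C2 x2 *(1,2,3,4) uv(1)] s by blast
  next
    case True
    then have "u \<noteq> g" "v \<noteq> g" using uv gne by auto
    then obtain p1 a1 q1 p2 a2 q2 where *: "?C = p1 @ u # a1 # q1" "E x a1" "?C = p2 @ v # a2 # q2" "E x a2"
      using succ[OF u] succ[OF v] by blast
    show ?thesis
      using predecessors_of_feet[OF C2 x2 *(1,2,3,4) uv(1)] s by blast
  qed
  have nbA: "nb y \<subseteq> ?A" if y: "y \<in> V - set C" for y
  proof (cases "y = x")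
    case yx: False
    have yC: "nb y \<subseteq> set C" "card (nb y) = k" using single[OF y] feet_sub[of C y] by auto
    have y2: "y \<in> V - set ?C" "nb y \<subseteq> set ?C" using y yC s by blast+
    have only: "E x z" if z: "z \<in> set w" "E y z" for z
    proof (rule ccontr)
      assume n: "\<not> E x z"
      then have "z \<in> set w - ?A" using z by (simp add: nb_iff)
      then obtain p a1 a2 q where L: "w = p @ a1 # z # a2 # q" "a1 \<in> ?A" "a2 \<in> ?A" using mid by blast
      have zB: "z \<in> ?B" using n z s by (auto simp: nb_iff)
      have ne: "a1 \<noteq> a2" "z \<noteq> g" "z \<noteq> g'" using dist L(1) by auto
      have "\<not> E y a1" using no_consecutive_feet[of "g' # p" a1 z "a2 # q @ [g]" y] C2 y2(1) L(1) z(2) by auto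
      moreover have "\<not> E y a2"
        using no_consecutive_feet[of "g' # p @ [a1]" z a2 "q @ [g]" y] C2 y2(1) L(1) z(2) by auto
      moreover have "v \<in> ?A" if v: "E y v" "v \<noteq> z" for v
      proof (rule ccontr)
        assume "v \<notin> ?A"
        then have "v \<in> ?B" using v yC by (auto simp: nb_iff)
        moreover have "{z, v} \<noteq> {g, g'}" using ne by auto
        ultimately show False using indep[OF zB, of v] v z y yx by blast
      qed
      ultimately have "nb y \<subseteq> insert z (?A - {a1, a2})" by (auto simp: nb_iff)
      then have "card (nb y) \<le> card (insert z (?A - {a1, a2}))"
        using fin_nb[of x] by (intro card_mono) auto
      also have "\<dots> \<le> Suc (card (?A - {a1, a2}))" using fin_nb[of x] by (simp add: card_insert_if)
      also have "card (?A - {a1, a2}) = k - 2" using L ne fin_nb[of x] cA by (subst card_Diff_subset) auto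
      finally show False using yC k3 by simp
    qed
    have 1: "\<not> E y g" by (rule gap_end[OF C2 k3 c x2 Aw cA y2(1) yx y2(2) yC(2) only])
    have C3: "lcyc (g # rev w @ [g'])" using lcyc_rev[OF C2] by simp
    have 2: "\<not> E y g'"
      by (rule gap_end[OF C3 k3 c _ _ cA _ yx _ yC(2) only]) (use x2 Aw y2 in auto)
    show ?thesis
    proof
      fix v assume v: "v \<in> nb y"
      then have "v \<noteq> g" "v \<noteq> g'" using 1 2 by (auto simp: nb_iff)
      then have "v \<in> set w" using y2(2) v by auto
      then show "v \<in> ?A" using only[of v] v by (simp add: nb_iff)
    qed
  qed simp
  have "{u, v} = {g, g'}" if uv: "u \<in> V - ?A" "v \<in> V - ?A" "E u v" for u v
  proof (rule ccontr)
    assume n: "{u, v} \<noteq> {g, g'}"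
    have ne: "u \<noteq> v" using uv(3) irr by auto
    have "u \<in> set C" using nbA[of u] uv nb_iff by blast
    moreover have "v \<in> set C" using nbA[of v] uv sym[OF uv(3)] nb_iff by blast
    ultimately show False using indep[of u v] ne n uv by blast
  qed
  then have "\<forall>u\<in>V - ?A. \<forall>v\<in>V - ?A. E u v \<longrightarrow> {u, v} = {g, g'}" by blast
  moreover have "g \<in> V - ?A" "g' \<in> V - ?A" using gg lcyc_V[OF C] by auto
  ultimately show ?thesis
    by (intro exI[of _ ?A] exI[of _ g] exI[of _ g'] conjI nb_V cA gne)
qed

section \<open>Assembling the cases\<close>

lemma circumference_cases:
  assumes C: "lcyc C"
  shows "c = 2 * k \<or> c = 2 * k + 1"
proof -
  obtain x where "x \<in> V - set C" by (rule outside_vertex[OF C])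
  then show ?thesis using feet_classification(2)[OF C] ck by force
qed

lemma all_single:
  assumes C: "lcyc C" and no2: "\<And>v. v \<in> V - set C \<Longrightarrow> card (feet C v) \<noteq> 2"
    and no3: "\<not> (\<exists>v\<in>V - set C. k = 4 \<and> c = 9 \<and> card (feet C v) = 3 \<and> card (blob C v) = 2)"
  shows "3 \<le> k" "v \<in> V - set C \<Longrightarrow> feet C v = nb v \<and> card (nb v) = k"
proof -
  have *: "feet C v = nb v \<and> card (nb v) = k \<and> 3 \<le> k" if v: "v \<in> V - set C" for v
  proof -
    have f: "card (feet C v) = k" "card (blob C v) = 1"
      using feet_classification(3)[OF C v] no2[OF v] no3 v by blast+
    obtain z where "blob C v = {z}" using f(2) by (rule card_1_singletonE)
    then have b: "blob C v = {v}" using blob_self[of v C] by simp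
    have "nb v = feet C v \<union> (blob C v - {v})" by (rule outside_cycle(3)[OF C v blob_self])
    then have "nb v = feet C v" unfolding b by simp
    then show ?thesis using f(1) no2[OF v] feet_classification(1)[OF C v] by auto
  qed
  obtain x where "x \<in> V - set C" by (rule outside_vertex[OF C])
  then show "3 \<le> k" using * by blast
  show "v \<in> V - set C \<Longrightarrow> feet C v = nb v \<and> card (nb v) = k" using * by blast
qed

theorem even_structure:
  assumes C: "lcyc C" and e: "c = 2 * k"
  shows "(\<exists>A. A \<subseteq> V \<and> card A = k \<and> (\<forall>u\<in>V - A. \<forall>v\<in>V - A. \<not> E u v)) \<or>
    (\<exists>a b. a \<in> V \<and> b \<in> V \<and> a \<noteq> b \<and> (\<forall>v\<in>V - {a, b}. clq {a, b} (k - 1) v))"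
    (is "?R1 \<or> ?R2")
proof (cases "\<exists>v\<in>V - set C. card (feet C v) = 2")
  case True
  then obtain v where v: "v \<in> V - set C" "card (feet C v) = 2" by blast
  have ?R2 by (rule two_feet_even[OF C v e])
  then show ?thesis ..
next
  case False
  then have no2: "\<And>v. v \<in> V - set C \<Longrightarrow> card (feet C v) \<noteq> 2" by blast
  have no3: "\<not> (\<exists>v\<in>V - set C. k = 4 \<and> c = 9 \<and> card (feet C v) = 3 \<and> card (blob C v) = 2)"
  proof -
    have "c \<noteq> 9" using e by presburger
    then show ?thesis by blast
  qed
  have ?R1 by (rule single_feet_even[OF C all_single(1)[OF C no2 no3] e all_single(2)[OF C no2 no3]])
  then show ?thesis ..
qed

theorem odd_structure:
  assumes C: "lcyc C" and o: "c = 2 * k + 1"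
  shows "(\<exists>A g g'. A \<subseteq> V \<and> card A = k \<and> g \<in> V - A \<and> g' \<in> V - A \<and> g \<noteq> g' \<and>
        (\<forall>u\<in>V - A. \<forall>v\<in>V - A. E u v \<longrightarrow> {u, v} = {g, g'})) \<or>
      ((\<exists>a b q. distinct [a, b, q] \<and> {a, b, q} \<subseteq> V \<and> E a q \<and>
          (\<forall>v\<in>V - {a, b, q}. clq {a, b} (k - 1) v \<and> q \<notin> nb v \<or> clq {b, q} (k - 1) v \<and> a \<notin> nb v)) \<or>
        (\<exists>a b S. a \<in> V \<and> b \<in> V \<and> a \<noteq> b \<and> S \<subseteq> V - {a, b} \<and> card S = k \<and>
          (\<forall>v\<in>V - {a, b} - S. clq {a, b} (k - 1) v \<and> nb v \<inter> S = {})) \<or>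
        k = 3 \<and> (\<exists>a b q S. a \<in> V \<and> b \<in> V \<and> a \<noteq> b \<and> q \<in> S \<and> S \<subseteq> V - {a, b} \<and>
          (\<forall>u\<in>S. \<forall>v\<in>S. E u v \<longrightarrow> u = q \<or> v = q) \<and>
          (\<forall>v\<in>V - {a, b} - S. clq {a, b} 2 v \<and> nb v \<inter> S = {}))) \<or>
      k = 4 \<and> (\<exists>A. A \<subseteq> V \<and> card A = 3 \<and> (\<forall>v\<in>V - A. clq A 2 v))"
proof (cases "\<exists>v\<in>V - set C. card (feet C v) = 2")
  case True
  then obtain v where v: "v \<in> V - set C" "card (feet C v) = 2" by blast
  obtain a P b Q where D: "lcyc (a # P @ b # Q)" "v \<in> V - set (a # P @ b # Q)"
    "feet (a # P @ b # Q) v = {a, b}" "length P = k - 1" "length Q = c - k - 1"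
    by (rule two_feet_arcs[OF C v])
  have "length Q = k" using D(5) o by simp
  note D = D(1-4) this
  show ?thesis by (rule disjI2, rule disjI1, rule two_feet_odd_arcs[OF D])
next
  case False
  \<comment> \<open>Vertices with two feet are treated first because \<open>three_feet\<close>
    relies on their absence.\<close>
  then have no2: "\<And>v. v \<in> V - set C \<Longrightarrow> card (feet C v) \<noteq> 2" by blast
  show ?thesis
  proof (cases "\<exists>v\<in>V - set C. k = 4 \<and> c = 9 \<and> card (feet C v) = 3 \<and> card (blob C v) = 2")
    case True
    then obtain v where v: "v \<in> V - set C" "k = 4" "c = 9" "card (feet C v) = 3" "card (blob C v) = 2"
      by blast
    show ?thesis by (rule disjI2, rule disjI2, rule conjI[OF v(2) three_feet[OF C v no2]])
  next
    case no3: False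
    show ?thesis
      by (rule disjI1, rule single_feet_odd[OF C all_single(1)[OF C no2 no3] o all_single(2)[OF C no2 no3]])
  qed
qed

end

section \<open>Embeddings into the extremal graphs\<close>

lemma adj_complete [simp]: "adj (complete_graph m) i j \<longleftrightarrow> i < m \<and> j < m \<and> i \<noteq> j"
  by (auto simp: adj_def complete_graph_def doubleton_eq_iff)

lemma adj_empty [simp]: "\<not> adj (empty_graph m) i j"
  by (auto simp: adj_def empty_graph_def)

lemma adj_star [simp]: "adj (star r) i j \<longleftrightarrow> i = 0 \<and> 1 \<le> j \<and> j \<le> r \<or> j = 0 \<and> 1 \<le> i \<and> i \<le> r"
  by (auto simp: adj_def star_def doubleton_eq_iff)

lemma adj_copies [simp]: "adj (copies a G) p q \<longleftrightarrow> fst p = fst q \<and> fst p < a \<and> adj G (snd p) (snd q)"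
proof
  assume "adj (copies a G) p q"
  then obtain i e where i: "{p, q} = Pair i ` e" "i < a" "e \<in> edges G"
    by (auto simp: adj_def copies_def)
  then have "p \<in> Pair i ` e" "q \<in> Pair i ` e" by blast+
  then have f: "fst p = i" "fst q = i" by auto
  have "snd ` {p, q} = snd ` Pair i ` e" using i(1) by simp
  then have "{snd p, snd q} = e" by (simp add: image_image)
  then show "fst p = fst q \<and> fst p < a \<and> adj G (snd p) (snd q)" using f i by (simp add: adj_def)
next
  assume a: "fst p = fst q \<and> fst p < a \<and> adj G (snd p) (snd q)"
  then have "{p, q} = Pair (fst p) ` {snd p, snd q}" by (cases p; cases q) auto
  moreover have "{snd p, snd q} \<in> edges G" using a by (simp add: adj_def)
  ultimately have "{p, q} \<in> {Pair i ` e |i e. i < a \<and> e \<in> edges G}" using a by blast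
  then show "adj (copies a G) p q" unfolding adj_def copies_def by simp
qed

lemma image_doubleton_iff: "inj f \<Longrightarrow> {f u, f v} \<in> (`) f ` S \<longleftrightarrow> {u, v} \<in> S"
proof -
  assume "inj f"
  then have "f ` {u, v} \<in> (`) f ` S \<longleftrightarrow> {u, v} \<in> S"
    by (auto simp: inj_image_eq_iff simp del: image_insert)
  then show ?thesis by simp
qed

lemma mixed_notin: "{Inl u, Inr v} \<notin> (`) Inl ` S" "{Inl u, Inr v} \<notin> (`) Inr ` T"
  "{Inr v, Inl u} \<notin> (`) Inl ` S" "{Inr v, Inl u} \<notin> (`) Inr ` T"
  "{Inl u, Inl u'} \<notin> (`) Inr ` T" "{Inr v, Inr v'} \<notin> (`) Inl ` S"
  by (auto simp: set_eq_iff image_iff)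

lemma adj_union [simp]:
  "adj (G \<union>\<^sub>g H) (Inl u) (Inl v) \<longleftrightarrow> adj G u v"
  "adj (G \<union>\<^sub>g H) (Inr x) (Inr y) \<longleftrightarrow> adj H x y"
  "\<not> adj (G \<union>\<^sub>g H) (Inl u) (Inr y)" "\<not> adj (G \<union>\<^sub>g H) (Inr y) (Inl u)"
  by (auto simp: adj_def disjoint_union_def image_doubleton_iff mixed_notin)

lemma adj_join [simp]:
  "adj (G +\<^sub>g H) (Inl u) (Inl v) \<longleftrightarrow> adj G u v"
  "adj (G +\<^sub>g H) (Inr x) (Inr y) \<longleftrightarrow> adj H x y"
  "adj (G +\<^sub>g H) (Inl u) (Inr y) \<longleftrightarrow> u \<in> verts G \<and> y \<in> verts H"
  "adj (G +\<^sub>g H) (Inr y) (Inl u) \<longleftrightarrow> u \<in> verts G \<and> y \<in> verts H"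
  by (auto simp: adj_def join_def image_doubleton_iff mixed_notin doubleton_eq_iff)

lemma adj_add_edge [simp]: "adj (add_edge a b G) u v \<longleftrightarrow> adj G u v \<or> {u, v} = {a, b}"
  by (auto simp: adj_def add_edge_def)

lemma adj_remove_edge [simp]: "adj (remove_edge a b G) u v \<longleftrightarrow> adj G u v \<and> {u, v} \<noteq> {a, b}"
  by (auto simp: adj_def remove_edge_def)

lemma verts_simps [simp]:
  "verts (complete_graph m) = {..<m}" "verts (empty_graph m) = {..<m}" "verts (star r) = {..r}"
  "verts (copies a G) = {..<a} \<times> verts G"
  "verts (G \<union>\<^sub>g H) = Inl ` verts G \<union> Inr ` verts H"
  "verts (G +\<^sub>g H) = Inl ` verts G \<union> Inr ` verts H"
  "verts (add_edge x y G) = verts G" "verts (remove_edge x y G) = verts G"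
  by (simp_all add: complete_graph_def empty_graph_def star_def copies_def disjoint_union_def
      join_def add_edge_def remove_edge_def)

text \<open>Stated for a vertex set and a relation, so that parts of one graph can be embedded
  separately with the same \<open>E\<close> and then combined.\<close>

definition embeds :: "'a set \<Rightarrow> ('a \<Rightarrow> 'a \<Rightarrow> bool) \<Rightarrow> 'b ugraph \<Rightarrow> bool" where
  "embeds S E F \<longleftrightarrow> (\<exists>f. inj_on f S \<and> f ` S \<subseteq> verts F \<and> (\<forall>u\<in>S. \<forall>v\<in>S. E u v \<longrightarrow> adj F (f u) (f v)))"

definition matches :: "'a set \<Rightarrow> ('a \<Rightarrow> 'a \<Rightarrow> bool) \<Rightarrow> 'b ugraph \<Rightarrow> bool" where
  "matches S E F \<longleftrightarrow> (\<exists>f. bij_betw f S (verts F) \<and> (\<forall>u\<in>S. \<forall>v\<in>S. E u v \<longleftrightarrow> adj F (f u) (f v)))"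

lemma matches_embeds:
  assumes "matches S E F"
  shows "embeds S E F"
proof -
  obtain f where "bij_betw f S (verts F)" "\<forall>u\<in>S. \<forall>v\<in>S. E u v \<longleftrightarrow> adj F (f u) (f v)"
    using assms unfolding matches_def by (elim exE conjE)
  then show ?thesis unfolding embeds_def bij_betw_def by (intro exI[of _ f]) simp
qed

text \<open>Edges between \<open>A\<close> and \<open>B\<close> are unrestricted because the join
  contains all of them; \<open>embeds_union\<close> forbids them, and \<open>matches_join\<close>
  demands all of them.\<close>

lemma embeds_join:
  assumes "embeds A E F1" "embeds B E F2" "A \<inter> B = {}"
  shows "embeds (A \<union> B) E (F1 +\<^sub>g F2)"
proof -
  obtain f1 where f1: "inj_on f1 A" "f1 ` A \<subseteq> verts F1" "\<forall>u\<in>A. \<forall>v\<in>A. E u v \<longrightarrow> adj F1 (f1 u) (f1 v)"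
    using assms(1) unfolding embeds_def by (elim exE conjE)
  obtain f2 where f2: "inj_on f2 B" "f2 ` B \<subseteq> verts F2" "\<forall>u\<in>B. \<forall>v\<in>B. E u v \<longrightarrow> adj F2 (f2 u) (f2 v)"
    using assms(2) unfolding embeds_def by (elim exE conjE)
  have "v \<notin> A" if "v \<in> B" for v using that assms(3) by blast
  then show ?thesis unfolding embeds_def using f1 f2
    by (intro exI[of _ "\<lambda>v. if v \<in> A then Inl (f1 v) else Inr (f2 v)"]) (auto simp: inj_on_def)
qed

lemma embeds_union:
  assumes "embeds A E F1" "embeds B E F2" "A \<inter> B = {}"
    and "\<And>u v. u \<in> A \<Longrightarrow> v \<in> B \<Longrightarrow> \<not> E u v \<and> \<not> E v u"
  shows "embeds (A \<union> B) E (F1 \<union>\<^sub>g F2)"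
proof -
  obtain f1 where f1: "inj_on f1 A" "f1 ` A \<subseteq> verts F1" "\<forall>u\<in>A. \<forall>v\<in>A. E u v \<longrightarrow> adj F1 (f1 u) (f1 v)"
    using assms(1) unfolding embeds_def by (elim exE conjE)
  obtain f2 where f2: "inj_on f2 B" "f2 ` B \<subseteq> verts F2" "\<forall>u\<in>B. \<forall>v\<in>B. E u v \<longrightarrow> adj F2 (f2 u) (f2 v)"
    using assms(2) unfolding embeds_def by (elim exE conjE)
  have "v \<notin> A" if "v \<in> B" for v using that assms(3) by blast
  then show ?thesis unfolding embeds_def using f1 f2 assms(4)
    by (intro exI[of _ "\<lambda>v. if v \<in> A then Inl (f1 v) else Inr (f2 v)"]) (auto simp: inj_on_def)
qed

lemma matches_join:
  assumes "matches A E F1" "matches B E F2" "A \<inter> B = {}"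
    and "\<And>u v. u \<in> A \<Longrightarrow> v \<in> B \<Longrightarrow> E u v \<and> E v u"
  shows "matches (A \<union> B) E (F1 +\<^sub>g F2)"
proof -
  obtain f1 where f1: "inj_on f1 A" "f1 ` A = verts F1" "\<forall>u\<in>A. \<forall>v\<in>A. E u v \<longleftrightarrow> adj F1 (f1 u) (f1 v)"
    using assms(1) by (auto simp: matches_def bij_betw_def)
  obtain f2 where f2: "inj_on f2 B" "f2 ` B = verts F2" "\<forall>u\<in>B. \<forall>v\<in>B. E u v \<longleftrightarrow> adj F2 (f2 u) (f2 v)"
    using assms(2) by (auto simp: matches_def bij_betw_def)
  let ?f = "\<lambda>v. if v \<in> A then Inl (f1 v) else Inr (f2 v)"
  have dis: "v \<notin> A" if "v \<in> B" for v using that assms(3) by blast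
  have i: "inj_on ?f (A \<union> B)" using f1(1) f2(1) dis by (auto simp: inj_on_def)
  have "?f ` A = Inl ` verts F1" using f1(2) by auto
  moreover have "?f ` B = Inr ` verts F2" using f2(2) dis by force
  ultimately have "?f ` (A \<union> B) = verts (F1 +\<^sub>g F2)" by (simp only: image_Un verts_simps)
  moreover have "E u v \<longleftrightarrow> adj (F1 +\<^sub>g F2) (?f u) (?f v)" if "u \<in> A \<union> B" "v \<in> A \<union> B" for u v
    using that f1(2,3) f2(2,3) dis assms(4) by (cases "u \<in> A"; cases "v \<in> A") auto
  ultimately show ?thesis unfolding matches_def bij_betw_def using i by blast
qed

lemma embeds_complete:
  assumes "finite S" "card S = m" "\<And>u. \<not> E u u"
  shows "embeds S E (complete_graph m)"
proof -
  obtain f where f: "bij_betw f S {0..<m}" using ex_bij_betw_finite_nat[OF assms(1)] assms(2) by auto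
  then have "inj_on f S" "f ` S = {0..<m}" by (auto simp: bij_betw_def)
  then show ?thesis unfolding embeds_def using assms(3)
    by (intro exI[of _ f]) (auto simp: inj_on_eq_iff)
qed

lemma matches_complete:
  assumes "finite S" "card S = m" "\<And>u. \<not> E u u" "\<And>u v. u \<in> S \<Longrightarrow> v \<in> S \<Longrightarrow> u \<noteq> v \<Longrightarrow> E u v"
  shows "matches S E (complete_graph m)"
proof -
  obtain f where f: "bij_betw f S {0..<m}" using ex_bij_betw_finite_nat[OF assms(1)] assms(2) by auto
  then have "inj_on f S" "f ` S = {0..<m}" by (auto simp: bij_betw_def)
  then show ?thesis unfolding matches_def using assms(3,4) f
    by (intro exI[of _ f]) (auto simp: inj_on_eq_iff atLeast0LessThan)
qed

lemma matches_empty: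
  assumes "finite S" "card S = m" "\<And>u v. u \<in> S \<Longrightarrow> v \<in> S \<Longrightarrow> \<not> E u v"
  shows "matches S E (empty_graph m)"
proof -
  obtain f where f: "bij_betw f S {0..<m}" using ex_bij_betw_finite_nat[OF assms(1)] assms(2) by auto
  then show ?thesis unfolding matches_def using assms(3)
    by (intro exI[of _ f]) (auto simp: atLeast0LessThan)
qed

lemma embeds_star:
  assumes S: "finite S" "card S = Suc r" "q \<in> S" and E: "\<And>u. \<not> E u u"
    "\<And>u v. u \<in> S \<Longrightarrow> v \<in> S \<Longrightarrow> E u v \<Longrightarrow> u = q \<or> v = q"
  shows "embeds S E (star r)"
proof -
  have "card (S - {q}) = r" using S by simp
  then obtain h where h: "bij_betw h (S - {q}) {0..<r}" using ex_bij_betw_finite_nat[of "S - {q}"] S(1) by auto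
  let ?f = "\<lambda>v. if v = q then 0 else Suc (h v)"
  have "inj_on h (S - {q})" "\<And>v. v \<in> S - {q} \<Longrightarrow> h v < r" using h by (auto simp: bij_betw_def)
  then have "inj_on ?f S" "\<And>v. v \<in> S \<Longrightarrow> v \<noteq> q \<Longrightarrow> Suc (h v) \<le> r" by (auto simp: inj_on_def Suc_le_eq)
  then show ?thesis unfolding embeds_def using E
    by (intro exI[of _ ?f]) auto
qed

text \<open>The blocks \<open>insert v (nb v \<inter> S)\<close> partition \<open>S\<close>; the first coordinate numbers the blocks and
  the second one the elements within a block.\<close>
lemma clique_coordinates:
  assumes fin: "finite S" and irr: "\<And>u. \<not> E u u"
    and blocks: "\<And>v. v \<in> S \<Longrightarrow> \<exists>K. v \<in> K \<and> card K = m \<and> K \<subseteq> S \<and> (\<forall>w\<in>K. {u \<in> S. E w u} = K - {w})"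
  shows "\<exists>a. card S = a * m \<and> matches S E (copies a (complete_graph m))"
proof -
  define B where "B v = insert v {u \<in> S. E v u}" for v
  have B: "v \<in> B v" "card (B v) = m" "B v \<subseteq> S" "\<And>w. w \<in> B v \<Longrightarrow> B w = B v" if v: "v \<in> S" for v
  proof -
    obtain K where K: "v \<in> K" "card K = m" "K \<subseteq> S" "\<forall>w\<in>K. {u \<in> S. E w u} = K - {w}"
      using blocks[OF v] by blast
    have "B w = K" if "w \<in> K" for w using K(4) that by (auto simp: B_def)
    then show "v \<in> B v" "card (B v) = m" "B v \<subseteq> S" "\<And>w. w \<in> B v \<Longrightarrow> B w = B v" using K by auto
  qed
  have E_iff: "E u v \<longleftrightarrow> u \<noteq> v \<and> B u = B v" if "u \<in> S" "v \<in> S" for u v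
  proof
    assume "E u v"
    then have "v \<in> B u" using that by (simp add: B_def)
    then show "u \<noteq> v \<and> B u = B v" using B(4)[OF that(1)] \<open>E u v\<close> irr by auto
  next
    assume a: "u \<noteq> v \<and> B u = B v"
    then have "v \<in> B u" using B(1)[OF that(2)] by simp
    then show "E u v" using a by (auto simp: B_def)
  qed
  have finP: "finite (B ` S)" using fin by simp
  define a where "a = card (B ` S)"
  obtain g where g: "bij_betw g (B ` S) {0..<a}" using ex_bij_betw_finite_nat[OF finP] a_def by blast
  have "\<exists>h. bij_betw h K {0..<m}" if "K \<in> B ` S" for K
  proof -
    have "finite K" "card K = m" using that B(2,3) fin finite_subset by blast+
    then show ?thesis using ex_bij_betw_finite_nat[of K] by simp
  qed
  then obtain h where h: "\<And>K. K \<in> B ` S \<Longrightarrow> bij_betw (h K) K {0..<m}" by metis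
  define f where "f v = (g (B v), h (B v) v)" for v
  have ginj: "g (B u) = g (B v) \<longleftrightarrow> B u = B v" if "u \<in> S" "v \<in> S" for u v
    using g that unfolding bij_betw_def by (auto simp: inj_on_eq_iff)
  have inj: "inj_on f S"
  proof (rule inj_onI)
    fix u v assume uv: "u \<in> S" "v \<in> S" "f u = f v"
    then have e: "B u = B v" "h (B u) u = h (B u) v" using ginj by (auto simp: f_def)
    have "u \<in> B u" "v \<in> B u" using B(1) uv e(1) by auto
    then show "u = v" using h[of "B u"] uv(1) e(2) by (auto simp: bij_betw_def inj_on_def)
  qed
  have img: "f ` S = {..<a} \<times> {..<m}"
  proof
    show "f ` S \<subseteq> {..<a} \<times> {..<m}"
    proof
      fix p assume "p \<in> f ` S"
      then obtain v where v: "v \<in> S" "p = f v" by blast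
      have "g (B v) \<in> {0..<a}" using g v(1) by (auto simp: bij_betw_def)
      moreover have "h (B v) v \<in> {0..<m}" using h[of "B v"] v(1) B(1)[OF v(1)] by (auto simp: bij_betw_def)
      ultimately show "p \<in> {..<a} \<times> {..<m}" using v by (simp add: f_def)
    qed
    show "{..<a} \<times> {..<m} \<subseteq> f ` S"
    proof
      fix p assume "p \<in> {..<a} \<times> {..<m}"
      then obtain i j where p: "p = (i, j)" "i \<in> {0..<a}" "j \<in> {0..<m}" by auto
      have "i \<in> g ` B ` S" using p(2) g by (simp add: bij_betw_def)
      then obtain v where v: "v \<in> S" "g (B v) = i" by blast
      have "j \<in> h (B v) ` B v" using h[of "B v"] v(1) p(3) by (simp add: bij_betw_def)
      then obtain w where w: "w \<in> B v" "h (B v) w = j" by blast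
      have "w \<in> S" "B w = B v" using B(3,4)[OF v(1)] w(1) by auto
      then have "p = f w" "w \<in> S" using p v w by (simp_all add: f_def)
      then show "p \<in> f ` S" by blast
    qed
  qed
  have bij: "bij_betw f S ({..<a} \<times> {..<m})" using inj img by (simp add: bij_betw_def)
  have "card S = a * m" using bij_betw_same_card[OF bij] by simp
  moreover have "E u v \<longleftrightarrow> adj (copies a (complete_graph m)) (f u) (f v)" if uv: "u \<in> S" "v \<in> S" for u v
  proof -
    have "f u \<in> {..<a} \<times> {..<m}" "f v \<in> {..<a} \<times> {..<m}" using img uv by blast+
    then have r: "fst (f u) < a" "snd (f u) < m" "snd (f v) < m" by auto
    have 1: "fst (f u) = fst (f v) \<longleftrightarrow> B u = B v" using ginj[OF uv] by (simp add: f_def)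
    have 2: "fst (f u) = fst (f v) \<and> snd (f u) = snd (f v) \<longleftrightarrow> u = v"
      using inj_on_eq_iff[OF inj uv] by (simp add: prod_eq_iff)
    have "adj (copies a (complete_graph m)) (f u) (f v) \<longleftrightarrow>
        fst (f u) = fst (f v) \<and> snd (f u) \<noteq> snd (f v)"
      using r by simp
    then show ?thesis using E_iff[OF uv] 1 2 by blast
  qed
  ultimately show ?thesis using bij unfolding matches_def
    by (intro exI[of _ a] conjI exI[of _ f] ballI) auto
qed

context dirac_graph
begin

lemma clique_blocks:
  assumes S: "S \<subseteq> V" "S \<inter> A = {}" and cl: "\<And>v. v \<in> S \<Longrightarrow> \<exists>K. v \<in> K \<and> card K = m \<and> K \<subseteq> S \<and> (\<forall>w\<in>K. nb w = A \<union> (K - {w}))"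
  shows "\<exists>a. card S = a * m \<and> matches S E (copies a (complete_graph m))"
proof (rule clique_coordinates[OF _ irr])
  show "finite S" using S(1) finV finite_subset by blast
  fix v assume v: "v \<in> S"
  obtain K where K: "v \<in> K" "card K = m" "K \<subseteq> S" "\<forall>w\<in>K. nb w = A \<union> (K - {w})"
    using cl[OF v] by (elim exE conjE)
  have "{u \<in> S. E w u} = K - {w}" if w: "w \<in> K" for w
  proof -
    have "{u \<in> S. E w u} = S \<inter> nb w" by (auto simp: nb_def)
    also have "nb w = A \<union> (K - {w})" using K(4) w by (rule bspec)
    finally show ?thesis using K(3) S(2) by auto
  qed
  then show "\<exists>K. v \<in> K \<and> card K = m \<and> K \<subseteq> S \<and> (\<forall>w\<in>K. {u \<in> S. E w u} = K - {w})"
    using K(1-3) by (intro exI[of _ K]) simp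
qed

end

lemma embeds_cong:
  assumes "embeds S E F" "verts F = verts F'" "\<And>p q. adj F p q \<Longrightarrow> adj F' p q"
  shows "embeds S E F'"
  using assms(1) unfolding embeds_def
  by (elim exE, intro exI) (auto simp: assms(2)[symmetric] intro: assms(3))

lemma embeds_single_edge:
  assumes "finite S" "card S = m" "g \<in> S" "g' \<in> S" "g \<noteq> g'"
    and "\<And>u v. u \<in> S \<Longrightarrow> v \<in> S \<Longrightarrow> E u v \<Longrightarrow> {u, v} = {g, g'}"
  shows "embeds S E (add_edge 0 1 (empty_graph m))"
proof -
  have c: "card (S - {g, g'}) = m - 2" using assms(1-5) by (simp add: card_Diff_subset)
  have "2 \<le> m" using card_mono[of S "{g, g'}"] assms(1-5) by simp
  obtain h where h: "bij_betw h (S - {g, g'}) {0..<m - 2}"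
    using ex_bij_betw_finite_nat[of "S - {g, g'}"] assms(1) c by auto
  \<comment> \<open>The shift by 2 keeps the other vertices clear of \<open>0\<close> and
    \<open>1\<close>, the ends of the edge.\<close>
  let ?f = "\<lambda>v. if v = g then 0 else if v = g' then 1 else h v + 2"
  have hi: "inj_on h (S - {g, g'})" and hl: "\<And>v. v \<in> S - {g, g'} \<Longrightarrow> h v < m - 2"
    using h by (auto simp: bij_betw_def)
  have "inj_on ?f S"
  proof (rule inj_onI)
    fix u v assume "u \<in> S" "v \<in> S" "?f u = ?f v"
    then show "u = v" using inj_onD[OF hi, of u v] by (simp split: if_splits)
  qed
  moreover have "?f v \<in> verts (add_edge 0 1 (empty_graph m))" if "v \<in> S" for v
    using hl[of v] that \<open>2 \<le> m\<close> by (auto simp: less_diff_conv)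
  then have "?f ` S \<subseteq> verts (add_edge 0 1 (empty_graph m))" by (rule image_subsetI)
  moreover have "adj (add_edge 0 1 (empty_graph m)) (?f u) (?f v)" if uv: "u \<in> S" "v \<in> S" "E u v" for u v
    using assms(6)[OF uv] assms(5) by (auto simp: doubleton_eq_iff)
  ultimately show ?thesis unfolding embeds_def by (intro exI[of _ ?f]) blast
qed

section \<open>Recognising the extremal graphs\<close>

context short_circumference
begin

text \<open>The clique of a vertex without neighbours in \<open>Q\<close> avoids \<open>Q\<close>,
  so the cliques partition the rest.\<close>

lemma rest_blocks:
  assumes "\<forall>v\<in>V - A - Q. clq A m v \<and> nb v \<inter> Q = {}"
  shows "\<exists>a. card (V - A - Q) = a * m \<and> matches (V - A - Q) E (copies a (complete_graph m))"
proof (rule clique_blocks)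
  fix v assume v: "v \<in> V - A - Q"
  have cl: "clq A m v" "nb v \<inter> Q = {}" using assms v by blast+
  obtain K where K: "v \<in> K" "card K = m" "K \<subseteq> V - A" "\<forall>w\<in>K. nb w = A \<union> (K - {w})"
    using cl(1) unfolding clq_def by (elim exE conjE)
  have nv: "nb v = A \<union> (K - {v})" using K(4,1) by (rule bspec)
  have "w \<notin> Q" if "w \<in> K" for w
  proof (cases "w = v")
    case False
    then have "w \<in> nb v" using nv that by blast
    then show ?thesis using cl(2) by blast
  qed (use v in blast)
  then have "K \<subseteq> V - A - Q" using K(3) by blast
  then show "\<exists>K. v \<in> K \<and> card K = m \<and> K \<subseteq> V - A - Q \<and> (\<forall>w\<in>K. nb w = A \<union> (K - {w}))"
    using K(1,2,4) by blast
qed auto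

lemma clq_adj: "clq A m v \<Longrightarrow> u \<in> A \<Longrightarrow> E v u"
  unfolding clq_def nb_def by blast

lemma no_edges: "nb v \<inter> Q = {} \<Longrightarrow> u \<in> Q \<Longrightarrow> \<not> E u v \<and> \<not> E v u"
  using sym[of u v] unfolding nb_def by blast

lemma fin_sub: "S \<subseteq> V \<Longrightarrow> finite S" using finV finite_subset by blast

lemma embeds_H_even:
  assumes "A \<subseteq> V" "card A = k" "\<forall>u\<in>V - A. \<forall>v\<in>V - A. \<not> E u v"
  shows "embeds V E (H_graph (card V) (2 * k))"
proof -
  have "embeds (A \<union> (V - A)) E (complete_graph k +\<^sub>g empty_graph (card V - k))"
  proof (rule embeds_join)
    show "embeds A E (complete_graph k)" by (rule embeds_complete[OF fin_sub[OF assms(1)] assms(2) irr])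
    show "embeds (V - A) E (empty_graph (card V - k))"
      by (rule matches_embeds[OF matches_empty])
        (use assms finV card_Diff_subset[OF fin_sub[OF assms(1)] assms(1)] in auto)
  qed blast
  moreover have "A \<union> (V - A) = V" using assms(1) by blast
  ultimately show ?thesis by (simp add: H_graph_def)
qed

lemma embeds_H_odd:
  assumes "A \<subseteq> V" "card A = k" "g \<in> V - A" "g' \<in> V - A" "g \<noteq> g'"
    "\<forall>u\<in>V - A. \<forall>v\<in>V - A. E u v \<longrightarrow> {u, v} = {g, g'}"
  shows "embeds V E (H_graph (card V) (2 * k + 1))"
proof -
  let ?I = "empty_graph (card V - k)"
  \<comment> \<open>The extra edge is first placed in the second factor, where
    \<open>embeds_join\<close> applies, and then moved to the join.\<close>
  have "embeds (A \<union> (V - A)) E (complete_graph k +\<^sub>g add_edge 0 1 ?I)"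
  proof (rule embeds_join)
    show "embeds A E (complete_graph k)" by (rule embeds_complete[OF fin_sub[OF assms(1)] assms(2) irr])
    show "embeds (V - A) E (add_edge 0 1 ?I)"
      by (rule embeds_single_edge[OF _ _ assms(3-5)])
        (use assms finV card_Diff_subset[OF fin_sub[OF assms(1)] assms(1)] in auto)
  qed blast
  then have "embeds (A \<union> (V - A)) E (add_edge (Inr 0) (Inr 1) (complete_graph k +\<^sub>g ?I))"
  proof (rule embeds_cong)
    fix p q :: "nat + nat"
    assume "adj (complete_graph k +\<^sub>g add_edge 0 1 ?I) p q"
    then show "adj (add_edge (Inr 0) (Inr 1) (complete_graph k +\<^sub>g ?I)) p q"
      by (cases p; cases q) (auto simp: doubleton_eq_iff)
  qed simp
  moreover have "A \<union> (V - A) = V" using assms(1) by blast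
  ultimately show ?thesis by (simp add: H_graph_def)
qed

lemma card_three_parts:
  assumes "A \<subseteq> V" "Q \<subseteq> V - A"
  shows "card V = card A + card Q + card (V - A - Q)"
proof -
  have "card V = card A + card (V - A)"
    using card_Diff_subset[OF fin_sub[OF assms(1)] assms(1)] card_mono[OF finV assms(1)] by simp
  moreover have "finite Q" using assms(2) fin_sub by blast
  then have "card (V - A) = card Q + card (V - A - Q)"
    using card_Diff_subset[OF _ assms(2)] card_mono[OF _ assms(2)] finV by simp
  ultimately show ?thesis by simp
qed

lemma embeds_join_rest:
  assumes A: "A \<subseteq> V" "card A = s" and Q: "Q \<subseteq> V - A" and FQ: "embeds Q E FQ"
    and cl: "\<forall>v\<in>V - A - Q. clq A m v \<and> nb v \<inter> Q = {}"
  shows "\<exists>a. card V = s + card Q + a * m \<and>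
    embeds V E (complete_graph s +\<^sub>g (FQ \<union>\<^sub>g copies a (complete_graph m)))"
proof -
  obtain a where a: "card (V - A - Q) = a * m" "matches (V - A - Q) E (copies a (complete_graph m))"
    using rest_blocks[OF cl] by (elim exE conjE)
  have r: "embeds (Q \<union> (V - A - Q)) E (FQ \<union>\<^sub>g copies a (complete_graph m))"
  proof (rule embeds_union[OF FQ matches_embeds[OF a(2)]])
    fix u v assume "u \<in> Q" "v \<in> V - A - Q"
    then show "\<not> E u v \<and> \<not> E v u" using no_edges cl by blast
  qed blast
  have "embeds (A \<union> (Q \<union> (V - A - Q))) E
      (complete_graph s +\<^sub>g (FQ \<union>\<^sub>g copies a (complete_graph m)))"
    by (rule embeds_join[OF embeds_complete[OF fin_sub[OF A(1)] A(2) irr] r]) (use Q in blast)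
  moreover have "A \<union> (Q \<union> (V - A - Q)) = V" using A Q by blast
  ultimately show ?thesis using a(1) card_three_parts[OF A(1) Q] A(2) by auto
qed

lemma embeds_join_copies:
  assumes A: "A \<subseteq> V" "card A = s" and cl: "\<forall>v\<in>V - A. clq A m v"
  shows "\<exists>a. card V = s + a * m \<and> embeds V E (complete_graph s +\<^sub>g copies a (complete_graph m))"
proof -
  have "\<forall>v\<in>V - A - {}. clq A m v \<and> nb v \<inter> {} = {}" using cl by simp
  from rest_blocks[OF this]
  obtain a where a: "card (V - A - {}) = a * m" "matches (V - A - {}) E (copies a (complete_graph m))"
    by (elim exE conjE)
  have "embeds (A \<union> (V - A)) E (complete_graph s +\<^sub>g copies a (complete_graph m))"
    by (rule embeds_join[OF embeds_complete[OF fin_sub[OF A(1)] A(2) irr]])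
      (use matches_embeds[OF a(2)] in auto)
  moreover have "A \<union> (V - A) = V" using A by blast
  moreover have "card V = card A + card ({} :: 'a set) + card (V - A - {})"
    by (rule card_three_parts[OF A(1)]) simp
  ultimately show ?thesis unfolding a(1) A(2) by auto
qed

text \<open>Whether \<open>a\<close> and \<open>b\<close> are adjacent is undetermined and selects
  one of the two members of the class. The bound on \<open>card V\<close> makes the number of
  cliques positive.\<close>

lemma matches_H2:
  assumes ab: "a \<in> V" "b \<in> V" "a \<noteq> b" and cl: "\<forall>v\<in>V - {a, b}. clq {a, b} (k - 1) v" and V: "3 \<le> card V"
  shows "\<exists>F\<in>H2_class (card V) k. matches V E F"
proof -
  let ?S = "V - {a, b}"
  have "\<forall>v\<in>?S - {}. clq {a, b} (k - 1) v \<and> nb v \<inter> {} = {}" using cl by simp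
  from rest_blocks[OF this]
  obtain r where r: "card (?S - {}) = r * (k - 1)" "matches (?S - {}) E (copies r (complete_graph (k - 1)))"
    by (elim exE conjE)
  have "card V = card {a, b} + card ({} :: 'a set) + card (?S - {})"
    by (rule card_three_parts) (use ab(1,2) in auto)
  moreover have "card {a, b} = 2" using ab(3) by simp
  ultimately have n: "card V = r * (k - 1) + 2" unfolding r(1) by simp
  have r0: "0 < r"
  proof (rule ccontr)
    assume "\<not> 0 < r"
    then show False using n V by simp
  qed
  have EA: "E u v \<and> E v u" if "u \<in> {a, b}" "v \<in> ?S" for u v
    using clq_adj[of "{a, b}" "k - 1" v u] cl that sym by blast
  have un: "{a, b} \<union> ?S = V" using ab by blast
  show ?thesis
  proof (cases "E a b")
    case True
    have "matches {a, b} E (complete_graph 2)"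
      by (rule matches_complete) (use ab(3) irr True sym[OF True] in auto)
    then have "matches ({a, b} \<union> ?S) E (complete_graph 2 +\<^sub>g copies r (complete_graph (k - 1)))"
      using r(2) EA by (intro matches_join) auto
    then show ?thesis using un n r0 unfolding H2_class_def by auto
  next
    case False
    have "matches {a, b} E (empty_graph 2)"
      by (rule matches_empty) (use ab(3) irr False sym[of b a] in auto)
    then have "matches ({a, b} \<union> ?S) E (empty_graph 2 +\<^sub>g copies r (complete_graph (k - 1)))"
      using r(2) EA by (intro matches_join) auto
    then show ?thesis using un n r0 unfolding H2_class_def by auto
  qed
qed

text \<open>Separates the cliques on \<open>{a, b}\<close> from those on \<open>{b, q}\<close>:
  since \<open>q\<close> is not adjacent to \<open>v\<close>, the whole clique of \<open>v\<close>
  avoids \<open>q\<close> and stays in \<open>S\<close>.\<close>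

lemma private_blocks:
  assumes S: "S = {v \<in> V - insert q A. clq A m v \<and> q \<notin> nb v}"
  shows "\<exists>r. card S = r * m \<and> matches S E (copies r (complete_graph m))"
    and "v \<in> S \<Longrightarrow> A \<subseteq> nb v \<and> nb v \<subseteq> A \<union> S"
proof -
  have K: "\<exists>K. v \<in> K \<and> card K = m \<and> K \<subseteq> S \<and> (\<forall>w\<in>K. nb w = A \<union> (K - {w}))" if v: "v \<in> S" for v
  proof -
    have v': "clq A m v" "q \<notin> nb v" "v \<noteq> q" using v by (auto simp: S)
    obtain K where K: "v \<in> K" "card K = m" "K \<subseteq> V - A" "\<forall>w\<in>K. nb w = A \<union> (K - {w})"
      using v'(1) unfolding clq_def by (elim exE conjE)
    have nv: "nb v = A \<union> (K - {v})" using K(4,1) by (rule bspec)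
    then have q: "q \<notin> K" "q \<notin> A" using v'(2,3) by blast+
    have "w \<in> S" if w: "w \<in> K" for w
    proof -
      have "clq A m w" unfolding clq_def using K w by blast
      moreover have "nb w = A \<union> (K - {w})" using K(4) w by (rule bspec)
      ultimately show ?thesis using w q K(3) unfolding S by auto
    qed
    then show ?thesis using K by blast
  qed
  show "\<exists>r. card S = r * m \<and> matches S E (copies r (complete_graph m))"
    by (rule clique_blocks[OF _ _ K]) (auto simp: S)
  show "A \<subseteq> nb v \<and> nb v \<subseteq> A \<union> S" if v: "v \<in> S"
  proof -
    obtain K where "v \<in> K" "K \<subseteq> S" "\<forall>w\<in>K. nb w = A \<union> (K - {w})" using K[OF v] by (elim exE conjE)
    then show ?thesis using bspec[of K "\<lambda>w. nb w = A \<union> (K - {w})" v] by blast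
  qed
qed

text \<open>\<open>b\<close> plays the role of \<open>u0\<close>, and \<open>a\<close>,
  \<open>q\<close> those of \<open>u1\<close>, \<open>u2\<close>. The edges from \<open>b\<close> to
  \<open>a\<close> and to \<open>q\<close> are undetermined, which accounts for the four graphs of
  the class.\<close>

lemma matches_H1:
  assumes d: "distinct [a, b, q]" and V3: "{a, b, q} \<subseteq> V" and Eaq: "E a q"
    and cl: "\<forall>v\<in>V - {a, b, q}. clq {a, b} (k - 1) v \<and> q \<notin> nb v \<or> clq {b, q} (k - 1) v \<and> a \<notin> nb v"
    and V: "4 \<le> card V"
  shows "\<exists>F\<in>H1_class (card V) k. matches V E F"
proof -
  define S1 where "S1 = {v \<in> V - insert q {a, b}. clq {a, b} (k - 1) v \<and> q \<notin> nb v}"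
  define S2 where "S2 = {v \<in> V - insert a {b, q}. clq {b, q} (k - 1) v \<and> a \<notin> nb v}"
  note S1 = private_blocks[OF S1_def] and S2 = private_blocks[OF S2_def]
  obtain b1 where b1: "card S1 = b1 * (k - 1)" "matches S1 E (copies b1 (complete_graph (k - 1)))"
    using S1(1) by (elim exE conjE)
  obtain b2 where b2: "card S2 = b2 * (k - 1)" "matches S2 E (copies b2 (complete_graph (k - 1)))"
    using S2(1) by (elim exE conjE)
  obtain f1 where f1: "inj_on f1 S1" "f1 ` S1 = {..<b1} \<times> {..<k - 1}"
    "\<forall>u\<in>S1. \<forall>v\<in>S1. E u v \<longleftrightarrow> adj (copies b1 (complete_graph (k - 1))) (f1 u) (f1 v)"
    using b1(2) unfolding matches_def bij_betw_def by auto
  obtain f2 where f2: "inj_on f2 S2" "f2 ` S2 = {..<b2} \<times> {..<k - 1}"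
    "\<forall>u\<in>S2. \<forall>v\<in>S2. E u v \<longleftrightarrow> adj (copies b2 (complete_graph (k - 1))) (f2 u) (f2 v)"
    using b2(2) unfolding matches_def bij_betw_def by auto
  have out: "a \<notin> S1" "b \<notin> S1" "q \<notin> S1" "a \<notin> S2" "b \<notin> S2" "q \<notin> S2"
    and SV: "S1 \<subseteq> V" "S2 \<subseteq> V" and qS1: "\<And>v. v \<in> S1 \<Longrightarrow> q \<notin> nb v" and aS2: "\<And>v. v \<in> S2 \<Longrightarrow> a \<notin> nb v"
    by (auto simp: S1_def S2_def)
  have "S1 \<inter> S2 = {}" using qS1 S2(2) by blast
  note dis = out this
  have cov: "V = {a, b, q} \<union> S1 \<union> S2" using V3 cl by (auto simp: S1_def S2_def)
  have E1: "E v a \<and> E v b \<and> \<not> E v q \<and> (\<forall>u\<in>S2. \<not> E v u)" if v: "v \<in> S1" for v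
  proof -
    have "a \<in> nb v" "b \<in> nb v" "q \<notin> nb v" "\<forall>u\<in>S2. u \<notin> nb v" using S1(2)[OF v] qS1[OF v] dis by blast+
    then show ?thesis by (simp add: nb_def)
  qed
  have E2: "\<not> E v a \<and> E v b \<and> E v q" if v: "v \<in> S2" for v
    using S2(2)[OF v] aS2[OF v] unfolding nb_def by blast
  have Esym: "E u v \<longleftrightarrow> E v u" for u v using sym by blast
  define f :: "'a \<Rightarrow> h1_vertex" where "f v = (if v = b then u0 else if v = a then u1 else if v = q then u2
    else if v \<in> S1 then Inl (Inl (Inl (f1 v))) else Inl (Inr (Inl (f2 v))))" for v
  have fv: "f b = u0" "f a = u1" "f q = u2" using d by (auto simp: f_def)
  have fS1: "f v = Inl (Inl (Inl (f1 v)))" if "v \<in> S1" for v using that dis by (auto simp: f_def)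
  have fS2: "f v = Inl (Inr (Inl (f2 v)))" if "v \<in> S2" for v using that dis by (auto simp: f_def)
  let ?H = "H1_base k b1 b2"
  define F where "F = (if E b a then id else remove_edge u0 u1)
    ((if E b q then id else remove_edge u0 u2) ?H)"
  have vF: "verts F = verts ?H" by (simp add: F_def)
  have aF: "adj F x y \<longleftrightarrow> adj ?H x y \<and> ({x, y} = {u0, u1} \<longrightarrow> E b a) \<and> ({x, y} = {u0, u2} \<longrightarrow> E b q)" for x y
    by (auto simp: F_def)
  have inj: "inj_on f V"
    unfolding cov inj_on_Un
  proof (intro conjI)
    show "inj_on f {a, b, q}" using fv d by (auto simp: u0_def u1_def u2_def)
    show "inj_on f S1" using f1(1) fS1 by (auto simp: inj_on_def)
    show "inj_on f S2" using f2(1) fS2 by (auto simp: inj_on_def)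
    show "f ` ({a, b, q} - S1) \<inter> f ` (S1 - {a, b, q}) = {}"
      using fv fS1 by (auto simp: u0_def u1_def u2_def)
    show "f ` ({a, b, q} \<union> S1 - S2) \<inter> f ` (S2 - ({a, b, q} \<union> S1)) = {}"
      using fv fS1 fS2 by (auto simp: u0_def u1_def u2_def)
  qed
  have "f ` S1 = Inl ` Inl ` Inl ` ({..<b1} \<times> {..<k - 1})"
    unfolding f1(2)[symmetric] image_image using fS1 by (rule image_cong[OF refl])
  moreover have "f ` S2 = Inl ` Inr ` Inl ` ({..<b2} \<times> {..<k - 1})"
    unfolding f2(2)[symmetric] image_image using fS2 by (rule image_cong[OF refl])
  moreover have "f ` {a, b, q} = {u0, u1, u2}" using fv by auto
  ultimately have "f ` V = {u0, u1, u2} \<union> Inl ` Inl ` Inl ` ({..<b1} \<times> {..<k - 1}) \<union>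
      Inl ` Inr ` Inl ` ({..<b2} \<times> {..<k - 1})"
    unfolding cov image_Un by simp
  also have "\<dots> = verts ?H" by (auto simp: H1_base_def u0_def u1_def u2_def image_Un)
  finally have img: "f ` V = verts F" using vF by simp
  have adjH: "adj ?H x y \<longleftrightarrow> {x, y} = {u1, u2} \<or>
      adj (((copies b1 (complete_graph (k - 1)) +\<^sub>g complete_graph 1) \<union>\<^sub>g
         (copies b2 (complete_graph (k - 1)) +\<^sub>g complete_graph 1)) +\<^sub>g complete_graph 1) x y" for x y
    by (auto simp: H1_base_def)
  have fr1: "fst (f1 v) < b1" "snd (f1 v) < k - 1" if "v \<in> S1" for v
  proof -
    have "f1 v \<in> {..<b1} \<times> {..<k - 1}" using f1(2) that by blast
    then show "fst (f1 v) < b1" "snd (f1 v) < k - 1" by auto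
  qed
  have fr2: "fst (f2 v) < b2" "snd (f2 v) < k - 1" if "v \<in> S2" for v
  proof -
    have "f2 v \<in> {..<b2} \<times> {..<k - 1}" using f2(2) that by blast
    then show "fst (f2 v) < b2" "snd (f2 v) < k - 1" by auto
  qed
  \<comment> \<open>Both sides are symmetric, so one order of each pair suffices; the kinds are
    ordered as \<open>b\<close>, \<open>a\<close>, \<open>q\<close>, \<open>S1\<close>,
    \<open>S2\<close>.\<close>
  have half: "E u v \<longleftrightarrow> adj F (f u) (f v)"
    if "u = b \<or> u = a \<and> v \<noteq> b \<or> u = q \<and> v \<noteq> b \<and> v \<noteq> a \<or> u \<in> S1 \<and> v \<in> S1 \<or> u \<in> S1 \<and> v \<in> S2 \<or> u \<in> S2 \<and> v \<in> S2"
      and v: "v \<in> V" for u v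
  proof -
    have vc: "v = b \<or> v = a \<or> v = q \<or> v \<in> S1 \<or> v \<in> S2" using v cov by blast
    from that(1) consider "u = b" | "u = a" "v \<noteq> b" | "u = q" "v \<noteq> b" "v \<noteq> a" | "u \<in> S1" "v \<in> S1"
      | "u \<in> S1" "v \<in> S2" | "u \<in> S2" "v \<in> S2" by blast
    then show ?thesis
    proof cases
      case 1
      then show ?thesis using vc irr E1[of v] E2[of v] Esym[of b v] fr1[of v] fr2[of v]
        by (auto simp: aF adjH fv fS1 fS2 u0_def u1_def u2_def doubleton_eq_iff mem_Times_iff)
    next
      case 2
      then show ?thesis using vc irr E1[of v] E2[of v] Esym[of a v] fr1[of v] fr2[of v] Eaq
        by (auto simp: aF adjH fv fS1 fS2 u0_def u1_def u2_def doubleton_eq_iff mem_Times_iff)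
    next
      case 3
      then show ?thesis using vc irr E1[of v] E2[of v] Esym[of q v] fr1[of v] fr2[of v]
        by (auto simp: aF adjH fv fS1 fS2 u0_def u1_def u2_def doubleton_eq_iff mem_Times_iff)
    next
      case 4
      then show ?thesis using f1(3)
        by (simp add: aF adjH fS1 u0_def u1_def u2_def doubleton_eq_iff)
    next
      case 5
      then show ?thesis using E1[of u]
        by (simp add: aF adjH fS1 fS2 u0_def u1_def u2_def doubleton_eq_iff)
    next
      case 6
      then show ?thesis using f2(3)
        by (simp add: aF adjH fS2 u0_def u1_def u2_def doubleton_eq_iff)
    qed
  qed
  have "adj F x y \<longleftrightarrow> adj F y x" for x y by (simp add: adj_def insert_commute)
  then have "E u v \<longleftrightarrow> adj F (f u) (f v)" if "u \<in> V" "v \<in> V" for u v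
    using half[of u v] half[of v u] that Esym[of u v] cov by blast
  then have "matches V E F" unfolding matches_def bij_betw_def using inj img by blast
  moreover have "F \<in> H1_class (card V) k"
  proof -
    have "card V = card {a, b, q} + card (S1 \<union> S2)"
      using card_Un_disjoint[of "{a, b, q}" "S1 \<union> S2"] cov dis fin_sub[OF SV(1)] fin_sub[OF SV(2)]
      by (simp add: Un_assoc)
    also have "card {a, b, q} = 3" using d by simp
    also have "card (S1 \<union> S2) = (b1 + b2) * (k - 1)"
      using card_Un_disjoint[OF fin_sub[OF SV(1)] fin_sub[OF SV(2)] dis(7)] b1(1) b2(1)
      by (simp only: add_mult_distrib)
    finally have n: "card V = (b1 + b2) * (k - 1) + 3" by simp
    moreover have "0 < b1 + b2" using n V by (cases "b1 + b2") auto
    moreover have "F \<in> {?H, remove_edge u0 u1 ?H, remove_edge u0 u2 ?H,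
        remove_edge u0 u1 (remove_edge u0 u2 ?H)}" by (auto simp: F_def)
    ultimately show ?thesis unfolding H1_class_def by blast
  qed
  ultimately show ?thesis by blast
qed

end

section \<open>From graph records to the abstract setting\<close>

context dirac_graph
begin

text \<open>Rules out the default value 0 of the circumference. For the ends of an edge, both
  outcomes of \<open>long_link_or_cliques\<close> give a path that the edge closes to a
  cycle.\<close>

lemma cycle_exists:
  assumes "3 \<le> card V" "2 \<le> k"
  shows "\<exists>p. cyc p"
proof -
  obtain x where x: "x \<in> V" using assms(1) by fastforce
  have "nb x \<noteq> {}" using deg_nb[OF x] assms(2) by auto
  then obtain y where y: "E x y" using nb_iff by blast
  have xy: "x \<noteq> y" "y \<in> V" using y irr EV by auto
  let ?S = "V - {x, y}"
  have iV: "insert x (insert y ?S) = V" using x xy by blast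
  have "card ?S = card V - 2" using x xy by (simp add: card_Diff_subset)
  then have "0 < card ?S" using assms(1) by linarith
  then have ne: "?S \<noteq> {}" using card_gt_0_iff by blast
  have "(\<exists>p. link E ?S x y p \<and> k \<le> length p) \<or> (\<forall>v\<in>?S. E x v \<and> E v y) \<and> cliques E ?S (k - 1)"
  proof (rule long_link_or_cliques[OF sym irr])
    fix T assume T: "T \<subseteq> ?S" "T \<noteq> {}"
    have "{x, y} \<subseteq> V - T" using T x xy by blast
    then have "2 \<le> card (V - T)" using card_mono[of "V - T" "{x, y}"] finV xy by simp
    then show "2 \<le> card (outer E (insert x (insert y ?S)) T)" unfolding iV using cut[of T] T by blast
  next
    fix v assume "v \<in> ?S"
    moreover have "{w \<in> V. E v w} = {w. E v w}" using EV by blast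
    ultimately show "k \<le> card {w \<in> insert x (insert y ?S). E v w}" unfolding iV using deg[of v] by simp
  qed (use finV ne xy in auto)
  then have "\<exists>p. link E ?S x y p"
  proof
    assume "(\<forall>v\<in>?S. E x v \<and> E v y) \<and> cliques E ?S (k - 1)"
    moreover obtain v where "v \<in> ?S" using ne by blast
    ultimately have "link E ?S x y [v]" by (auto simp: link_def successively_Cons)
    then show ?thesis by blast
  qed blast
  then obtain p where p: "link E ?S x y p" by blast
  have "cyc (x # p @ [y])" unfolding cyc_def
  proof (intro conjI)
    show "3 \<le> length (x # p @ [y])" using p by (cases p) (auto simp: link_def)
    show "distinct (x # p @ [y])" using p xy by (auto simp: link_def)
    show "successively E (x # p @ [y])" using p by (simp add: link_def)
    show "E (last (x # p @ [y])) (hd (x # p @ [y]))" using sym[OF y] by simp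
  qed
  then show ?thesis by blast
qed

end

text \<open>Fewer than two outer neighbours would form a separator: after deleting them nothing
  outside \<open>T\<close> can be reached from \<open>T\<close>, although a vertex remains
  there.\<close>

lemma cut_of_vertex_connected:
  assumes G: "simple_graph G" and conn: "vertex_connected 2 G"
    and T: "T \<subseteq> verts G" "T \<noteq> {}" "2 \<le> card (verts G - T)"
  shows "2 \<le> card (outer (adj G) (verts G) T)"
proof (rule ccontr)
  let ?X = "outer (adj G) (verts G) T"
  assume "\<not> ?thesis"
  then have c: "card ?X < 2" by simp
  have XV: "?X \<subseteq> verts G" "?X \<inter> T = {}" by (auto simp: outer_def)
  have con: "connected_graph (delete_verts G ?X)" using conn XV(1) c unfolding vertex_connected_def by blast
  obtain t where t: "t \<in> T" using T(2) by blast
  have fV: "finite (verts G)" using G by (simp add: simple_graph_def)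
  have "\<not> verts G - T \<subseteq> ?X"
  proof
    assume "verts G - T \<subseteq> ?X"
    moreover have "finite ?X" using XV(1) fV finite_subset by blast
    ultimately have "card (verts G - T) \<le> card ?X" by (intro card_mono)
    then show False using T(3) c by simp
  qed
  then obtain u where u: "u \<in> verts G" "u \<notin> T" "u \<notin> ?X" by blast
  have "t \<in> verts (delete_verts G ?X)" "u \<in> verts (delete_verts G ?X)"
    using t u XV T(1) by (auto simp: delete_verts_def)
  then have "(adj (delete_verts G ?X))\<^sup>*\<^sup>* t u" using con by (simp add: connected_graph_def)
  then have "u \<in> T"
  proof (induction rule: rtranclp_induct)
    case (step y z)
    have yz: "adj G y z" "z \<notin> ?X" using step.hyps(2) by (auto simp: adj_def delete_verts_def)
    have "z \<in> verts G" using yz(1) G by (auto simp: adj_def simple_graph_def)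
    then show ?case using yz step.IH by (auto simp: outer_def)
  qed (rule t)
  then show False using u by blast
qed

lemma dirac_graph_of_graph:
  assumes G: "simple_graph G" and conn: "vertex_connected 2 G" and k: "min_degree G = k"
  shows "dirac_graph (verts G) (adj G) k" "2 \<le> k"
proof -
  have fV: "finite (verts G)" using G by (simp add: simple_graph_def)
  have V3: "3 \<le> card (verts G)" using conn by (simp add: vertex_connected_def)
  have EV: "u \<in> verts G \<and> v \<in> verts G" if "adj G u v" for u v
    using that G by (auto simp: adj_def simple_graph_def)
  have nbs: "{w \<in> verts G. adj G v w} = {w. adj G v w}" for v using EV by blast
  show "dirac_graph (verts G) (adj G) k"
  proof
    show "\<not> adj G u u" for u using G by (auto simp: adj_def simple_graph_def)
    show "adj G u v \<Longrightarrow> adj G v u" for u v by (simp add: adj_def insert_commute)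
    show "k \<le> card {w. adj G v w}" if "v \<in> verts G" for v
    proof -
      have "min_degree G \<le> degree G v" unfolding min_degree_def using fV that by (intro Min_le) auto
      then show ?thesis using k nbs by (simp add: degree_def)
    qed
  qed (use fV EV cut_of_vertex_connected[OF G conn] in auto)
  have "verts G \<noteq> {}" using V3 by auto
  then have "min_degree G \<in> degree G ` verts G" unfolding min_degree_def using fV by (intro Min_in) auto
  then obtain v where v: "v \<in> verts G" "degree G v = k" using k by auto
  have "card (verts G - {v}) = card (verts G) - 1" using v by (simp add: card_Diff_singleton)
  \<comment> \<open>The cut condition for a single vertex of minimum degree yields two
    neighbours.\<close>
  then have "2 \<le> card (outer (adj G) (verts G) {v})"
    using cut_of_vertex_connected[OF G conn, of "{v}"] v(1) V3 by simp
  also have "\<dots> \<le> card {w \<in> verts G. adj G v w}"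
    using fV by (intro card_mono) (auto simp: outer_def)
  finally show "2 \<le> k" using v(2) by (simp add: degree_def)
qed

lemma is_cycle_iff:
  assumes "dirac_graph (verts G) (adj G) k"
  shows "is_cycle G p \<longleftrightarrow> dirac_graph.cyc (adj G) p"
proof -
  interpret dirac_graph "verts G" "adj G" k by (rule assms)
  show ?thesis
  proof
    assume p: "is_cycle G p"
    then have p1: "3 \<le> length p" "distinct p" and a: "\<And>i. i < length p \<Longrightarrow> adj G (p ! i) (p ! (Suc i mod length p))"
      by (auto simp: is_cycle_def)
    have "successively (adj G) p" unfolding successively_conv_nth
    proof (intro allI impI)
      fix i assume "Suc i < length p"
      then show "adj G (p ! i) (p ! Suc i)" using a[of i] by simp
    qed
    moreover have "adj G (last p) (hd p)"
    proof -
      have ne: "p \<noteq> []" using p1(1) by auto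
      have "adj G (p ! (length p - 1)) (p ! (Suc (length p - 1) mod length p))" using a[of "length p - 1"] ne by simp
      then show ?thesis using ne by (simp add: last_conv_nth hd_conv_nth)
    qed
    ultimately show "cyc p" using p1 by (simp add: cyc_def)
  next
    assume p: "cyc p"
    then have p1: "3 \<le> length p" "distinct p" "successively (adj G) p" "adj G (last p) (hd p)" by (auto simp: cyc_def)
    have ne: "p \<noteq> []" using p1(1) by auto
    have "adj G (p ! i) (p ! (Suc i mod length p))" if i: "i < length p" for i
    proof (cases "Suc i < length p")
      case True
      then show ?thesis using p1(3) by (simp add: successively_conv_nth)
    next
      case False
      then have "Suc i = length p" using i by simp
      then have "i = length p - 1" "Suc i mod length p = 0" by auto
      then show ?thesis using p1(4) ne by (simp add: last_conv_nth hd_conv_nth)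
    qed
    then show "is_cycle G p" using p1 cyc_V[OF p] by (simp add: is_cycle_def)
  qed
qed

lemma subgraph_of_iff: "G \<subseteq>\<^sub>g F \<longleftrightarrow> embeds (verts G) (adj G) F"
  by (simp add: subgraph_of_def embeds_def)

lemma iso_member_iff: "G \<in>\<^sub>g \<H> \<longleftrightarrow> (\<exists>F\<in>\<H>. matches (verts G) (adj G) F)"
  by (simp add: iso_member_def graph_iso_def matches_def)

theorem theorem4:
  fixes G :: "'a ugraph" and n k :: nat
  assumes "simple_graph G"
    and "vertex_connected 2 G"
    and "card (verts G) = n"
    and "n \<ge> circumference G + 1"
    and "min_degree G = k"
  shows
    "circumference G \<ge> 2 * k + 2 \<or>
     (circumference G = 2 * k + 1 \<and>
       (G \<subseteq>\<^sub>g H_graph n (2 * k + 1) \<or>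
        G \<in>\<^sub>g H1_class n k \<or>
        (\<exists>a. n = a * (k - 1) + k + 2 \<and>
             G \<subseteq>\<^sub>g complete_graph 2 +\<^sub>g
                 (complete_graph k \<union>\<^sub>g copies a (complete_graph (k - 1)))) \<or>
        (k = 4 \<and>
          (\<exists>a. n = 2 * a + 3 \<and> G \<subseteq>\<^sub>g complete_graph 3 +\<^sub>g copies a (complete_graph 2))) \<or>
        (k = 3 \<and>
          (\<exists>t. n \<ge> 3 + 2 * t \<and>
               G \<subseteq>\<^sub>g complete_graph 2 +\<^sub>g
                   (star (n - 3 - 2 * t) \<union>\<^sub>g copies t (complete_graph 2)))))) \<or>
     (circumference G = 2 * k \<and>
       (G \<subseteq>\<^sub>g H_graph n (2 * k) \<or> G \<in>\<^sub>g H2_class n k))"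
proof (cases "2 * k + 2 \<le> circumference G")
  case False
  let ?V = "verts G" let ?E = "adj G" let ?c = "circumference G"
  note dg = dirac_graph_of_graph[OF assms(1,2,5)]
  interpret dirac_graph ?V ?E k by (rule dg(1))
  have V3: "3 \<le> card ?V" using assms(2) by (simp add: vertex_connected_def)
  note cyc_iff = is_cycle_iff[OF dg(1)]
  let ?L = "insert 0 {length p |p. is_cycle G p}"
  have "?L \<subseteq> {..card ?V}"
  proof -
    have "length p \<le> card ?V" if "is_cycle G p" for p
    proof -
      have p: "distinct p" "set p \<subseteq> ?V" using that by (auto simp: is_cycle_def)
      show ?thesis using card_mono[OF finV p(2)] distinct_card[OF p(1)] by simp
    qed
    then show ?thesis by auto
  qed
  then have finL: "finite ?L" by (rule finite_subset) simp
  have le: "length p \<le> ?c" if "cyc p" for p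
  proof -
    have "is_cycle G p" using cyc_iff that by simp
    then have "length p \<in> ?L" by blast
    then show ?thesis unfolding circumference_def by (rule Max_ge[OF finL])
  qed
  obtain p0 where p0: "cyc p0" using cycle_exists[OF V3 dg(2)] by blast
  \<comment> \<open>The maximum is attained and positive, so it is the length of a cycle.\<close>
  have "?c \<in> ?L" unfolding circumference_def by (rule Max_in[OF finL]) simp
  moreover have "0 < ?c" using le[OF p0] p0 by (simp add: cyc_def)
  ultimately obtain C where C: "cyc C" "length C = ?c" using cyc_iff by auto
  interpret short_circumference ?V ?E k ?c
    by unfold_locales (use le False assms(3,4) in auto)
  have lC: "lcyc C" using C by (simp add: lcyc_def)
  have V4: "4 \<le> card ?V" using assms(3,4) C by (simp add: cyc_def)
  show ?thesis
  proof (cases "?c = 2 * k")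
    case True
    have "G \<subseteq>\<^sub>g H_graph n (2 * k) \<or> G \<in>\<^sub>g H2_class n k"
      using even_structure[OF lC True]
    proof
      assume "\<exists>A. A \<subseteq> ?V \<and> card A = k \<and> (\<forall>u\<in>?V - A. \<forall>v\<in>?V - A. \<not> ?E u v)"
      then obtain A where "A \<subseteq> ?V" "card A = k" "\<forall>u\<in>?V - A. \<forall>v\<in>?V - A. \<not> ?E u v"
        by (elim exE conjE)
      from embeds_H_even[OF this] show ?thesis unfolding subgraph_of_iff assms(3) ..
    next
      assume "\<exists>a b. a \<in> ?V \<and> b \<in> ?V \<and> a \<noteq> b \<and> (\<forall>v\<in>?V - {a, b}. clq {a, b} (k - 1) v)"
      then obtain a b where "a \<in> ?V" "b \<in> ?V" "a \<noteq> b" "\<forall>v\<in>?V - {a, b}. clq {a, b} (k - 1) v"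
        by (elim exE conjE)
      from matches_H2[OF this V3] show ?thesis unfolding iso_member_iff assms(3) ..
    qed
    then show ?thesis using True by blast
  next
    case c1: False
    then have odd: "?c = 2 * k + 1" using circumference_cases[OF lC] by blast
    from odd_structure[OF lC odd] show ?thesis
    proof (elim disjE exE conjE)
      fix A g g'
      assume *: "A \<subseteq> ?V" "card A = k" "g \<in> ?V - A" "g' \<in> ?V - A" "g \<noteq> g'"
        "\<forall>u\<in>?V - A. \<forall>v\<in>?V - A. ?E u v \<longrightarrow> {u, v} = {g, g'}"
      have "G \<subseteq>\<^sub>g H_graph n (2 * k + 1)" unfolding subgraph_of_iff using embeds_H_odd[OF *] assms(3) by simp
      then show ?thesis using odd by blast
    next
      fix a b q
      assume *: "distinct [a, b, q]" "{a, b, q} \<subseteq> ?V" "?E a q"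
        "\<forall>v\<in>?V - {a, b, q}. clq {a, b} (k - 1) v \<and> q \<notin> nb v \<or> clq {b, q} (k - 1) v \<and> a \<notin> nb v"
      have "G \<in>\<^sub>g H1_class n k" unfolding iso_member_iff using matches_H1[OF * V4] assms(3) by simp
      then show ?thesis using odd by blast
    next
      fix a b S
      assume *: "a \<in> ?V" "b \<in> ?V" "a \<noteq> b" "S \<subseteq> ?V - {a, b}" "card S = k"
        "\<forall>v\<in>?V - {a, b} - S. clq {a, b} (k - 1) v \<and> nb v \<inter> S = {}"
      have AV: "{a, b} \<subseteq> ?V" "card {a, b} = 2" using * by auto
      have "finite S" using *(4) fin_sub by blast
      from embeds_join_rest[OF AV *(4) embeds_complete[OF this *(5) irr] *(6)]
      obtain r where r: "card ?V = 2 + card S + r * (k - 1)"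
        "embeds ?V ?E (complete_graph 2 +\<^sub>g (complete_graph k \<union>\<^sub>g copies r (complete_graph (k - 1))))"
        by blast
      have "n = r * (k - 1) + k + 2" using r(1) *(5) assms(3) by simp
      then show ?thesis using odd r(2) unfolding subgraph_of_iff by blast
    next
      fix a b q S
      assume k: "k = 3" and *: "a \<in> ?V" "b \<in> ?V" "a \<noteq> b" "q \<in> S" "S \<subseteq> ?V - {a, b}"
        "\<forall>u\<in>S. \<forall>v\<in>S. ?E u v \<longrightarrow> u = q \<or> v = q"
        "\<forall>v\<in>?V - {a, b} - S. clq {a, b} 2 v \<and> nb v \<inter> S = {}"
      have AV: "{a, b} \<subseteq> ?V" "card {a, b} = 2" using * by auto
      have finS: "finite S" using *(5) fin_sub by blast
      then have cS: "card S = Suc (card S - 1)" using *(4) card_gt_0_iff[of S] by auto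
      have star: "embeds S ?E (star (card S - 1))"
        by (rule embeds_star[OF finS cS *(4) irr]) (use *(6) in blast)
      from embeds_join_rest[OF AV *(5) star *(7)]
      obtain t where t: "card ?V = 2 + card S + t * 2"
        "embeds ?V ?E (complete_graph 2 +\<^sub>g (star (card S - 1) \<union>\<^sub>g copies t (complete_graph 2)))"
        by blast
      have n: "n = 2 + card S + 2 * t" using t(1) assms(3) by simp
      \<comment> \<open>The 3 accounts for \<open>a\<close>, \<open>b\<close> and the centre of the
        star; its leaves are what remains after the \<open>t\<close> pairs.\<close>
      then have "card S - 1 = n - 3 - 2 * t" "3 + 2 * t \<le> n" using cS by simp_all
      then have "3 + 2 * t \<le> n \<and> embeds ?V ?E (complete_graph 2 +\<^sub>g
          (star (n - 3 - 2 * t) \<union>\<^sub>g copies t (complete_graph 2)))" using t(2) by simp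
      then show ?thesis using odd k unfolding subgraph_of_iff by blast
    next
      fix A
      assume k: "k = 4" and *: "A \<subseteq> ?V" "card A = 3" "\<forall>v\<in>?V - A. clq A 2 v"
      obtain r where r: "card ?V = 3 + r * 2" "embeds ?V ?E (complete_graph 3 +\<^sub>g copies r (complete_graph 2))"
        using embeds_join_copies[OF *] by blast
      have "n = 2 * r + 3" using r(1) assms(3) by simp
      then show ?thesis using odd k r(2) unfolding subgraph_of_iff by blast
    qed
  qed
qed blast

end
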